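(* Let $M$ be the rank $k$ Heisenberg vertex operator algebra built on $H=\mathbf{C}^k$ with nondegenerate symmetric bilinear form $(\cdot,\cdot)$, let $h_1,\dots,h_k$ be an orthonormal basis of $H$, and let $M^+$ be the fixed-point subVOA of the canonical involution $t$ of $M$. Let $p\ge 0$ be even, let $n_1,\dots,n_p$ be positive integers and $i_1,\dots,i_p\in\{1,\dots,k\}$. Then \[ Z_{M^+}(h_{i_1}[-n_1]\cdots h_{i_p}[-n_p]\mathbf{1},\tau)=\Big(\sum_{\sigma}\prod_{(rs)}\delta_{i_r,i_s}\widehat{F}_{n_r+n_s}(\tau)\Big)Z_{M^+}(\tau)+\frac12\Big(\sum_{\sigma}\Big(\prod_{(rs)}\delta_{i_r,i_s}\widehat{E}_{n_r+n_s}(\tau)-\prod_{(rs)}\delta_{i_r,i_s}\widehat{F}_{n_r+n_s}(\tau)\Big)\Big)Z_M(\tau), \] where $\sigma$ ranges over the fixed-point-free involutions of the index set $\{1,\dots,p\}$ and, for each $\sigma$, the products range over the transpositions $(rs)$ whose product is $\sigma$.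
   Context: $M$ has Fock space $S(H_1\oplus H_2\oplus\cdots)$ and is spanned by states $h_{j_1}(-m_1)\cdots h_{j_q}(-m_q)\mathbf 1$ ($m_i\ge1$), with modes satisfying $[h_i(m),h_j(n)]=\delta_{ij}\delta_{m,-n}m$; its central charge is $c=k$. The involution $t$ acts by $h_{j_1}(-m_1)\cdots h_{j_q}(-m_q)\mathbf 1\mapsto(-1)^q h_{j_1}(-m_1)\cdots h_{j_q}(-m_q)\mathbf 1$, and $M^+$ is its $+1$-eigenspace. For a VOA $V$ with vertex operators $Y(v,z)=\sum_n v(n)z^{-n-1}$ and Virasoro operator $L(0)$, the square bracket modes are defined by $Y[v,z]=\sum_{n}v[n]z^{-n-1}:=Y(e^{zL(0)}v,e^z-1)$. For $v$ of $L(0)$-weight $w$, the zero mode is $o(v)=v(w-1)$, extended linearly. For a VOA (or module) $W$ of central charge $c$, $Z_W(u,\tau)=\mathrm{Tr}_W\, o(u)q^{L(0)-c/24}$ with $q=e^{2\pi i\tau}$, and $Z_W(\tau)=Z_W(\mathbf 1,\tau)$; here $Z_M(\tau)=\eta(\tau)^{-k}$ and $Z_{M^+}(\tau)=\tfrac12(\eta(\tau)^{-k}+\eta(\tau)^k/\eta(2\tau)^k)$, with $\eta$ the Dedekind eta function. Eisenstein series: $E_k(\tau)=-\frac{B_k}{k!}+\frac{2}{(k-1)!}\sum_{n\ge1}\sigma_{k-1}(n)q^n$ for $k$ even and $E_k=0$ for $k$ odd ($B_k$ Bernoulli numbers, $\sigma_{k-1}(n)=\sum_{d\mid n}d^{k-1}$),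 $F_k(\tau)=2E_k(2\tau)-E_k(\tau)$. For positive integers $a,b$: $\widehat E_{a+b}(\tau)=(-1)^{b+1}b\binom{a+b-1}{b}E_{a+b}(\tau)$ and $\widehat F_{a+b}(\tau)=(-1)^{b+1}b\binom{a+b-1}{b}F_{a+b}(\tau)$ (symmetric in $a,b$; the notation depends on the pair $(a,b)$, not only on $a+b$). Convention for $p=0$: the identity is the unique fixed-point-free involution of the empty set and empty products equal $1$. *)

theory Defs
  imports "HOL-Analysis.Analysis"
          "HOL-Computational_Algebra.Formal_Laurent_Series"
          "HOL-Library.Multiset"
begin

text \<open>A basis monomial h_{j1}(-m1)...h_{jq}(-mq)1 (m_i \<ge> 1) is encoded as the multiset
  of pairs (j_i, m_i).  A vector of M is a (finitely supported) function from monomials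
  to complex coefficients.\<close>

type_synonym mono = "(nat \<times> nat) multiset"
type_synonym vec = "mono \<Rightarrow> complex"

definition vac :: vec where
  "vac = (\<lambda>\<mu>. if \<mu> = {#} then 1 else 0)"

definition basis_vec :: "mono \<Rightarrow> vec" where
  "basis_vec \<nu> = (\<lambda>\<mu>. if \<mu> = \<nu> then 1 else 0)"

definition wt :: "mono \<Rightarrow> nat" where
  "wt \<mu> = sum_mset (image_mset snd \<mu>)"

text \<open>Heisenberg modes h_j(a), a \<in> Z, acting on M, with
  [h_i(m),h_j(n)] = \<delta>_{ij} \<delta>_{m,-n} m and h_j(0) = 0 on M:
  h_j(-m) (m>0) multiplies by the generator, h_j(m) (m>0) acts as m d/dh_j(-m).\<close>
definition hmode :: "nat \<Rightarrow> int \<Rightarrow> vec \<Rightarrow> vec" where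
  "hmode j a v =
     (if a < 0 then (\<lambda>\<mu>. if (j, nat (-a)) \<in># \<mu> then v (\<mu> - {#(j, nat (-a))#}) else 0)
      else if a > 0 then (\<lambda>\<mu>. of_int a * of_nat (count \<mu> (j, nat a) + 1) * v (\<mu> + {#(j, nat a)#}))
      else (\<lambda>\<mu>. 0))"

definition normal_ord :: "(nat \<times> int) list \<Rightarrow> vec \<Rightarrow> vec" where
  "normal_ord ps w =
     foldr (\<lambda>(j,a). hmode j a) (filter (\<lambda>(j,a). a \<le> 0) ps)
       (foldr (\<lambda>(j,a). hmode j a) (filter (\<lambda>(j,a). a > 0) ps) w)"

text \<open>Vertex operator of a basis monomial:
  Y(h_{j1}(-m1)...h_{jq}(-mq)1, z) = : \<Prod>_r (1/(m_r-1)!) \<partial>^{m_r-1} h_{j_r}(z) :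
  where (1/(m-1)!) \<partial>^{m-1} h(z) = \<Sum>_a binom(-a-1, m-1) h(a) z^{-a-m}.
  Hence the mode \<mu>(n) (coefficient of z^{-n-1}) is the sum over (a_1..a_q) with
  \<Sum> a_r = n + 1 - wt \<mu>.  The infinite sum is taken pointwise (it has only finitely
  many nonzero terms on finitely supported vectors).  The generators are listed in an
  arbitrary order (any list enumerating the multiset); the normal ordered product does
  not depend on it.\<close>
definition vmode_mono :: "mono \<Rightarrow> int \<Rightarrow> vec \<Rightarrow> vec" where
  "vmode_mono \<mu> n w = (\<lambda>\<nu>.
     (let gs = (SOME gs. mset gs = \<mu>) in
      infsum (\<lambda>as. (\<Prod>r<length gs. (of_int (- as ! r - 1) gchoose (snd (gs ! r) - 1)) :: complex)
                   * normal_ord (zip (map fst gs) as) w \<nu>)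
             {as. length as = length gs \<and> sum_list as = n + 1 - int (wt \<mu>)}))"

definition zero_mode :: "vec \<Rightarrow> vec \<Rightarrow> vec" where
  "zero_mode v w = (\<lambda>\<nu>. \<Sum>\<mu> | v \<mu> \<noteq> 0. v \<mu> * vmode_mono \<mu> (int (wt \<mu>) - 1) w \<nu>)"

text \<open>For h_j = h_j(-1)1 of L(0)-weight 1: Y[h_j,z] = Y(e^{zL(0)} h_j, e^z - 1)
  = e^z \<Sum>_m h_j(m) (e^z-1)^{-m-1}, so
  h_j[n] = \<Sum>_m [z^{-n-1}] (e^z (e^z-1)^{-m-1}) h_j(m), computed in Laurent series.\<close>
definition sq_coeff :: "int \<Rightarrow> int \<Rightarrow> complex" where
  "sq_coeff n m = fls_nth (fps_to_fls (fps_exp 1) *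
                     (fps_to_fls (fps_exp 1) - 1) powi (- m - 1)) (- n - 1)"

definition sq_hmode :: "nat \<Rightarrow> int \<Rightarrow> vec \<Rightarrow> vec" where
  "sq_hmode j n v = (\<lambda>\<nu>. infsum (\<lambda>m. sq_coeff n m * hmode j m v \<nu>) UNIV)"

definition sq_state :: "nat \<Rightarrow> (nat \<Rightarrow> nat) \<Rightarrow> (nat \<Rightarrow> nat) \<Rightarrow> vec" where
  "sq_state p i n = foldr (\<lambda>r w. sq_hmode (i r) (- int (n r)) w) [1..<Suc p] vac"

text \<open>Basis monomials of M of weight N (indices in 1..k), and of M^+ (the +1 eigenspace of
  t, spanned by the monomials with an even number of factors).\<close>
definition basis_M :: "nat \<Rightarrow> nat \<Rightarrow> mono set" where
  "basis_M k N = {\<mu>. (\<forall>x\<in>#\<mu>. fst x \<in> {1..k} \<and> snd x \<ge> 1) \<and> wt \<mu> = N}"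

definition basis_Mplus :: "nat \<Rightarrow> nat \<Rightarrow> mono set" where
  "basis_Mplus k N = {\<mu> \<in> basis_M k N. even (size \<mu>)}"

text \<open>Z_W(u,\<tau>) = Tr_W o(u) q^{L(0) - c/24}, q = e^{2 \<pi> i \<tau>}, c = k.\<close>
definition Zfun :: "(nat \<Rightarrow> mono set) \<Rightarrow> nat \<Rightarrow> vec \<Rightarrow> complex \<Rightarrow> complex" where
  "Zfun B k u \<tau> = (\<Sum>N. (\<Sum>\<mu>\<in>B N. zero_mode u (basis_vec \<mu>) \<mu>)
                        * exp (2 * pi * \<i> * \<tau> * (of_nat N - of_nat k / 24)))"

definition Z_M :: "nat \<Rightarrow> vec \<Rightarrow> complex \<Rightarrow> complex" where
  "Z_M k u \<tau> = Zfun (basis_M k) k u \<tau>"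

definition Z_Mplus :: "nat \<Rightarrow> vec \<Rightarrow> complex \<Rightarrow> complex" where
  "Z_Mplus k u \<tau> = Zfun (basis_Mplus k) k u \<tau>"

definition bernoulli_num :: "nat \<Rightarrow> complex" where
  "bernoulli_num n = fact n * fls_nth (fls_X / (fps_to_fls (fps_exp 1) - 1)) (int n)"

definition divisor_sigma :: "nat \<Rightarrow> nat \<Rightarrow> nat" where
  "divisor_sigma a n = (\<Sum>d | d dvd n. d ^ a)"

definition eisenstein :: "nat \<Rightarrow> complex \<Rightarrow> complex" where
  "eisenstein k \<tau> =
     (if even k then - bernoulli_num k / fact k
        + 2 / fact (k - 1) * (\<Sum>n. of_nat (divisor_sigma (k - 1) (Suc n))
                                  * exp (2 * pi * \<i> * \<tau>) ^ Suc n)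
      else 0)"

definition eisF :: "nat \<Rightarrow> complex \<Rightarrow> complex" where
  "eisF k \<tau> = 2 * eisenstein k (2 * \<tau>) - eisenstein k \<tau>"

definition hatE :: "nat \<Rightarrow> nat \<Rightarrow> complex \<Rightarrow> complex" where
  "hatE a b \<tau> = (-1) ^ (b + 1) * of_nat b * of_nat ((a + b - 1) choose b) * eisenstein (a + b) \<tau>"

definition hatF :: "nat \<Rightarrow> nat \<Rightarrow> complex \<Rightarrow> complex" where
  "hatF a b \<tau> = (-1) ^ (b + 1) * of_nat b * of_nat ((a + b - 1) choose b) * eisF (a + b) \<tau>"

definition fpf_involutions :: "nat \<Rightarrow> (nat \<Rightarrow> nat) set" where
  "fpf_involutions p = {\<sigma>. (\<forall>r\<in>{1..p}. \<sigma> r \<in> {1..p} \<and> \<sigma> r \<noteq> r \<and> \<sigma> (\<sigma> r) = r)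
                          \<and> (\<forall>r. r \<notin> {1..p} \<longrightarrow> \<sigma> r = r)}"

definition pair_prod :: "nat \<Rightarrow> (nat \<Rightarrow> nat) \<Rightarrow> (nat \<Rightarrow> nat \<Rightarrow> complex) \<Rightarrow> complex" where
  "pair_prod p \<sigma> f = (\<Prod>r\<in>{r\<in>{1..p}. r < \<sigma> r}. f r (\<sigma> r))"

end

theory Submission
  imports Defs
begin

text \<open>The trace over \<open>M\<^sup>+\<close> is the average of the traces over \<open>M\<close> weighted by \<open>\<epsilon>\<^sup>l\<close> on
  monomials with \<open>l\<close> factors, \<open>\<epsilon> = 1, -1\<close>, so it suffices to show that each of these traces is a sum over
  pairings times the trace of the identity.  For round-bracket monomials this is Wick's theorem: on
  normally ordered modes the trace pairs each annihilator with an equal creator, with weight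
  \<open>a \<epsilon>q\<^sup>a / (1 - \<epsilon>q\<^sup>a)\<close>.  A square-bracket mode is a multiplication operator plus a derivation;
  pulling it through the trace contracts it with one of the remaining factors.  The modes \<open>a\<close> and \<open>-a\<close>
  contribute the divisor sums of the Eisenstein series to this contraction, because
  \<open>e\<^sup>z (1 + (e\<^sup>z - 1))\<^bsup>-a-1\<^esup> = e\<^bsup>-az\<^esup>\<close>; the commutator of two
  square-bracket modes contributes the Bernoulli constant, as a coefficient of
  \<open>e\<^sup>z e\<^sup>w / (e\<^sup>z - e\<^sup>w)\<^sup>2\<close>.  With \<open>q\<close> formal every sum is finite in each degree, so
  convergence matters only for the characters and the Eisenstein series.\<close>

unbundle no vec_syntax
unbundle fps_syntax

section \<open>Sums over fixed-point-free involutions\<close>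

text \<open>The obstacle is a mismatch of bases: zero modes and vertex operators are given on
  round-bracket monomials, while a product of square-bracket modes is an inhomogeneous combination
  of these. Contractions are therefore performed on states, before any trace is taken. The
  functional \<open>wick\<close> sends a polynomial in the generators to its Gaussian moment, and
  Gaussian integration by parts removes the square-bracket factors one at a time. Sums over pairings
  are hafnians and are recognized only through their expansion along one row
  (\<open>Haf_uniqueI\<close>), so involutions are manipulated just once. Two truncations keep the
  sums finite: \<open>B\<close> bounds the generators occurring in the states, \<open>L\<close> the
  modes occurring in a trace. The second one makes contractions correct only through
  \<open>q^L\<close>, which is why many statements compare coefficients instead of series. The
  series \<open>F_K\<close> comes from the sign in \<open>\<epsilon> ^ (t div a)\<close>: for
  \<epsilon> = -1 the divisor sum at t becomes twice the one at t/2 (if t is even) minus the one at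
  t, which is 2 E_K(2 \<tau>) - E_K(\<tau>).\<close>

definition fpf :: "'a::linorder set \<Rightarrow> ('a \<Rightarrow> 'a) set" where
  "fpf S = {\<sigma>. (\<forall>r\<in>S. \<sigma> r \<in> S \<and> \<sigma> r \<noteq> r \<and> \<sigma> (\<sigma> r) = r) \<and> (\<forall>r. r \<notin> S \<longrightarrow> \<sigma> r = r)}"

text \<open>The hafnian of the matrix \<open>f\<close>. Arbitrary index sets allow two indices to be
  deleted in an induction; the linear order only selects one orientation of each
  transposition.\<close>

definition Haf :: "('a::linorder \<Rightarrow> 'a \<Rightarrow> 'b::comm_semiring_1) \<Rightarrow> 'a set \<Rightarrow> 'b" where
  "Haf f S = (\<Sum>\<sigma>\<in>fpf S. \<Prod>r\<in>{r\<in>S. r < \<sigma> r}. f r (\<sigma> r))"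

lemma finite_fpf:
  assumes "finite S" shows "finite (fpf S)"
proof (rule finite_subset)
  show "fpf S \<subseteq> {\<sigma>. \<sigma> permutes S}"
  proof
    fix \<sigma> assume s: "\<sigma> \<in> fpf S"
    have "\<sigma> (\<sigma> x) = x" for x using s by (cases "x \<in> S") (auto simp: fpf_def)
    then have "\<exists>!x. \<sigma> x = y" for y by metis
    then show "\<sigma> \<in> {\<sigma>. \<sigma> permutes S}"
      using s by (auto simp: fpf_def permutes_def)
  qed
qed (use assms finite_permutations in auto)

lemma fpf_empty [simp]: "fpf {} = {id}"
  by (auto simp: fpf_def)

lemma Haf_empty [simp]: "Haf f {} = 1"
  by (simp add: Haf_def)

lemma Haf_cong:
  assumes "\<And>r s. r \<in> S \<Longrightarrow> s \<in> S \<Longrightarrow> f r s = g r s"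
  shows "Haf f S = Haf g S"
  unfolding Haf_def by (intro sum.cong prod.cong) (use assms in \<open>auto simp: fpf_def\<close>)

lemma bij_betw_fpf_remove_pair:
  assumes "r \<in> S" "s \<in> S" "r \<noteq> s"
  shows "bij_betw (\<lambda>\<sigma>. \<sigma>(r := s, s := r)) (fpf (S - {r, s})) {\<sigma> \<in> fpf S. \<sigma> r = s}"
proof (rule bij_betwI[where g = "\<lambda>\<sigma>. \<sigma>(r := r, s := s)"])
  show "(\<lambda>\<sigma>. \<sigma>(r := s, s := r)) \<in> fpf (S - {r, s}) \<rightarrow> {\<sigma> \<in> fpf S. \<sigma> r = s}"
  proof (intro funcsetI)
    fix \<sigma> assume s: "\<sigma> \<in> fpf (S - {r, s})"
    have *: "\<sigma> x \<in> S" "\<sigma> x \<noteq> r" "\<sigma> x \<noteq> s" "\<sigma> x \<noteq> x" "\<sigma> (\<sigma> x) = x" if "x \<in> S" "x \<noteq> r" "x \<noteq> s" for x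
      using s that by (auto simp: fpf_def)
    have "\<sigma> x = x" if "x \<notin> S" for x using s that by (auto simp: fpf_def)
    with * assms show "\<sigma>(r := s, s := r) \<in> {\<sigma> \<in> fpf S. \<sigma> r = s}"
      by (auto simp: fpf_def)
  qed
  show "(\<lambda>\<sigma>. \<sigma>(r := r, s := s)) \<in> {\<sigma> \<in> fpf S. \<sigma> r = s} \<rightarrow> fpf (S - {r, s})"
  proof (intro funcsetI)
    fix \<sigma> assume s: "\<sigma> \<in> {\<sigma> \<in> fpf S. \<sigma> r = s}"
    have *: "\<sigma> x \<in> S" "\<sigma> x \<noteq> x" "\<sigma> (\<sigma> x) = x" if "x \<in> S" for x
      using s that by (auto simp: fpf_def)
    have **: "\<sigma> x = x" if "x \<notin> S" for x using s that by (auto simp: fpf_def)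
    have "\<sigma> r = s" "\<sigma> s = r" using s assms(1) by (auto simp: fpf_def)
    then have "\<sigma> x \<noteq> r" "\<sigma> x \<noteq> s" if "x \<in> S" "x \<noteq> r" "x \<noteq> s" for x
      using *(3) that assms by metis+
    with * ** show "\<sigma>(r := r, s := s) \<in> fpf (S - {r, s})"
      by (auto simp: fpf_def)
  qed
  fix \<sigma> assume "\<sigma> \<in> fpf (S - {r, s})"
  then have "\<sigma> r = r" "\<sigma> s = s" by (auto simp: fpf_def)
  then show "(\<sigma>(r := s, s := r))(r := r, s := s) = \<sigma>" by (auto simp: fun_eq_iff)
next
  fix \<sigma> assume "\<sigma> \<in> {\<sigma> \<in> fpf S. \<sigma> r = s}"
  then have "\<sigma> r = s" "\<sigma> s = r" using assms by (auto simp: fpf_def)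
  then show "(\<sigma>(r := r, s := s))(r := s, s := r) = \<sigma>" by (auto simp: fun_eq_iff)
qed

text \<open>Involutions are grouped by the partner \<open>s\<close> of \<open>r\<close>, and
  deleting this pair leaves an involution of the rest. Symmetry of \<open>f\<close> enters because
  the product evaluates it at the smaller index first.\<close>

lemma Haf_rec:
  fixes f :: "'a::linorder \<Rightarrow> 'a \<Rightarrow> 'b::comm_semiring_1"
  assumes fin: "finite S" and r: "r \<in> S"
    and sym: "\<And>u v. u \<in> S \<Longrightarrow> v \<in> S \<Longrightarrow> f u v = f v u"
  shows "Haf f S = (\<Sum>s\<in>S - {r}. f r s * Haf f (S - {r, s}))"
proof -
  let ?P = "\<lambda>S \<sigma>. \<Prod>u\<in>{u\<in>S. u < \<sigma> u}. f u (\<sigma> u)"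
  have "Haf f S = (\<Sum>s\<in>S - {r}. \<Sum>\<sigma>\<in>{\<sigma> \<in> fpf S. \<sigma> r = s}. ?P S \<sigma>)"
    unfolding Haf_def
    by (rule sum.group[symmetric]) (use fin finite_fpf r in \<open>auto simp: fpf_def\<close>)
  also have "\<dots> = (\<Sum>s\<in>S - {r}. f r s * Haf f (S - {r, s}))"
  proof (rule sum.cong[OF refl])
    fix s assume s: "s \<in> S - {r}"
    then have sS: "s \<in> S" "r \<noteq> s" by auto
    have "(\<Sum>\<sigma>\<in>{\<sigma> \<in> fpf S. \<sigma> r = s}. ?P S \<sigma>)
          = (\<Sum>\<sigma>\<in>fpf (S - {r, s}). ?P S (\<sigma>(r := s, s := r)))"
      by (rule sum.reindex_bij_betw[OF bij_betw_fpf_remove_pair[OF r sS], symmetric])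
    also have "\<dots> = (\<Sum>\<sigma>\<in>fpf (S - {r, s}). f r s * ?P (S - {r, s}) \<sigma>)"
    proof (rule sum.cong[OF refl])
      fix \<sigma> assume \<sigma>: "\<sigma> \<in> fpf (S - {r, s})"
      let ?\<tau> = "\<sigma>(r := s, s := r)"
      \<comment> \<open>The pair \<open>r\<close>, \<open>s\<close> is counted once, at its smaller
        element.\<close>
      have "{u\<in>S. u < ?\<tau> u} = insert (min r s) {u \<in> S - {r, s}. u < \<sigma> u}"
        using r sS by (auto simp: min_def)
      moreover have "min r s \<notin> {u \<in> S - {r, s}. u < \<sigma> u}" by (auto simp: min_def)
      ultimately have "?P S ?\<tau> = f (min r s) (?\<tau> (min r s))
           * (\<Prod>u\<in>{u \<in> S - {r, s}. u < \<sigma> u}. f u (?\<tau> u))"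
        using fin by (simp only: finite_Diff finite_Collect_conjI prod.insert simp_thms) simp
      also have "f (min r s) (?\<tau> (min r s)) = f r s"
        using sym[OF r sS(1)] sS by (auto simp: min_def)
      also have "(\<Prod>u\<in>{u \<in> S - {r, s}. u < \<sigma> u}. f u (?\<tau> u)) = ?P (S - {r, s}) \<sigma>"
        by (rule prod.cong) auto
      finally show "?P S ?\<tau> = f r s * ?P (S - {r, s}) \<sigma>" .
    qed
    finally show "(\<Sum>\<sigma>\<in>{\<sigma> \<in> fpf S. \<sigma> r = s}. ?P S \<sigma>) = f r s * Haf f (S - {r, s})"
      by (simp add: Haf_def sum_distrib_left)
  qed
  finally show ?thesis .
qed

text \<open>The row expansion together with the value 1 at the empty set determines a function of
  finite sets, by induction on the cardinality. The row may be chosen separately for each subset,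
  which later allows a case distinction on the kind of mode.\<close>

lemma Haf_uniqueI:
  fixes f :: "'a::linorder \<Rightarrow> 'a \<Rightarrow> 'b::comm_semiring_1"
  assumes "finite S"
    and sym: "\<And>u v. u \<in> S \<Longrightarrow> v \<in> S \<Longrightarrow> f u v = f v u"
    and "G {} = 1"
    and rec: "\<And>T. T \<subseteq> S \<Longrightarrow> T \<noteq> {} \<Longrightarrow> \<exists>r\<in>T. G T = (\<Sum>s\<in>T - {r}. f r s * G (T - {r, s}))"
  shows "G S = Haf f S"
proof -
  have "G T = Haf f T" if "T \<subseteq> S" for T
    using that
  proof (induction "card T" arbitrary: T rule: less_induct)
    case less
    have fin: "finite T" using less.prems assms(1) finite_subset by blast
    show ?case
    proof (cases "T = {}")
      case False
      then obtain r where r: "r \<in> T" "G T = (\<Sum>s\<in>T - {r}. f r s * G (T - {r, s}))"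
        using rec less.prems by blast
      have "G (T - {r, s}) = Haf f (T - {r, s})" for s
        using less.prems r(1) fin by (intro less.hyps) (auto intro!: psubset_card_mono)
      with r(2) have "G T = (\<Sum>s\<in>T - {r}. f r s * Haf f (T - {r, s}))" by simp
      also have "\<dots> = Haf f T"
        by (rule Haf_rec[symmetric]) (use fin r less.prems sym in auto)
      finally show ?thesis .
    qed (use assms in auto)
  qed
  then show ?thesis by blast
qed

text \<open>\<open>g\<close> need not be monotone, so the two sides may orient the same
  transposition differently. Comparing row expansions avoids tracking this.\<close>

lemma Haf_reindex:
  assumes fin: "finite S" and inj: "inj_on g S"
    and sym: "\<And>u v. u \<in> g ` S \<Longrightarrow> v \<in> g ` S \<Longrightarrow> f u v = f v u"
  shows "Haf (\<lambda>r s. f (g r) (g s)) S = Haf f (g ` S)"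
proof -
  have "Haf f (g ` S) = Haf (\<lambda>r s. f (g r) (g s)) S"
  proof (rule Haf_uniqueI[where G = "\<lambda>T. Haf f (g ` T)"])
    fix T assume T: "T \<subseteq> S" "T \<noteq> {}"
    then obtain r where r: "r \<in> T" by blast
    have injT: "inj_on g T" using inj T inj_on_subset by blast
    have "Haf f (g ` T) = (\<Sum>s\<in>g ` T - {g r}. f (g r) s * Haf f (g ` T - {g r, s}))"
    proof (rule Haf_rec)
      show "finite (g ` T)" using T fin finite_subset by blast
    qed (use T r sym in blast)+
    also have "g ` T - {g r} = g ` (T - {r})"
      using injT r by (auto simp: inj_on_def)
    also have "(\<Sum>s\<in>g ` (T - {r}). f (g r) s * Haf f (g ` T - {g r, s}))
       = (\<Sum>s\<in>T - {r}. f (g r) (g s) * Haf f (g ` T - {g r, g s}))"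
      by (subst sum.reindex) (use injT in \<open>auto simp: inj_on_def\<close>)
    also have "\<dots> = (\<Sum>s\<in>T - {r}. f (g r) (g s) * Haf f (g ` (T - {r, s})))"
    proof (intro sum.cong refl)
      fix s assume "s \<in> T - {r}"
      then have "g ` T - {g r, g s} = g ` (T - {r, s})" using injT r by (auto simp: inj_on_def)
      then show "f (g r) (g s) * Haf f (g ` T - {g r, g s}) = f (g r) (g s) * Haf f (g ` (T - {r, s}))"
        by simp
    qed
    finally show "\<exists>r\<in>T. Haf f (g ` T) = (\<Sum>s\<in>T - {r}. f (g r) (g s) * Haf f (g ` (T - {r, s})))"
      using r by blast
  qed (use fin sym in auto)
  then show ?thesis by simp
qed

text \<open>For a symmetric kernel the choice of the listing is immaterial (\<open>Haf_eq_haf_mset\<close>).\<close>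
definition haf_mset :: "('g \<Rightarrow> 'g \<Rightarrow> 'b::comm_semiring_1) \<Rightarrow> 'g multiset \<Rightarrow> 'b" where
  "haf_mset \<kappa> \<mu> = (let gs = (SOME gs. mset gs = \<mu>) in Haf (\<lambda>r s. \<kappa> (gs ! r) (gs ! s)) {..<length gs})"

lemma mset_eq_image_mset_nth: "mset xs = image_mset ((!) xs) (mset_set {..<length xs})"
  by (metis map_nth mset_map mset_upt atLeast0LessThan)

lemma Haf_eq_haf_mset:
  fixes \<kappa> :: "'g \<Rightarrow> 'g \<Rightarrow> 'b::comm_semiring_1"
  assumes sym: "\<And>x y. \<kappa> x y = \<kappa> y x" and fin: "finite S" and \<mu>: "image_mset g (mset_set S) = \<mu>"
  shows "Haf (\<lambda>r s. \<kappa> (g r) (g s)) S = haf_mset \<kappa> \<mu>"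
proof -
  have aux: "image_mset h (mset_set T) = image_mset g (mset_set S) \<Longrightarrow>
     finite S \<Longrightarrow> finite T \<Longrightarrow>
     Haf (\<lambda>r s. \<kappa> (g r) (g s)) S = Haf (\<lambda>r s. \<kappa> (h r) (h s)) T"
    for S :: "'a set" and T :: "nat set" and g h
  proof -
    assume eq: "image_mset h (mset_set T) = image_mset g (mset_set S)" and fin: "finite S" "finite T"
    have "card T = card S" using arg_cong[OF eq, of size] by simp
    then obtain f where f: "bij_betw f S T" using fin finite_same_card_bij by metis
    then have "image_mset (h \<circ> f) (mset_set S) = image_mset g (mset_set S)"
      using eq by (metis bij_betw_def image_mset_mset_set multiset.map_comp)
    then obtain p where p: "p permutes S" "\<forall>x\<in>S. (h \<circ> f) x = g (p x)"
      by (rule image_mset_eq_implies_permutes[OF fin(1)])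
    \<comment> \<open>The bijection \<open>f\<close> only matches cardinalities; precomposing with
      \<open>inv p\<close> makes it carry each element to one with the same label.\<close>
    define f' where "f' = f \<circ> inv p"
    have f: "bij_betw f' S T"
      unfolding f'_def using f permutes_imp_bij[OF permutes_inv[OF p(1)]] bij_betw_trans by blast
    have f2: "g x = h (f' x)" if "x \<in> S" for x
      using bspec[OF p(2), of "inv p x"] that p(1) by (simp add: f'_def permutes_in_image[OF permutes_inv] permutes_inverses)
    have "Haf (\<lambda>r s. \<kappa> (g r) (g s)) S = Haf (\<lambda>r s. \<kappa> (h (f' r)) (h (f' s))) S"
      by (rule Haf_cong) (simp add: f2)
    also have "\<dots> = Haf (\<lambda>r s. \<kappa> (h r) (h s)) (f' ` S)"
      by (rule Haf_reindex) (use fin f sym in \<open>auto simp: bij_betw_def\<close>)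
    also have "f' ` S = T" using f by (simp add: bij_betw_def)
    finally show ?thesis .
  qed
  define gs where "gs = (SOME gs. mset gs = \<mu>)"
  have "mset gs = \<mu>" unfolding gs_def by (rule someI_ex) (rule ex_mset)
  then show ?thesis
    unfolding haf_mset_def Let_def gs_def[symmetric]
    using \<mu> fin mset_eq_image_mset_nth[of gs] by (intro aux) simp_all
qed

lemma haf_mset_empty [simp]: "haf_mset \<kappa> {#} = 1"
  by (simp add: haf_mset_def)

text \<open>Row expansion at index 0 of the listing \<open>x # gs\<close>. Equal entries are summed
  with multiplicity; this multiplicity later becomes the factor produced by a derivative in
  \<open>wick_mult_gen\<close>.\<close>

lemma haf_mset_add:
  fixes \<kappa> :: "'g \<Rightarrow> 'g \<Rightarrow> 'b::comm_semiring_1"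
  assumes sym: "\<And>x y. \<kappa> x y = \<kappa> y x"
  shows "haf_mset \<kappa> (add_mset x \<mu>) = (\<Sum>y\<in>#\<mu>. \<kappa> x y * haf_mset \<kappa> (\<mu> - {#y#}))"
proof -
  obtain gs where gs: "mset gs = \<mu>" using ex_mset by blast
  let ?g = "(!) (x # gs)" and ?n = "length gs"
  have sub: "image_mset ?g (mset_set ({..<Suc ?n} - {0})) = \<mu>"
  proof -
    have "{..<Suc ?n} - {0} = Suc ` {..<?n}" by (simp add: lessThan_Suc_eq_insert_0)
    then show ?thesis
      by (simp add: image_mset_mset_set[symmetric] gs[symmetric] mset_eq_image_mset_nth multiset.map_comp comp_def)
  qed
  have "haf_mset \<kappa> (add_mset x \<mu>) = Haf (\<lambda>r s. \<kappa> (?g r) (?g s)) {..<Suc ?n}"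
    using mset_eq_image_mset_nth[of "x # gs"] gs
    by (intro Haf_eq_haf_mset[symmetric]) (auto intro: sym simp del: nth_Cons_0)
  also have "\<dots> = (\<Sum>s\<in>{..<Suc ?n} - {0}. \<kappa> x (?g s) * Haf (\<lambda>r s. \<kappa> (?g r) (?g s)) ({..<Suc ?n} - {0, s}))"
    by (subst Haf_rec[where r = 0]) (use sym in auto)
  also have "\<dots> = (\<Sum>s\<in>{..<Suc ?n} - {0}. \<kappa> x (?g s) * haf_mset \<kappa> (\<mu> - {#?g s#}))"
  proof (intro sum.cong refl arg_cong2[where f = "(*)"] Haf_eq_haf_mset)
    fix s assume s: "s \<in> {..<Suc ?n} - {0}"
    have "{..<Suc ?n} - {0, s} = ({..<Suc ?n} - {0}) - {s}" by auto
    then have "mset_set ({..<Suc ?n} - {0, s}) = mset_set ({..<Suc ?n} - {0}) - {#s#}"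
      using s by (simp add: mset_set_Diff)
    with s show "image_mset ?g (mset_set ({..<Suc ?n} - {0, s})) = \<mu> - {#?g s#}"
      by (subst sub[symmetric]) (simp add: image_mset_Diff)
  qed (use sym in auto)
  also have "\<dots> = (\<Sum>y\<in>#image_mset ?g (mset_set ({..<Suc ?n} - {0})). \<kappa> x y * haf_mset \<kappa> (\<mu> - {#y#}))"
    by (simp only: sum_unfold_sum_mset multiset.map_comp comp_def)
  finally show ?thesis by (simp only: sub)
qed

lemma sum_PiE_insert:
  assumes "x \<notin> S" "finite S" "finite I"
  shows "(\<Sum>a\<in>PiE (insert x S) (\<lambda>_. I). F a) = (\<Sum>u\<in>I. \<Sum>a\<in>PiE S (\<lambda>_. I). F (a(x := u)))"
proof -
  have "(\<Sum>a\<in>PiE (insert x S) (\<lambda>_. I). F a) = (\<Sum>(u, a)\<in>I \<times> PiE S (\<lambda>_. I). F (a(x := u)))"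
    unfolding PiE_insert_eq
    by (subst sum.reindex) (use assms inj_combinator in \<open>auto simp: case_prod_unfold\<close>)
  then show ?thesis by (simp add: sum.cartesian_product)
qed

text \<open>Each index lies in exactly one pair of a pairing, so the sum over its label
  \<open>a r\<close> can be moved into the matrix entry of that pair. This is how Wick's theorem
  passes from single modes to fields, which are sums of modes.\<close>

lemma Haf_multilinear:
  fixes b :: "'a::linorder \<Rightarrow> 'i \<Rightarrow> 'b::comm_semiring_1"
  assumes fin: "finite S" and I: "finite I"
    and sym: "\<And>r s u v. \<eta> r s u v = \<eta> s r v u"
  shows "(\<Sum>a\<in>PiE S (\<lambda>_. I). (\<Prod>r\<in>S. b r (a r)) * Haf (\<lambda>r s. \<eta> r s (a r) (a s)) S)
     = Haf (\<lambda>r s. \<Sum>u\<in>I. \<Sum>v\<in>I. b r u * b s v * \<eta> r s u v) S"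
    (is "?G S = Haf ?f S")
proof (rule Haf_uniqueI[where G = ?G])
  fix u v show "?f u v = ?f v u"
    by (subst sum.swap) (simp add: sym[of u v] mult_ac)
next
  fix T assume T: "T \<subseteq> S" "T \<noteq> {}"
  then obtain r where r: "r \<in> T" by blast
  have finT: "finite T" using T fin finite_subset by blast
  have "?G T = (\<Sum>a\<in>PiE T (\<lambda>_. I). \<Sum>s\<in>T - {r}. (\<Prod>r\<in>T. b r (a r)) * \<eta> r s (a r) (a s) *
       Haf (\<lambda>r s. \<eta> r s (a r) (a s)) (T - {r, s}))"
    by (subst Haf_rec[OF finT r]) (use sym in \<open>auto simp: sum_distrib_left mult.assoc\<close>)
  also have "\<dots> = (\<Sum>s\<in>T - {r}. \<Sum>a\<in>PiE T (\<lambda>_. I). (\<Prod>r\<in>T. b r (a r)) * \<eta> r s (a r) (a s) *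
       Haf (\<lambda>r s. \<eta> r s (a r) (a s)) (T - {r, s}))"
    by (rule sum.swap)
  also have "\<dots> = (\<Sum>s\<in>T - {r}. ?f r s * ?G (T - {r, s}))"
  proof (intro sum.cong refl)
    fix s assume s: "s \<in> T - {r}"
    define U where "U = T - {r, s}"
    have Teq: "T = insert r (insert s U)" and nin: "r \<notin> insert s U" "s \<notin> U" "finite U"
      using r s finT by (auto simp: U_def)
    have neq: "r \<noteq> s" using s by auto
    have cong1: "(\<Prod>x\<in>U. b x ((a(s := v, r := u)) x)) = (\<Prod>x\<in>U. b x (a x))" for a u v
      by (rule prod.cong) (use nin in auto)
    have cong2: "Haf (\<lambda>x y. \<eta> x y ((a(s := v, r := u)) x) ((a(s := v, r := u)) y)) U
        = Haf (\<lambda>x y. \<eta> x y (a x) (a y)) U" for a u v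
      by (rule Haf_cong) (use nin in auto)
    have "(\<Sum>a\<in>PiE T (\<lambda>_. I). (\<Prod>r\<in>T. b r (a r)) * \<eta> r s (a r) (a s) * Haf (\<lambda>r s. \<eta> r s (a r) (a s)) U)
      = (\<Sum>u\<in>I. \<Sum>v\<in>I. \<Sum>a\<in>PiE U (\<lambda>_. I). (b r u * b s v * \<eta> r s u v) *
            ((\<Prod>r\<in>U. b r (a r)) * Haf (\<lambda>r s. \<eta> r s (a r) (a s)) U))"
    proof -
      have p: "(\<Prod>x\<in>insert r (insert s U). b x ((a(s := v, r := u)) x)) = b r u * b s v * (\<Prod>x\<in>U. b x (a x))" for a u v
        using nin neq cong1[of a v u] by (simp add: mult.assoc del: fun_upd_apply) simp
      show ?thesis
        unfolding Teq
        apply (subst sum_PiE_insert)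
           apply (use nin I in auto)[3]
        apply (subst sum_PiE_insert)
           apply (use nin I in auto)[3]
        apply (intro sum.cong refl)
        apply (subst p, subst cong2)
        using neq by (simp add: mult_ac)
    qed
    then show "(\<Sum>a\<in>PiE T (\<lambda>_. I). (\<Prod>r\<in>T. b r (a r)) * \<eta> r s (a r) (a s) *
       Haf (\<lambda>r s. \<eta> r s (a r) (a s)) (T - {r, s})) = ?f r s * ?G (T - {r, s})"
      by (simp only: U_def[symmetric] sum_distrib_right sum_distrib_left[symmetric])
  qed
  finally show "\<exists>r\<in>T. ?G T = (\<Sum>s\<in>T - {r}. ?f r s * ?G (T - {r, s}))"
    using r by blast
qed (use fin in auto)

section \<open>Traces of normally ordered modes\<close>

lemma prod_set_mset_split:
  fixes F :: "'a \<Rightarrow> nat \<Rightarrow> 'b::comm_monoid_mult"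
  assumes "F x 0 = 1"
  shows "(\<Prod>z\<in>set_mset A. F z (count A z)) = F x (count A x) * (\<Prod>z\<in>set_mset A - {x}. F z (count A z))"
proof (cases "x \<in># A")
  case True then show ?thesis by (simp add: prod.remove)
next
  case False
  then show ?thesis using assms by (simp add: not_in_iff)
qed

definition mset_fact :: "'a multiset \<Rightarrow> nat" where
  "mset_fact A = (\<Prod>x\<in>set_mset A. fact (count A x))"

text \<open>Multiplied by \<open>mset_fact A\<close>, this is the product of falling factorials that
  appears when the monomial \<open>\<nu>\<close> is differentiated by every generator in
  \<open>A\<close>.\<close>

definition mset_choose :: "'a multiset \<Rightarrow> 'a multiset \<Rightarrow> nat" where
  "mset_choose \<nu> A = (\<Prod>x\<in>set_mset A. count \<nu> x choose count A x)"

lemma mset_fact_empty [simp]: "mset_fact {#} = 1" by (simp add: mset_fact_def)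

lemma mset_choose_empty [simp]: "mset_choose \<nu> {#} = 1" by (simp add: mset_choose_def)

lemma mset_fact_split: "mset_fact A = fact (count A x) * (\<Prod>z\<in>set_mset A - {x}. fact (count A z))"
  unfolding mset_fact_def by (rule prod_set_mset_split) simp

lemma mset_fact_add_mset: "mset_fact (add_mset x A) = Suc (count A x) * mset_fact A"
proof -
  have 1: "(\<Prod>z\<in>set_mset (add_mset x A) - {x}. fact (count (add_mset x A) z))
      = (\<Prod>z\<in>set_mset A - {x}. fact (count A z) :: nat)"
    by (rule prod.cong) auto
  show ?thesis
    unfolding mset_fact_split[of _ x] 1 by (simp add: algebra_simps)
qed

lemma mset_choose_split:
  "mset_choose \<nu> A = (count \<nu> x choose count A x) * (\<Prod>z\<in>set_mset A - {x}. count \<nu> z choose count A z)"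
  unfolding mset_choose_def by (rule prod_set_mset_split) simp

lemma mset_choose_add_mset_add_mset:
  "mset_choose (add_mset x \<nu>) (add_mset x A) = mset_choose \<nu> A + mset_choose \<nu> (add_mset x A)"
proof -
  have 1: "(\<Prod>z\<in>set_mset (add_mset x A) - {x}. count (add_mset x \<nu>) z choose count (add_mset x A) z)
      = (\<Prod>z\<in>set_mset A - {x}. count \<nu> z choose count A z)"
    by (rule prod.cong) auto
  have 2: "(\<Prod>z\<in>set_mset (add_mset x A) - {x}. count \<nu> z choose count (add_mset x A) z)
      = (\<Prod>z\<in>set_mset A - {x}. count \<nu> z choose count A z)"
    by (rule prod.cong) auto
  show ?thesis
    unfolding mset_choose_split[of _ _ x] 1 2 by (simp add: algebra_simps)
qed

text \<open>The absorption identity (a+1) C(n,a+1) = (n-a) C(n,a) at the generator \<open>x\<close>.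
  The factor on the right is the number of copies of \<open>x\<close> that are left for one more
  annihilator.\<close>

lemma mset_choose_add_mset:
  "Suc (count A x) * mset_choose \<nu> (add_mset x A) = (count \<nu> x - count A x) * mset_choose \<nu> A"
proof -
  have 1: "(\<Prod>z\<in>set_mset (add_mset x A) - {x}. count \<nu> z choose count (add_mset x A) z)
      = (\<Prod>z\<in>set_mset A - {x}. count \<nu> z choose count A z)"
    by (rule prod.cong) auto
  have "Suc (count A x) * (count \<nu> x choose Suc (count A x))
      = (count \<nu> x - count A x) * (count \<nu> x choose count A x)"
    using binomial_absorb_comp binomial_absorption by metis
  then show ?thesis
    unfolding mset_choose_split[of _ _ x] 1 by (simp add: mult.assoc[symmetric])
qed

lemma mset_choose_nonzero_iff: "mset_choose \<nu> A \<noteq> 0 \<longleftrightarrow> A \<subseteq># \<nu>"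
  unfolding mset_choose_def subseteq_mset_def
  by (auto simp: not_less) (metis count_inI zero_le)

section \<open>Diagonal entries of normally ordered products\<close>

lemma hmode_scaled_basis_neg:
  assumes "m > 0"
  shows "hmode j (- int m) (\<lambda>\<mu>. c * basis_vec l \<mu>) = (\<lambda>\<mu>. c * basis_vec (add_mset (j, m) l) \<mu>)"
  using assms by (fastforce simp: hmode_def basis_vec_def fun_eq_iff)

lemma hmode_scaled_basis_pos:
  assumes "m > 0"
  shows "hmode j (int m) (\<lambda>\<mu>. c * basis_vec l \<mu>)
     = (\<lambda>\<mu>. c * of_nat m * of_nat (count l (j, m)) * basis_vec (l - {#(j, m)#}) \<mu>)"
proof
  fix \<mu>
  show "hmode j (int m) (\<lambda>\<mu>. c * basis_vec l \<mu>) \<mu>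
     = c * of_nat m * of_nat (count l (j, m)) * basis_vec (l - {#(j, m)#}) \<mu>"
  proof (cases "(j, m) \<in># l")
    case True
    then have "l = add_mset (j, m) \<mu> \<longleftrightarrow> \<mu> = l - {#(j, m)#}" by (metis add_mset_remove_trivial insert_DiffM)
    then show ?thesis using assms by (auto simp: hmode_def basis_vec_def)
  next
    case False
    then have "l \<noteq> add_mset (j, m) \<mu>" by auto
    with False show ?thesis using assms by (auto simp: hmode_def basis_vec_def not_in_iff)
  qed
qed

lemma hmode_zero_mode [simp]: "hmode j 0 v = (\<lambda>_. 0)"
  by (simp add: hmode_def)

lemma hmode_zero_vec [simp]: "hmode j a (\<lambda>_. 0) = (\<lambda>_. 0)"
  by (auto simp: hmode_def fun_eq_iff)

text \<open>The generators removed by the positive modes of a family; \<open>creat\<close> collects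
  those inserted by the negative modes. Zero modes enter neither and are tested for
  separately.\<close>

definition annih :: "('a \<Rightarrow> nat \<times> int) \<Rightarrow> 'a set \<Rightarrow> mono" where
  "annih p S = image_mset (\<lambda>r. (fst (p r), nat (snd (p r)))) (mset_set {r \<in> S. snd (p r) > 0})"

definition creat :: "('a \<Rightarrow> nat \<times> int) \<Rightarrow> 'a set \<Rightarrow> mono" where
  "creat p S = image_mset (\<lambda>r. (fst (p r), nat (- snd (p r)))) (mset_set {r \<in> S. snd (p r) < 0})"

lemma annih_nth: "annih ((!) ps) {..<length ps}
   = image_mset (\<lambda>x. (fst x, nat (snd x))) (filter_mset (\<lambda>x. snd x > 0) (mset ps))"
  unfolding annih_def mset_eq_image_mset_nth filter_mset_image_mset
  by (simp add: multiset.map_comp comp_def filter_mset_mset_set)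

lemma creat_nth: "creat ((!) ps) {..<length ps}
   = image_mset (\<lambda>x. (fst x, nat (- snd x))) (filter_mset (\<lambda>x. snd x < 0) (mset ps))"
  unfolding creat_def mset_eq_image_mset_nth filter_mset_image_mset
  by (simp add: multiset.map_comp comp_def filter_mset_mset_set)

lemma foldr_creation:
  assumes "\<forall>x\<in>set ps. snd x \<le> 0"
  shows "foldr (\<lambda>(j,a). hmode j a) ps (\<lambda>\<mu>. c * basis_vec l \<mu>)
     = (\<lambda>\<mu>. (if \<exists>x\<in>set ps. snd x = 0 then 0 else c)
          * basis_vec (l + image_mset (\<lambda>x. (fst x, nat (- snd x))) (filter_mset (\<lambda>x. snd x < 0) (mset ps))) \<mu>)"
  using assms
proof (induction ps)
  case (Cons x ps)
  obtain j a where x: "x = (j, a)" by force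
  have IH: "foldr (\<lambda>(j,a). hmode j a) ps (\<lambda>\<mu>. c * basis_vec l \<mu>)
     = (\<lambda>\<mu>. (if \<exists>x\<in>set ps. snd x = 0 then 0 else c)
          * basis_vec (l + image_mset (\<lambda>x. (fst x, nat (- snd x))) (filter_mset (\<lambda>x. snd x < 0) (mset ps))) \<mu>)"
    using Cons by simp
  show ?case
  proof (cases "a = 0")
    case False
    then obtain m where m: "a = - int m" "m > 0" using Cons.prems x
      by (metis list.set_intros(1) neg_0_equal_iff_equal nonpos_int_cases of_nat_0 snd_conv gr0I)
    show ?thesis
      unfolding foldr.simps comp_def IH using m hmode_scaled_basis_neg[OF m(2)] by (simp add: x)
  qed (simp add: x)
qed simp

text \<open>Each annihilator contributes its mode number times the number of copies still present.
  If \<open>A\<close> is not contained in \<open>\<nu>\<close>, then \<open>mset_choose\<close>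
  vanishes, so the truncated difference \<open>\<nu> - A\<close> does no harm.\<close>

lemma foldr_annihilation:
  assumes "\<forall>x\<in>set ps. snd x > 0"
  defines "A \<equiv> image_mset (\<lambda>x. (fst x, nat (snd x))) (mset ps)"
  shows "foldr (\<lambda>(j,a). hmode j a) ps (basis_vec \<nu>)
     = (\<lambda>\<mu>. of_nat ((\<Prod>x\<in>#A. snd x) * mset_fact A * mset_choose \<nu> A) * basis_vec (\<nu> - A) \<mu>)"
  using assms(1) unfolding A_def
proof (induction ps)
  case (Cons x ps)
  obtain j m where x: "x = (j, int m)" "m > 0" using Cons.prems
    by (metis list.set_intros(1) prod.collapse pos_int_cases)
  let ?A = "image_mset (\<lambda>x. (fst x, nat (snd x))) (mset ps)"
  have IH: "foldr (\<lambda>(j,a). hmode j a) ps (basis_vec \<nu>)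
     = (\<lambda>\<mu>. of_nat ((\<Prod>x\<in>#?A. snd x) * mset_fact ?A * mset_choose \<nu> ?A) * basis_vec (\<nu> - ?A) \<mu>)"
    using Cons by simp
  have eq: "mset_fact (add_mset (j, m) ?A) * mset_choose \<nu> (add_mset (j, m) ?A)
     = mset_fact ?A * ((count \<nu> (j, m) - count ?A (j, m)) * mset_choose \<nu> ?A)"
    unfolding mset_choose_add_mset[symmetric] mset_fact_add_mset by (simp only: mult_ac)
  have eq': "(\<Prod>x\<in>#?A. snd x) * mset_fact ?A * mset_choose \<nu> ?A * m * count (\<nu> - ?A) (j, m)
     = (\<Prod>x\<in>#add_mset (j, m) ?A. snd x) * mset_fact (add_mset (j, m) ?A) * mset_choose \<nu> (add_mset (j, m) ?A)"
    unfolding mult.assoc eq by simp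
  show ?case
    unfolding foldr.simps comp_def IH x(1) prod.case hmode_scaled_basis_pos[OF x(2)] of_nat_mult[symmetric] eq'
    by (simp add: x)
qed simp

text \<open>A basis monomial returns to itself exactly when the removed generators are the inserted
  ones: for \<open>A\<close> inside \<open>\<nu>\<close>, \<open>\<nu> - A + C = \<nu>\<close>
  forces \<open>A = C\<close>.\<close>

lemma normal_ord_diag:
  fixes ps :: "(nat \<times> int) list"
  defines "A \<equiv> annih ((!) ps) {..<length ps}" and "C \<equiv> creat ((!) ps) {..<length ps}"
  shows "normal_ord ps (basis_vec \<nu>) \<nu>
     = (if (\<exists>x\<in>set ps. snd x = 0) \<or> A \<noteq> C then 0
        else of_nat ((\<Prod>x\<in>#A. snd x) * mset_fact A * mset_choose \<nu> A))"
proof -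
  let ?c = "of_nat ((\<Prod>x\<in>#A. snd x) * mset_fact A * mset_choose \<nu> A) :: complex"
  have A: "image_mset (\<lambda>x. (fst x, nat (snd x))) (mset (filter (\<lambda>(j,a). a > 0) ps)) = A"
    by (simp add: A_def annih_nth case_prod_unfold)
  have f: "filter_mset (\<lambda>x. snd x < 0) (mset (filter (\<lambda>(j,a). a \<le> 0) ps))
       = filter_mset (\<lambda>x. snd x < 0) (mset ps)"
    by (auto simp: filter_filter_mset case_prod_unfold intro!: filter_mset_cong)
  have "foldr (\<lambda>(j,a). hmode j a) (filter (\<lambda>(j,a). a > 0) ps) (basis_vec \<nu>) = (\<lambda>\<mu>. ?c * basis_vec (\<nu> - A) \<mu>)"
    using foldr_annihilation[of "filter (\<lambda>(j,a). a > 0) ps" \<nu>] unfolding A by auto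
  then have "normal_ord ps (basis_vec \<nu>) \<nu> = (if \<exists>x\<in>set ps. snd x = 0 then 0 else ?c) * basis_vec (\<nu> - A + C) \<nu>"
    using foldr_creation[of "filter (\<lambda>(j,a). a \<le> 0) ps" ?c "\<nu> - A"] f
    unfolding normal_ord_def by (auto simp: C_def creat_nth)
  moreover have "?c = 0 \<or> (basis_vec (\<nu> - A + C) \<nu> = (if A = C then 1 else 0))"
  proof (cases "A \<subseteq># \<nu>")
    case True
    then have "\<nu> = \<nu> - A + C \<longleftrightarrow> A = C"
      by (metis subset_mset.diff_add add_left_cancel)
    then show ?thesis by (simp add: basis_vec_def)
  next
    case False
    then have "mset_choose \<nu> A = 0" using mset_choose_nonzero_iff by blast
    then show ?thesis by simp
  qed
  ultimately show ?thesis by auto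
qed

section \<open>Weighted generating series over the monomials of M\<close>

lemma wt_add_mset [simp]: "wt (add_mset x \<nu>) = snd x + wt \<nu>"
  by (simp add: wt_def)

lemma wt_ge: "x \<in># \<nu> \<Longrightarrow> snd x \<le> wt \<nu>"
  by (metis insert_DiffM wt_add_mset le_add1)

lemma finite_basis_M: "finite (basis_M k N)"
proof (rule finite_subset)
  show "basis_M k N \<subseteq> mset ` {xs. set xs \<subseteq> {1..k} \<times> {1..N} \<and> length xs \<le> N}"
  proof
    fix \<nu> assume \<nu>: "\<nu> \<in> basis_M k N"
    obtain xs where xs: "mset xs = \<nu>" using ex_mset by blast
    have "size \<nu> \<le> wt \<nu>" if "\<forall>x\<in>#\<nu>. snd x \<ge> 1" for \<nu>
      using that by (induction \<nu>) auto
    with \<nu> have "size \<nu> \<le> N" by (auto simp: basis_M_def)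
    with \<nu> xs show "\<nu> \<in> mset ` {xs. set xs \<subseteq> {1..k} \<times> {1..N} \<and> length xs \<le> N}"
      by (intro image_eqI[of _ _ xs]) (use wt_ge in \<open>fastforce simp: basis_M_def\<close>)+
  qed
qed (auto intro: finite_lists_length_le)

lemma sum_basis_M_containing:
  fixes F :: "mono \<Rightarrow> 'b::comm_monoid_add"
  assumes "j \<in> {1..k}" "a \<ge> 1" "\<And>\<nu>. (j, a) \<notin># \<nu> \<Longrightarrow> F \<nu> = 0"
  shows "(\<Sum>\<nu>\<in>basis_M k N. F \<nu>) = (if N < a then 0 else \<Sum>\<nu>\<in>basis_M k (N - a). F (add_mset (j, a) \<nu>))"
proof -
  have "(\<Sum>\<nu>\<in>basis_M k N. F \<nu>) = (\<Sum>\<nu>\<in>{\<nu>\<in>basis_M k N. (j, a) \<in># \<nu>}. F \<nu>)"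
    by (rule sum.mono_neutral_right) (use assms finite_basis_M in auto)
  also have "{\<nu>\<in>basis_M k N. (j, a) \<in># \<nu>} = (if N < a then {} else add_mset (j, a) ` basis_M k (N - a))"
  proof (cases "N < a")
    case True
    then show ?thesis using wt_ge by (fastforce simp: basis_M_def)
  next
    case False
    have "\<nu> \<in> add_mset (j, a) ` basis_M k (N - a)" if "\<nu> \<in> basis_M k N" "(j, a) \<in># \<nu>" for \<nu>
    proof
      show "\<nu> = add_mset (j, a) (\<nu> - {#(j, a)#})" using that by simp
      then have "wt \<nu> = a + wt (\<nu> - {#(j, a)#})" by (metis wt_add_mset snd_conv)
      then show "\<nu> - {#(j, a)#} \<in> basis_M k (N - a)"
        using that by (auto simp: basis_M_def dest: in_diffD)
    qed
    with False assms show ?thesis by (auto simp: basis_M_def)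
  qed
  finally show ?thesis by (simp add: sum.reindex inj_on_def)
qed

text \<open>The expansion of \<epsilon> q^a / (1 - \<epsilon> q^a), characterized without division
  by \<open>lam_eq\<close>.\<close>

definition lam :: "complex \<Rightarrow> nat \<Rightarrow> complex fps" where
  "lam \<epsilon> a = Abs_fps (\<lambda>n. if n > 0 \<and> a dvd n then \<epsilon> ^ (n div a) else 0)"

lemma lam_eq:
  assumes "a \<ge> 1"
  shows "(1 - fps_const \<epsilon> * fps_X ^ a) * lam \<epsilon> a = fps_const \<epsilon> * fps_X ^ a"
proof (rule fps_ext)
  fix n
  have *: "\<epsilon> * \<epsilon> ^ ((n - a) div a) = \<epsilon> ^ (n div a)" if "a \<le> n"
    using that assms le_div_geq[of a n] by simp
  have "((1 - fps_const \<epsilon> * fps_X ^ a) * lam \<epsilon> a) $ n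
      = lam \<epsilon> a $ n - \<epsilon> * (fps_X ^ a * lam \<epsilon> a) $ n"
    by (simp add: algebra_simps mult.assoc)
  also have "\<dots> = (fps_const \<epsilon> * fps_X ^ a) $ n"
    using assms * by (cases "n = a") (auto simp: lam_def fps_X_power_mult_nth dvd_minus_self)
  finally show "((1 - fps_const \<epsilon> * fps_X ^ a) * lam \<epsilon> a) $ n = (fps_const \<epsilon> * fps_X ^ a) $ n" .
qed

definition choose_series :: "nat \<Rightarrow> complex \<Rightarrow> mono \<Rightarrow> complex fps" where
  "choose_series k \<epsilon> A = Abs_fps (\<lambda>N. \<Sum>\<nu>\<in>basis_M k N. \<epsilon> ^ size \<nu> * of_nat (mset_choose \<nu> A))"

definition char_series :: "nat \<Rightarrow> complex \<Rightarrow> complex fps" where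
  "char_series k \<epsilon> = Abs_fps (\<lambda>N. \<Sum>\<nu>\<in>basis_M k N. \<epsilon> ^ size \<nu>)"

text \<open>Pascal's rule \<open>mset_choose_add_mset_add_mset\<close> makes the weighted sum over monomials geometric in
  each generator.\<close>
lemma choose_series_add_mset:
  assumes j: "j \<in> {1..k}" and a: "a \<ge> 1"
  shows "choose_series k \<epsilon> (add_mset (j, a) A) = lam \<epsilon> a * choose_series k \<epsilon> A"
proof -
  let ?H = "choose_series k \<epsilon>" and ?u = "1 - fps_const \<epsilon> * fps_X ^ a"
  have rec: "?H (add_mset (j, a) A) = fps_const \<epsilon> * fps_X ^ a * (?H A + ?H (add_mset (j, a) A))"
  proof (rule fps_ext)
    fix N
    have z: "mset_choose \<nu> (add_mset (j, a) A) = 0" if "(j, a) \<notin># \<nu>" for \<nu>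
      using that mset_choose_nonzero_iff[of \<nu> "add_mset (j, a) A"] by (auto dest: mset_subset_eqD)
    have "?H (add_mset (j, a) A) $ N = (if N < a then 0 else
        \<Sum>\<nu>\<in>basis_M k (N - a). \<epsilon> ^ size (add_mset (j, a) \<nu>)
           * of_nat (mset_choose (add_mset (j, a) \<nu>) (add_mset (j, a) A)))"
      unfolding choose_series_def fps_nth_Abs_fps by (rule sum_basis_M_containing[OF j a]) (simp add: z)
    also have "\<dots> = (fps_const \<epsilon> * fps_X ^ a * (?H A + ?H (add_mset (j, a) A))) $ N"
      unfolding choose_series_def mult.assoc
      by (simp add: fps_X_power_mult_nth mset_choose_add_mset_add_mset
          sum.distrib sum_distrib_left ring_distribs mult.assoc)
    finally show "?H (add_mset (j, a) A) $ N = (fps_const \<epsilon> * fps_X ^ a * (?H A + ?H (add_mset (j, a) A))) $ N" .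
  qed
  then have "?u * ?H (add_mset (j, a) A) = fps_const \<epsilon> * fps_X ^ a * ?H A"
    by (simp add: algebra_simps)
  also have "\<dots> = ?u * (lam \<epsilon> a * ?H A)"
    by (simp only: mult.assoc[symmetric] lam_eq[OF a])
  finally have "?u * ?H (add_mset (j, a) A) = ?u * (lam \<epsilon> a * ?H A)" .
  \<comment> \<open>Power series form an integral domain, and the geometric denominator has constant
    term 1, so it can be cancelled.\<close>
  moreover have "?u \<noteq> 0"
  proof -
    have "?u $ 0 = 1" using a by simp
    then show ?thesis by (metis fps_zero_nth zero_neq_one)
  qed
  ultimately show ?thesis by simp
qed

lemma choose_series_eq:
  assumes "\<forall>x\<in>#A. fst x \<in> {1..k} \<and> snd x \<ge> 1"
  shows "choose_series k \<epsilon> A = (\<Prod>x\<in>#A. lam \<epsilon> (snd x)) * char_series k \<epsilon>"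
  using assms
proof (induction A)
  case (add x A)
  then show ?case by (cases x) (simp add: choose_series_add_mset mult.assoc)
qed (simp add: choose_series_def char_series_def)

text \<open>The normally ordered two-point function of Heisenberg modes, normalized by the trace of 1.\<close>
definition two_pt :: "complex \<Rightarrow> nat \<times> int \<Rightarrow> nat \<times> int \<Rightarrow> complex fps" where
  "two_pt \<epsilon> x y = (if fst x = fst y \<and> snd y = - snd x \<and> snd x \<noteq> 0
      then of_nat (nat \<bar>snd x\<bar>) * lam \<epsilon> (nat \<bar>snd x\<bar>) else 0)"

section \<open>Wick's theorem for single modes\<close>

lemma two_pt_sym: "two_pt \<epsilon> x y = two_pt \<epsilon> y x"
  by (auto simp: two_pt_def)

text \<open>\<open>mset_fact A\<close> counts the matchings of the annihilators in \<open>A\<close>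
  with equal creators; the product is the weight common to all these matchings.\<close>

definition pair_weight :: "complex \<Rightarrow> mono \<Rightarrow> complex fps" where
  "pair_weight \<epsilon> A = of_nat (mset_fact A) * (\<Prod>x\<in>#A. of_nat (snd x) * lam \<epsilon> (snd x))"

lemma pair_weight_add_mset:
  "pair_weight \<epsilon> (add_mset x A) = of_nat (Suc (count A x)) * (of_nat (snd x) * lam \<epsilon> (snd x)) * pair_weight \<epsilon> A"
  by (simp add: pair_weight_def mset_fact_add_mset algebra_simps)

text \<open>The combinatorial value of the trace of a normally ordered product divided by
  \<open>char_series\<close>; \<open>normal_ord_trace\<close> establishes this meaning.\<close>

definition modes_expect :: "complex \<Rightarrow> ('a \<Rightarrow> nat \<times> int) \<Rightarrow> 'a set \<Rightarrow> complex fps" where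
  "modes_expect \<epsilon> p S = (if (\<exists>r\<in>S. snd (p r) = 0) \<or> annih p S \<noteq> creat p S then 0
      else pair_weight \<epsilon> (annih p S))"

lemma annih_remove:
  assumes "finite S" "r \<in> S"
  shows "annih p S = (if snd (p r) > 0 then add_mset (fst (p r), nat (snd (p r))) (annih p (S - {r})) else annih p (S - {r}))"
proof -
  have "{x \<in> S. snd (p x) > 0} = (if snd (p r) > 0 then insert r {x \<in> S - {r}. snd (p x) > 0} else {x \<in> S - {r}. snd (p x) > 0})"
    using assms by auto
  then show ?thesis using assms by (simp add: annih_def)
qed

lemma creat_remove:
  assumes "finite S" "r \<in> S"
  shows "creat p S = (if snd (p r) < 0 then add_mset (fst (p r), nat (- snd (p r))) (creat p (S - {r})) else creat p (S - {r}))"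
proof -
  have "{x \<in> S. snd (p x) < 0} = (if snd (p r) < 0 then insert r {x \<in> S - {r}. snd (p x) < 0} else {x \<in> S - {r}. snd (p x) < 0})"
    using assms by auto
  then show ?thesis using assms by (simp add: creat_def)
qed

text \<open>An annihilator can only be paired with the creators of the same generator, collected in
  \<open>B\<close>. All these partners leave the same remainder, so the row sum is
  \<open>card B\<close> times a single term.\<close>

lemma modes_expect_rec_pos:
  assumes fin: "finite S" and r: "r \<in> S" and pos: "snd (p r) > 0"
  shows "modes_expect \<epsilon> p S = (\<Sum>s\<in>S - {r}. two_pt \<epsilon> (p r) (p s) * modes_expect \<epsilon> p (S - {r, s}))"
proof -
  obtain j m where pr: "p r = (j, int m)" "m > 0" using pos by (metis prod.collapse pos_int_cases)
  define B where "B = {s \<in> S. p s = (j, - int m)}"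
  let ?x = "(j, m)" and ?A = "annih p S" and ?C = "creat p S"
  have finB: "finite B" and BS: "B \<subseteq> S - {r}" using fin pr by (auto simp: B_def)
  have xA: "?A = add_mset ?x (annih p (S - {r}))" using annih_remove[OF fin r, of p] pr by simp
  have cardB: "card B = count ?C ?x"
  proof -
    have "(\<lambda>r. (fst (p r), nat (- snd (p r)))) -` {?x} \<inter> {s \<in> S. snd (p s) < 0} = B"
      using pr(2) by (auto simp: B_def prod_eq_iff)
    moreover have "(\<Sum>s\<in>B. count (mset_set {s \<in> S. snd (p s) < 0}) s) = (\<Sum>s\<in>B. 1)"
      by (rule sum.cong) (use fin pr(2) in \<open>auto simp: B_def\<close>)
    ultimately show ?thesis using fin by (simp add: creat_def count_image_mset)
  qed
  have "(\<Sum>s\<in>S - {r}. two_pt \<epsilon> (p r) (p s) * modes_expect \<epsilon> p (S - {r, s}))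
     = (\<Sum>s\<in>B. of_nat m * lam \<epsilon> m * modes_expect \<epsilon> p (S - {r, s}))"
    by (rule sum.mono_neutral_cong_right) (use fin BS pr in \<open>auto simp: two_pt_def B_def prod_eq_iff\<close>)
  also have "\<dots> = modes_expect \<epsilon> p S"
  proof (cases "B = {}")
    case True
    then have "?x \<notin># ?C" using cardB by (simp add: not_in_iff)
    then have "?A \<noteq> ?C" using xA by (metis union_single_eq_member)
    with True show ?thesis by (simp add: modes_expect_def)
  next
    case False
    have rem: "modes_expect \<epsilon> p (S - {r, s}) = (if (\<exists>r\<in>S. snd (p r) = 0) \<or> ?A \<noteq> ?C then 0
        else pair_weight \<epsilon> (annih p (S - {r})))" if s: "s \<in> B" for s
    proof -
      have S: "S - {r} - {s} = S - {r, s}" by auto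
      have s': "s \<in> S - {r}" "p s = (j, - int m)" using s BS by (auto simp: B_def)
      have "annih p (S - {r, s}) = annih p (S - {r})"
        using annih_remove[of "S - {r}" s p] fin s' by (simp add: S)
      moreover have "?C = add_mset ?x (creat p (S - {r, s}))"
        using creat_remove[of "S - {r}" s p] creat_remove[of S r p] r fin s' pr by (simp add: S)
      moreover have "(\<exists>r\<in>S - {r, s}. snd (p r) = 0) \<longleftrightarrow> (\<exists>r\<in>S. snd (p r) = 0)"
        using s' pr by auto
      ultimately show ?thesis using xA by (simp add: modes_expect_def)
    qed
    have "(\<Sum>s\<in>B. of_nat m * lam \<epsilon> m * modes_expect \<epsilon> p (S - {r, s}))
       = of_nat (card B) * (of_nat m * lam \<epsilon> m * (if (\<exists>r\<in>S. snd (p r) = 0) \<or> ?A \<noteq> ?C then 0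
        else pair_weight \<epsilon> (annih p (S - {r}))))"
      by (simp add: rem)
    also have "\<dots> = modes_expect \<epsilon> p S"
    proof (cases "(\<exists>r\<in>S. snd (p r) = 0) \<or> ?A \<noteq> ?C")
      case False
      \<comment> \<open>When creators and annihilators match, the number of partners is precisely
        the factor by which \<open>pair_weight\<close> grows in
        \<open>pair_weight_add_mset\<close>.\<close>
      then have "card B = Suc (count (annih p (S - {r})) ?x)" using cardB xA
        by (metis count_add_mset)
      moreover have "pair_weight \<epsilon> ?A = of_nat (Suc (count (annih p (S - {r})) ?x))
          * (of_nat m * lam \<epsilon> m) * pair_weight \<epsilon> (annih p (S - {r}))"
        unfolding xA pair_weight_add_mset by simp
      ultimately show ?thesis using False unfolding modes_expect_def
        by (simp add: mult.assoc del: of_nat_Suc)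
    qed (simp add: modes_expect_def)
    finally show ?thesis .
  qed
  finally show ?thesis by simp
qed

text \<open>Negating all modes swaps \<open>annih\<close> and \<open>creat\<close>, and the value is
  nonzero only when these agree. The row of a creator thereby reduces to the row of an
  annihilator.\<close>

lemma modes_expect_flip: "modes_expect \<epsilon> (\<lambda>r. (fst (p r), - snd (p r))) S = modes_expect \<epsilon> p S"
  by (auto simp: modes_expect_def annih_def creat_def)

lemma two_pt_flip: "two_pt \<epsilon> (fst x, - snd x) (fst y, - snd y) = two_pt \<epsilon> x y"
  by (auto simp: two_pt_def)

lemma modes_expect_eq_Haf:
  assumes "finite S"
  shows "modes_expect \<epsilon> p S = Haf (\<lambda>r s. two_pt \<epsilon> (p r) (p s)) S"
proof (rule Haf_uniqueI[OF assms])
  fix T assume T: "T \<subseteq> S" "T \<noteq> {}"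
  then obtain r where r: "r \<in> T" by blast
  have fin: "finite T" using T assms finite_subset by blast
  have "modes_expect \<epsilon> p T = (\<Sum>s\<in>T - {r}. two_pt \<epsilon> (p r) (p s) * modes_expect \<epsilon> p (T - {r, s}))"
  proof (cases "snd (p r)" "0::int" rule: linorder_cases)
    case less
    then show ?thesis
      using modes_expect_rec_pos[OF fin r, of "\<lambda>r. (fst (p r), - snd (p r))" \<epsilon>]
      by (simp only: modes_expect_flip two_pt_flip) simp
  next
    case equal
    then show ?thesis using r by (auto simp: modes_expect_def two_pt_def intro!: sum.neutral)
  next
    case greater
    then show ?thesis by (rule modes_expect_rec_pos[OF fin r])
  qed
  then show "\<exists>r\<in>T. modes_expect \<epsilon> p T = (\<Sum>s\<in>T - {r}. two_pt \<epsilon> (p r) (p s) * modes_expect \<epsilon> p (T - {r, s}))"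
    using r by blast
qed (auto simp: two_pt_sym modes_expect_def annih_def creat_def pair_weight_def)

text \<open>The coefficient of h(a) z^(-a-m) in the (m-1)-st divided derivative of h(z).\<close>

definition field_coeff :: "nat \<Rightarrow> int \<Rightarrow> complex" where
  "field_coeff m a = of_int (- a - 1) gchoose (m - 1)"

text \<open>Modes beyond the weight of a monomial annihilate it, so the truncation at \<open>L\<close> does not affect the
  coefficients up to \<open>q\<^sup>L\<close>.\<close>
definition field_two_pt :: "nat \<Rightarrow> complex \<Rightarrow> nat \<times> nat \<Rightarrow> nat \<times> nat \<Rightarrow> complex fps" where
  "field_two_pt L \<epsilon> x y = (\<Sum>u\<in>{- int L..int L}. \<Sum>v\<in>{- int L..int L}.
     fps_const (field_coeff (snd x) u) * fps_const (field_coeff (snd y) v) * two_pt \<epsilon> (fst x, u) (fst y, v))"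

section \<open>Traces of zero modes of round-bracket monomials\<close>

lemma field_two_pt_sym: "field_two_pt L \<epsilon> x y = field_two_pt L \<epsilon> y x"
  unfolding field_two_pt_def by (subst sum.swap) (simp add: two_pt_sym mult_ac)

text \<open>In the matching case the diagonal entries are a constant times
  \<open>mset_choose\<close>, whose weighted sum over monomials splits by
  \<open>choose_series_eq\<close> into one factor \<open>lam\<close> per annihilator and the
  character.\<close>

lemma normal_ord_trace:
  assumes "\<forall>x\<in>set ps. fst x \<in> {1..k}"
  shows "Abs_fps (\<lambda>N. \<Sum>\<nu>\<in>basis_M k N. \<epsilon> ^ size \<nu> * normal_ord ps (basis_vec \<nu>) \<nu>)
     = char_series k \<epsilon> * modes_expect \<epsilon> ((!) ps) {..<length ps}"
proof -
  let ?A = "annih ((!) ps) {..<length ps}" and ?C = "creat ((!) ps) {..<length ps}"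
  have ex: "(\<exists>r\<in>{..<length ps}. snd (ps ! r) = 0) \<longleftrightarrow> (\<exists>x\<in>set ps. snd x = 0)"
    by (metis in_set_conv_nth lessThan_iff)
  show ?thesis
  proof (cases "(\<exists>x\<in>set ps. snd x = 0) \<or> ?A \<noteq> ?C")
    case True
    then show ?thesis unfolding modes_expect_def ex normal_ord_diag by (auto intro!: fps_ext)
  next
    case False
    have A: "\<forall>x\<in>#?A. fst x \<in> {1..k} \<and> snd x \<ge> 1"
      using assms by (auto simp: annih_nth)
    have pw: "pair_weight \<epsilon> ?A = of_nat ((\<Prod>x\<in>#?A. snd x) * mset_fact ?A) * (\<Prod>x\<in>#?A. lam \<epsilon> (snd x))"
    proof -
      have "(\<Prod>x\<in>#B. of_nat (snd x) * lam \<epsilon> (snd x)) = of_nat (\<Prod>x\<in>#B. snd x) * (\<Prod>x\<in>#B. lam \<epsilon> (snd x))" for B :: mono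
        by (induction B) (auto simp: mult_ac)
      then show ?thesis by (simp add: pair_weight_def mult_ac)
    qed
    have "Abs_fps (\<lambda>N. \<Sum>\<nu>\<in>basis_M k N. \<epsilon> ^ size \<nu> * normal_ord ps (basis_vec \<nu>) \<nu>)
        = of_nat ((\<Prod>x\<in>#?A. snd x) * mset_fact ?A) * choose_series k \<epsilon> ?A"
      unfolding normal_ord_diag choose_series_def using False
      by (intro fps_ext) (simp add: sum_distrib_left fps_mult_of_nat_nth mult_ac del: of_nat_mult, simp add: mult_ac)
    also have "\<dots> = char_series k \<epsilon> * modes_expect \<epsilon> ((!) ps) {..<length ps}"
      using False pw unfolding modes_expect_def ex choose_series_eq[OF A] by (simp add: mult_ac)
    finally show ?thesis .
  qed
qed

lemma sum_list_annih_creat: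
  fixes ps :: "(nat \<times> int) list"
  shows "sum_list (map snd ps) = int (\<Sum>x\<in>#annih ((!) ps) {..<length ps}. snd x) - int (\<Sum>x\<in>#creat ((!) ps) {..<length ps}. snd x)"
  unfolding annih_nth creat_nth by (induction ps) auto

text \<open>Nonzero entries need equal creators and annihilators that lie inside
  \<open>\<nu>\<close>. These two bounds replace the infinite sum over mode tuples by a finite
  one.\<close>

lemma normal_ord_diag_nonzero:
  fixes ps :: "(nat \<times> int) list"
  assumes "normal_ord ps (basis_vec \<nu>) \<nu> \<noteq> 0"
  shows "sum_list (map snd ps) = 0" "\<forall>x\<in>set ps. \<bar>snd x\<bar> \<le> int (wt \<nu>)"
proof -
  let ?A = "annih ((!) ps) {..<length ps}" and ?C = "creat ((!) ps) {..<length ps}"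
  have 1: "?A = ?C" "mset_choose \<nu> ?A \<noteq> 0"
    using assms by (auto simp: normal_ord_diag split: if_splits)
  then have sub: "?A \<subseteq># \<nu>" using mset_choose_nonzero_iff by blast
  show "sum_list (map snd ps) = 0" by (simp add: sum_list_annih_creat 1)
  show "\<forall>x\<in>set ps. \<bar>snd x\<bar> \<le> int (wt \<nu>)"
  proof
    fix x assume x: "x \<in> set ps"
    have "(fst x, nat \<bar>snd x\<bar>) \<in># ?A \<or> snd x = 0"
    proof (cases "snd x" "0::int" rule: linorder_cases)
      case less
      then have "(fst x, nat \<bar>snd x\<bar>) \<in># ?C" using x by (auto simp: creat_nth intro!: image_eqI[of _ _ x])
      then show ?thesis using 1 by simp
    next
      case greater
      then show ?thesis using x by (auto simp: annih_nth intro!: image_eqI[of _ _ x])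
    qed auto
    then show "\<bar>snd x\<bar> \<le> int (wt \<nu>)"
      using wt_ge[of "(fst x, nat \<bar>snd x\<bar>)" \<nu>] mset_subset_eqD[OF sub] by auto
  qed
qed

lemma bij_betw_nth_PiE:
  "bij_betw (\<lambda>xs. restrict ((!) xs) {..<q}) {xs. length xs = q \<and> set xs \<subseteq> I} (PiE {..<q} (\<lambda>_. I))"
proof (rule bij_betwI[where g = "\<lambda>f. map f [0..<q]"])
  show "(\<lambda>f. map f [0..<q]) \<in> (PiE {..<q} (\<lambda>_. I)) \<rightarrow> {xs. length xs = q \<and> set xs \<subseteq> I}"
  proof
    fix f assume f: "f \<in> PiE {..<q} (\<lambda>_. I)"
    have "f i \<in> I" if "i < q" for i using PiE_mem[OF f] that by simp
    then show "map f [0..<q] \<in> {xs. length xs = q \<and> set xs \<subseteq> I}" by auto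
  qed
  show "(\<lambda>xs. restrict ((!) xs) {..<q}) \<in> {xs. length xs = q \<and> set xs \<subseteq> I} \<rightarrow> (PiE {..<q} (\<lambda>_. I))"
    using nth_mem by (intro funcsetI restrict_PiE_iff[THEN iffD2]) blast
  show "map (restrict ((!) x) {..<q}) [0..<q] = x" if "x \<in> {xs. length xs = q \<and> set xs \<subseteq> I}" for x
    using that by (intro nth_equalityI) auto
  show "restrict ((!) (map y [0..<q])) {..<q} = y" if "y \<in> PiE {..<q} (\<lambda>_. I)" for y
    using that by (auto simp: fun_eq_iff PiE_iff extensional_def)
qed

lemma vmode_mono_trace:
  assumes \<mu>: "\<forall>x\<in>#\<mu>. fst x \<in> {1..k}" and N: "N \<le> L"
  shows "(\<Sum>\<nu>\<in>basis_M k N. \<epsilon> ^ size \<nu> * vmode_mono \<mu> (int (wt \<mu>) - 1) (basis_vec \<nu>) \<nu>)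
     = (char_series k \<epsilon> * haf_mset (field_two_pt L \<epsilon>) \<mu>) $ N"
proof -
  define gs where "gs = (SOME gs. mset gs = \<mu>)"
  have gs: "mset gs = \<mu>" unfolding gs_def by (rule someI_ex) (rule ex_mset)
  define q where "q = length gs"
  let ?I = "{- int L..int L}"
  define X where "X = {as. length as = q \<and> set as \<subseteq> ?I}"
  define P where "P as = (\<Prod>r<q. field_coeff (snd (gs ! r)) (as ! r))" for as :: "int list"
  let ?z = "\<lambda>as. zip (map fst gs) as"
  have finX: "finite X" unfolding X_def using finite_lists_length_eq[of ?I q] by (simp add: conj_commute)
  have vm: "vmode_mono \<mu> (int (wt \<mu>) - 1) (basis_vec \<nu>) \<nu>
      = (\<Sum>as\<in>X. P as * normal_ord (?z as) (basis_vec \<nu>) \<nu>)" if \<nu>: "\<nu> \<in> basis_M k N" for \<nu>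
  proof -
    have snd_z: "map snd (?z as) = as" if "length as = q" for as using that by (simp add: q_def)
    have big: "set as \<subseteq> ?I" "sum_list as = 0"
      if "length as = q" "normal_ord (?z as) (basis_vec \<nu>) \<nu> \<noteq> 0" for as
    proof -
      have 1: "sum_list (map snd (?z as)) = 0" "\<forall>x\<in>set (?z as). \<bar>snd x\<bar> \<le> int (wt \<nu>)"
        using normal_ord_diag_nonzero[OF that(2)] by auto
      show "sum_list as = 0" using 1(1) by (simp only: snd_z[OF that(1)])
      have "\<forall>x\<in>snd ` set (?z as). \<bar>x\<bar> \<le> int (wt \<nu>)" using 1(2) by blast
      then have "\<forall>x\<in>set as. \<bar>x\<bar> \<le> int (wt \<nu>)"
        by (metis snd_z[OF that(1)] set_map)
      moreover have "wt \<nu> \<le> L" using \<nu> N by (simp add: basis_M_def)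
      ultimately show "set as \<subseteq> ?I" by fastforce
    qed
    have "vmode_mono \<mu> (int (wt \<mu>) - 1) (basis_vec \<nu>) \<nu>
      = infsum (\<lambda>as. P as * normal_ord (?z as) (basis_vec \<nu>) \<nu>) {as. length as = q \<and> sum_list as = 0}"
      unfolding vmode_mono_def Let_def gs_def[symmetric] by (simp add: P_def field_coeff_def q_def)
    \<comment> \<open>The summand vanishes on tuples lying in only one of the two index sets. Unlike
      the hyperplane of tuples with sum 0, the box \<open>X\<close> is a product, so
      \<open>Haf_multilinear\<close> becomes applicable.\<close>
    also have "\<dots> = infsum (\<lambda>as. P as * normal_ord (?z as) (basis_vec \<nu>) \<nu>) X"
      by (rule infsum_cong_neutral) (use big in \<open>auto simp: X_def\<close>)
    finally show ?thesis using finX by simp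
  qed
  have len: "length (?z as) = q" if "as \<in> X" for as using that by (simp add: X_def q_def)
  have "(\<Sum>\<nu>\<in>basis_M k N. \<epsilon> ^ size \<nu> * vmode_mono \<mu> (int (wt \<mu>) - 1) (basis_vec \<nu>) \<nu>)
     = (\<Sum>as\<in>X. P as * (\<Sum>\<nu>\<in>basis_M k N. \<epsilon> ^ size \<nu> * normal_ord (?z as) (basis_vec \<nu>) \<nu>))"
    by (simp add: vm sum_distrib_left sum_distrib_right mult_ac) (rule sum.swap)
  also have "\<dots> = (\<Sum>as\<in>X. (char_series k \<epsilon> * (fps_const (P as) * modes_expect \<epsilon> ((!) (?z as)) {..<q})) $ N)"
  proof (intro sum.cong refl)
    fix as assume as: "as \<in> X"
    have "\<forall>x\<in>set (?z as). fst x \<in> {1..k}"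
      using \<mu> gs by (auto dest!: set_zip_leftD)
    from arg_cong[OF normal_ord_trace[OF this, of \<epsilon>], of "\<lambda>f. f $ N"] len[OF as]
    have "(\<Sum>\<nu>\<in>basis_M k N. \<epsilon> ^ size \<nu> * normal_ord (?z as) (basis_vec \<nu>) \<nu>)
       = (char_series k \<epsilon> * modes_expect \<epsilon> ((!) (?z as)) {..<q}) $ N"
      by simp
    then show "P as * (\<Sum>\<nu>\<in>basis_M k N. \<epsilon> ^ size \<nu> * normal_ord (?z as) (basis_vec \<nu>) \<nu>)
       = (char_series k \<epsilon> * (fps_const (P as) * modes_expect \<epsilon> ((!) (?z as)) {..<q})) $ N"
      by (simp add: mult.left_commute[of "char_series k \<epsilon>"])
  qed
  also have "\<dots> = (char_series k \<epsilon> * (\<Sum>as\<in>X. fps_const (P as) * modes_expect \<epsilon> ((!) (?z as)) {..<q})) $ N"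
    by (simp add: sum_distrib_left fps_sum_nth)
  also have "(\<Sum>as\<in>X. fps_const (P as) * modes_expect \<epsilon> ((!) (?z as)) {..<q})
     = (\<Sum>a\<in>PiE {..<q} (\<lambda>_. ?I). (\<Prod>r<q. fps_const (field_coeff (snd (gs ! r)) (a r)))
          * Haf (\<lambda>r s. two_pt \<epsilon> (fst (gs ! r), a r) (fst (gs ! s), a s)) {..<q})"
  proof (subst sum.reindex_bij_betw[OF bij_betw_nth_PiE, symmetric], unfold X_def[symmetric], intro sum.cong refl arg_cong2[where f = "(*)"])
    fix as assume as: "as \<in> X"
    have "fps_const (\<Prod>r\<in>R. F r) = (\<Prod>r\<in>R. fps_const (F r))" for R and F :: "nat \<Rightarrow> complex"
      by (induction R rule: infinite_finite_induct) (auto simp: fps_const_mult[symmetric] simp del: fps_const_mult)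
    then show "fps_const (P as) = (\<Prod>r<q. fps_const (field_coeff (snd (gs ! r)) (restrict ((!) as) {..<q} r)))"
      unfolding P_def by simp
    show "modes_expect \<epsilon> ((!) (?z as)) {..<q}
      = Haf (\<lambda>r s. two_pt \<epsilon> (fst (gs ! r), restrict ((!) as) {..<q} r) (fst (gs ! s), restrict ((!) as) {..<q} s)) {..<q}"
      unfolding modes_expect_eq_Haf[OF finite_lessThan]
      by (rule Haf_cong) (use as in \<open>auto simp: X_def q_def\<close>)
  qed
  also have "\<dots> = Haf (\<lambda>r s. field_two_pt L \<epsilon> (gs ! r) (gs ! s)) {..<q}"
    unfolding field_two_pt_def
    by (rule Haf_multilinear) (auto simp: two_pt_sym)
  also have "\<dots> = haf_mset (field_two_pt L \<epsilon>) \<mu>"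
    by (rule Haf_eq_haf_mset) (use field_two_pt_sym mset_eq_image_mset_nth[of gs] gs q_def in simp_all)
  finally show ?thesis .
qed

section \<open>Coefficients of square-bracket modes\<close>

abbreviation fexp :: "complex fls" where "fexp \<equiv> fps_to_fls (fps_exp 1)"

lemma fexp_minus_1: "fexp - 1 = fps_to_fls (fps_exp 1 - 1)"
  by simp

lemma fexp_minus_1_nonzero: "fexp - 1 \<noteq> 0"
proof
  assume "fexp - 1 = 0"
  then have "(fexp - 1) $$ 1 = 0" by simp
  then show False by simp
qed

text \<open>The weight of the creation mode h(-m) in h[-n]; \<open>ann_coeff\<close> is that of the
  annihilation mode h(m).\<close>

definition crt_coeff :: "nat \<Rightarrow> nat \<Rightarrow> complex" where
  "crt_coeff n m = sq_coeff (- int n) (- int m)"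

definition ann_coeff :: "nat \<Rightarrow> nat \<Rightarrow> complex" where
  "ann_coeff n m = sq_coeff (- int n) (int m)"

lemma crt_coeff_eq:
  assumes "n \<ge> 1" "m \<ge> 1"
  shows "crt_coeff n m = (fps_exp 1 * (fps_exp 1 - 1) ^ (m - 1)) $ (n - 1)"
proof -
  have "(fexp - 1) powi (int m - 1) = fps_to_fls ((fps_exp 1 - 1) ^ (m - 1))"
    using assms unfolding fexp_minus_1
    by (simp add: power_int_def nat_diff_distrib fps_to_fls_power del: fps_to_fls_minus)
  moreover have "int n - 1 = int (n - 1)" using assms by simp
  ultimately have "crt_coeff n m = fps_to_fls (fps_exp 1 * (fps_exp 1 - 1) ^ (m - 1)) $$ int (n - 1)"
    unfolding crt_coeff_def sq_coeff_def minus_minus by (simp only: fls_times_fps_to_fls)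
  moreover have "fps_to_fls f $$ int j = f $ j" for f :: "complex fps" and j by simp
  ultimately show ?thesis by (simp only:)
qed

lemma fps_exp_minus_1_power_nth:
  "n < i \<Longrightarrow> ((fps_exp 1 - 1 :: complex fps) ^ i) $ n = 0"
  by (rule startsby_zero_power_prefix[rule_format]) auto

text \<open>The series (e^z - 1)^(m-1) starts at z^(m-1), so h[-n] contains only the creation modes
  h(-1), ..., h(-n).\<close>

lemma crt_coeff_zero:
  assumes "n \<ge> 1" "m > n"
  shows "crt_coeff n m = 0"
proof -
  have "((fps_exp 1 - 1 :: complex fps) ^ (m - 1)) $ i = 0" if "i \<le> n - 1" for i
    using that assms by (intro fps_exp_minus_1_power_nth) auto
  then show ?thesis using assms by (simp add: crt_coeff_eq fps_mult_nth)
qed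

text \<open>This is (1 + (e^z - 1))^x = e^(xz): both sides solve f' = x f with f(0) = 1.\<close>

lemma fps_binomial_compose_exp:
  "fps_binomial x oo (fps_exp 1 - 1) = fps_exp (x :: complex)"
proof -
  let ?E = "fps_exp 1 - 1 :: complex fps" and ?B = "fps_binomial x"
  have 0: "?E $ 0 = 0" by simp
  have "(1 + fps_X) * fps_deriv ?B = fps_const x * ?B"
  proof -
    have "(1 + fps_X :: complex fps) $ 0 \<noteq> 0" by simp
    then show ?thesis
      by (simp add: fps_binomial_deriv fps_divide_unit mult.commute[of "1 + fps_X"] mult.assoc inverse_mult_eq_1)
  qed
  then have "((1 + fps_X) oo ?E) * (fps_deriv ?B oo ?E) = (fps_const x oo ?E) * (?B oo ?E)"
    by (metis fps_compose_mult_distrib[OF 0])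
  then have "fps_deriv (?B oo ?E) = fps_const x * (?B oo ?E)"
    by (simp add: fps_compose_add_distrib fps_compose_deriv[OF 0] mult.commute)
  then have "?B oo ?E = fps_const ((?B oo ?E) $ 0) * fps_exp x"
    by (simp add: fps_exp_unique_ODE)
  then show ?thesis by simp
qed

text \<open>The sum is the coefficient of z^(n-1) in e^z (1 + (e^z - 1))^x = e^((x+1)z). At x = -a-1
  it gives the weight of the mode h(a) in the vertex operator of the state h[-n]1.\<close>

lemma sum_crt_coeff_gchoose:
  assumes "n \<ge> 1" "n \<le> B"
  shows "(\<Sum>m=1..B. crt_coeff n m * (x gchoose (m - 1))) = (x + 1) ^ (n - 1) / fact (n - 1)"
proof -
  let ?E = "fps_exp 1 - 1 :: complex fps"
  have "(\<Sum>m=1..B. crt_coeff n m * (x gchoose (m - 1))) = (\<Sum>m=1..n. crt_coeff n m * (x gchoose (m - 1)))"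
    by (rule sum.mono_neutral_right) (use assms crt_coeff_zero in auto)
  also have "\<dots> = (\<Sum>i\<le>n - 1. crt_coeff n (Suc i) * (x gchoose i))"
    by (rule sum.reindex_bij_witness[of _ Suc "\<lambda>m. m - 1"]) (use assms in auto)
  also have "\<dots> = (\<Sum>i\<le>n - 1. \<Sum>k\<le>n - 1. (x gchoose i) * (fps_exp 1 $ (n - 1 - k) * (?E ^ i) $ k))"
  proof -
    have "crt_coeff n (Suc i) = (\<Sum>k\<le>n - 1. (?E ^ i) $ k * fps_exp 1 $ (n - 1 - k))" for i
    proof -
      have "crt_coeff n (Suc i) = (?E ^ i * fps_exp 1) $ (n - 1)"
        using assms by (simp add: crt_coeff_eq mult.commute)
      then show ?thesis by (simp only: fps_mult_nth atLeast0AtMost)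
    qed
    then show ?thesis by (simp add: sum_distrib_left mult_ac)
  qed
  also have "\<dots> = (\<Sum>k\<le>n - 1. fps_exp 1 $ (n - 1 - k) * (\<Sum>i\<le>n - 1. (x gchoose i) * (?E ^ i) $ k))"
    by (subst sum.swap) (simp add: sum_distrib_left mult_ac)
  also have "\<dots> = (\<Sum>k\<le>n - 1. fps_exp 1 $ (n - 1 - k) * fps_exp x $ k)"
  proof (intro sum.cong refl arg_cong2[where f = "(*)"])
    fix k assume k: "k \<in> {..n - 1}"
    have "(\<Sum>i\<le>n - 1. (x gchoose i) * (?E ^ i) $ k) = (\<Sum>i=0..k. (x gchoose i) * (?E ^ i) $ k)"
      by (rule sum.mono_neutral_right) (use k fps_exp_minus_1_power_nth in auto)
    also have "\<dots> = (fps_binomial x oo ?E) $ k" by (simp add: fps_compose_nth)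
    finally show "(\<Sum>i\<le>n - 1. (x gchoose i) * (?E ^ i) $ k) = fps_exp x $ k"
      by (simp only: fps_binomial_compose_exp)
  qed
  also have "\<dots> = (fps_exp x * fps_exp 1) $ (n - 1)"
    unfolding fps_mult_nth atLeast0AtMost by (rule sum.cong) auto
  also have "\<dots> = (x + 1) ^ (n - 1) / fact (n - 1)"
    by (simp add: fps_exp_add_mult[symmetric])
  finally show ?thesis .
qed

text \<open>Obtained by differentiating e^z (e^z - 1)^(b-1) and replacing one factor e^z by (e^z -
  1) + 1.\<close>

lemma crt_coeff_rec:
  assumes "n \<ge> 1" "b \<ge> 1"
  shows "of_nat n * crt_coeff (Suc n) b = of_nat b * crt_coeff n b + of_nat (b - 1) * crt_coeff n (b - 1)"
proof -
  let ?E = "fps_exp 1 :: complex fps"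
  have d: "fps_deriv (?E * (?E - 1) ^ j) = of_nat (Suc j) * (?E * (?E - 1) ^ j) + of_nat j * (?E * (?E - 1) ^ (j - 1))" for j
  proof (cases j)
    case (Suc i)
    have *: "?E * (?E - 1) ^ i = (?E - 1) ^ j + (?E - 1) ^ i" using Suc by (simp add: algebra_simps)
    have "fps_deriv ((?E - 1) ^ Suc i) = of_nat (Suc i) * (?E * (?E - 1) ^ i)"
      by (subst fps_deriv_power') (simp add: mult_ac del: of_nat_Suc power_Suc)
    then have "fps_deriv (?E * (?E - 1) ^ j) = ?E * (?E - 1) ^ j + of_nat j * (?E * (?E * (?E - 1) ^ i))"
      using Suc by (simp add: mult_ac del: of_nat_Suc power_Suc)
    also have "\<dots> = of_nat (Suc j) * (?E * (?E - 1) ^ j) + of_nat j * (?E * (?E - 1) ^ (j - 1))"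
      unfolding * using Suc by (simp add: algebra_simps del: power_Suc)
    finally show ?thesis .
  qed simp
  have "of_nat n * crt_coeff (Suc n) b = fps_deriv (?E * (?E - 1) ^ (b - 1)) $ (n - 1)"
    using assms unfolding fps_deriv_nth by (simp add: crt_coeff_eq)
  also have "\<dots> = of_nat b * crt_coeff n b + of_nat (b - 1) * crt_coeff n (b - 1)"
  proof (cases "b = 1")
    case False
    define c where "c = b - 2"
    have b: "b = Suc (Suc c)" using assms False by (simp add: c_def)
    show ?thesis unfolding d b using assms by (simp add: crt_coeff_eq fps_mult_of_nat_nth del: of_nat_Suc power_Suc)
  qed (use assms in \<open>simp add: crt_coeff_eq\<close>)
  finally show ?thesis .
qed

text \<open>The coefficient of \<open>w\<^bsup>n-1\<^esup>\<close> in \<open>e\<^sup>w / (e\<^sup>z - e\<^sup>w) = 1 / (e\<^bsup>z-w\<^esup> - 1)\<close>, expanded for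
  \<open>\<bar>w\<bar> < \<bar>z\<bar>\<close>; hence a multiple of the \<open>(n-1)\<close>-st derivative of \<open>1 / (e\<^sup>z - 1)\<close>.\<close>
definition polar_sum :: "nat \<Rightarrow> complex fls" where
  "polar_sum n = (\<Sum>b=1..n. fls_const (crt_coeff n b) * inverse (fexp - 1) ^ b)"

section \<open>The expansion of 1 / (e^(z-w) - 1) and Bernoulli numbers\<close>

lemma fls_deriv_inverse_fexp:
  "fls_deriv (inverse (fexp - 1) ^ b) = - of_nat b * (fexp * inverse (fexp - 1) ^ Suc b)"
proof -
  let ?U = "fexp - 1"
  have dU: "fls_deriv ?U = fexp" by (simp add: fls_deriv_fps_to_fls)
  \<comment> \<open>The derivative of the reciprocal is extracted from the product rule for
    \<open>?U * inverse ?U = 1\<close>.\<close>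
  have "fls_deriv (?U * inverse ?U) = fls_deriv 1"
    by (simp only: right_inverse[OF fexp_minus_1_nonzero])
  then have "?U * fls_deriv (inverse ?U) + fexp * inverse ?U = 0"
    unfolding fls_deriv_mult dU by simp
  then have "?U * fls_deriv (inverse ?U) = - (fexp * inverse ?U)"
    by (simp only: eq_neg_iff_add_eq_0)
  then have "inverse ?U * (?U * fls_deriv (inverse ?U)) = inverse ?U * - (fexp * inverse ?U)" by simp
  moreover have "inverse ?U * (?U * fls_deriv (inverse ?U)) = fls_deriv (inverse ?U)"
    using fexp_minus_1_nonzero by (simp only: mult.assoc[symmetric] left_inverse) simp
  ultimately have "fls_deriv (inverse ?U) = - (fexp * inverse ?U ^ 2)"
    by (simp only: power2_eq_square mult_ac mult_minus_right)
  note dV = this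
  show ?thesis
  proof (cases b)
    case (Suc c)
    have "fls_deriv (inverse ?U ^ Suc c) = of_nat (Suc c) * inverse ?U ^ c * - (fexp * inverse ?U ^ 2)"
      by (simp only: fls_deriv_power[of _ "Suc c"] diff_Suc_1 dV)
    also have "\<dots> = - of_nat (Suc c) * (fexp * inverse ?U ^ Suc (Suc c))"
      by (simp only: power2_eq_square power_Suc mult_ac mult_minus_left mult_minus_right)
    finally show ?thesis by (simp only: Suc)
  qed simp
qed

text \<open>The generating function depends on z - w only, so its w-derivative is minus its
  z-derivative; this is the comparison of coefficients at w^(n-1). The proof checks it termwise with
  \<open>crt_coeff_rec\<close>.\<close>

lemma polar_sum_Suc:
  assumes "n \<ge> 1"
  shows "of_nat n * polar_sum (Suc n) = - fls_deriv (polar_sum n)"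
proof -
  let ?V = "inverse (fexp - 1)"
  have EV: "fexp * ?V ^ Suc b = ?V ^ b + ?V ^ Suc b" for b
  proof -
    have "fexp * ?V ^ Suc b = ((fexp - 1) * ?V) * ?V ^ b + ?V ^ Suc b" by (simp add: algebra_simps)
    then show ?thesis using fexp_minus_1_nonzero by simp
  qed
  let ?c = "\<lambda>b. fls_const (crt_coeff n b)"
  have "- fls_deriv (polar_sum n) = (\<Sum>b=1..n. ?c b * of_nat b * (?V ^ b + ?V ^ Suc b))"
    unfolding polar_sum_def fls_deriv_sum fls_deriv_mult_const_left fls_deriv_inverse_fexp EV
    by (simp add: sum_negf[symmetric] mult.assoc)
  also have "\<dots> = (\<Sum>b=1..n. ?c b * of_nat b * ?V ^ b) + (\<Sum>b=1..n. ?c b * of_nat b * ?V ^ Suc b)"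
    by (simp add: distrib_left sum.distrib)
  also have "(\<Sum>b=1..n. ?c b * of_nat b * ?V ^ b) = (\<Sum>b=1..Suc n. ?c b * of_nat b * ?V ^ b)"
    using crt_coeff_zero[of n "Suc n"] assms by simp
  also have "(\<Sum>b=1..n. ?c b * of_nat b * ?V ^ Suc b) = (\<Sum>b=1..Suc n. ?c (b - 1) * of_nat (b - 1) * ?V ^ b)"
  proof -
    have "(\<Sum>b=1..Suc n. ?c (b - 1) * of_nat (b - 1) * ?V ^ b) = (\<Sum>b=0..n. ?c b * of_nat b * ?V ^ Suc b)"
      by (simp only: One_nat_def sum.shift_bounds_cl_Suc_ivl) simp
    also have "\<dots> = (\<Sum>b=1..n. ?c b * of_nat b * ?V ^ Suc b)"
      by (simp add: sum.atLeast_Suc_atMost)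
    finally show ?thesis by simp
  qed
  also have "(\<Sum>b=1..Suc n. ?c b * of_nat b * ?V ^ b) + (\<Sum>b=1..Suc n. ?c (b - 1) * of_nat (b - 1) * ?V ^ b)
     = (\<Sum>b=1..Suc n. of_nat n * (fls_const (crt_coeff (Suc n) b) * ?V ^ b))"
    unfolding sum.distrib[symmetric]
  proof (intro sum.cong refl)
    fix b assume b: "b \<in> {1..Suc n}"
    have "of_nat n * fls_const (crt_coeff (Suc n) b) = fls_const (of_nat n * crt_coeff (Suc n) b)"
      by (simp add: fls_of_nat fls_const_mult_const)
    also have "\<dots> = of_nat b * ?c b + of_nat (b - 1) * ?c (b - 1)"
      using crt_coeff_rec[OF assms, of b] b by (simp add: fls_of_nat fls_const_mult_const fls_plus_const)
    finally have "of_nat n * fls_const (crt_coeff (Suc n) b) = of_nat b * ?c b + of_nat (b - 1) * ?c (b - 1)" .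
    then show "?c b * of_nat b * ?V ^ b + ?c (b - 1) * of_nat (b - 1) * ?V ^ b
      = of_nat n * (fls_const (crt_coeff (Suc n) b) * ?V ^ b)"
      by (simp only: mult.assoc[symmetric]) (simp add: algebra_simps)
  qed
  finally show ?thesis by (simp only: polar_sum_def sum_distrib_left)
qed

text \<open>Iterating \<open>polar_sum_Suc\<close> makes n! times the sum equal to (-1)^n times the
  n-th derivative of 1 / (e^z - 1); the Pochhammer symbol is the effect of that derivative on a
  coefficient.\<close>

lemma polar_sum_nth:
  "fact n * polar_sum (Suc n) $$ i
     = (-1) ^ n * pochhammer (of_int (i + 1)) n * inverse (fexp - 1) $$ (i + int n)"
proof (induction n arbitrary: i)
  case 0
  then show ?case by (simp add: polar_sum_def crt_coeff_eq)
next
  case (Suc n)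
  have "(of_nat (Suc n) * polar_sum (Suc (Suc n))) $$ i = - (of_int (i + 1) * polar_sum (Suc n) $$ (i + 1))"
    by (subst polar_sum_Suc) auto
  then have r: "of_nat (Suc n) * polar_sum (Suc (Suc n)) $$ i = - (of_int (i + 1) * polar_sum (Suc n) $$ (i + 1))"
    by (simp add: fls_of_nat del: of_nat_Suc)
  have "fact (Suc n) * polar_sum (Suc (Suc n)) $$ i = fact n * (of_nat (Suc n) * polar_sum (Suc (Suc n)) $$ i)"
    by (simp add: algebra_simps)
  also have "\<dots> = - (of_int (i + 1)) * (fact n * polar_sum (Suc n) $$ (i + 1))"
    unfolding r by (simp only: mult_ac mult_minus_left mult_minus_right)
  also have "\<dots> = (-1) ^ Suc n * pochhammer (of_int (i + 1)) (Suc n) * inverse (fexp - 1) $$ (i + int (Suc n))"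
    unfolding Suc.IH by (simp add: pochhammer_rec algebra_simps)
  finally show ?case .
qed

text \<open>With V = 1 / (e^z - 1), the series b e^z V^(b+1) is minus the derivative of V^b. The
  factor b is the one that h(b) carries as an operator.\<close>

lemma ann_coeff_eq:
  assumes "n \<ge> 1"
  shows "of_nat b * ann_coeff n b = - of_nat n * (inverse (fexp - 1) ^ b) $$ int n"
proof -
  have "(fexp - 1) powi (- int b - 1) = inverse (fexp - 1) ^ Suc b"
    by (simp add: power_int_def power_inverse nat_add_distrib)
  then have "of_nat b * ann_coeff n b = of_nat b * (fexp * inverse (fexp - 1) ^ Suc b) $$ (int n - 1)"
    by (simp add: ann_coeff_def sq_coeff_def)
  also have "\<dots> = - (fls_deriv (inverse (fexp - 1) ^ b) $$ (int n - 1))"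
    unfolding fls_deriv_inverse_fexp by (simp add: fls_of_nat del: power_Suc)
  also have "\<dots> = - of_nat n * (inverse (fexp - 1) ^ b) $$ int n"
    by simp
  finally show ?thesis .
qed

lemma inverse_fexp_nth:
  assumes "N \<ge> 1"
  shows "inverse (fexp - 1) $$ (int N - 1) = bernoulli_num N / fact N"
  by (simp add: bernoulli_num_def field_class.field_divide_inverse[where 'a = "complex fls"] fls_X_times_conv_shift)

text \<open>The annihilation part of h[-n'] contracted with the creation part of h[-n]. By
  \<open>ann_coeff_eq\<close> the sum over b assembles \<open>polar_sum n\<close>, whose coefficient
  at z^n' is a Bernoulli number.\<close>

lemma sum_ann_crt_coeff:
  assumes "n \<ge> 1" "n' \<ge> 1" "n \<le> B"
  shows "(\<Sum>b=1..B. of_nat b * ann_coeff n' b * crt_coeff n b)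
     = (-1) ^ (n + 1) * of_nat n * of_nat ((n' + n - 1) choose n) * (- bernoulli_num (n' + n) / fact (n' + n))"
proof -
  obtain k where k: "n = Suc k" using assms by (cases n) auto
  have "(\<Sum>b=1..B. of_nat b * ann_coeff n' b * crt_coeff n b) = (\<Sum>b=1..n. of_nat b * ann_coeff n' b * crt_coeff n b)"
    by (rule sum.mono_neutral_right) (use assms crt_coeff_zero in auto)
  also have "\<dots> = - of_nat n' * polar_sum n $$ int n'"
    by (simp add: ann_coeff_eq[OF assms(2)] polar_sum_def fls_nth_sum sum_distrib_left mult_ac sum_negf)
  also have "\<dots> = - of_nat n' * ((-1) ^ k * pochhammer (of_nat (n' + 1)) k * (bernoulli_num (n' + n) / fact (n' + n)) / fact k)"
  proof -
    have "fact k * polar_sum n $$ int n' = (-1) ^ k * pochhammer (of_nat (n' + 1)) k * (bernoulli_num (n' + n) / fact (n' + n))"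
      using polar_sum_nth[of k "int n'"] inverse_fexp_nth[of "n' + n"] k by (simp add: add_ac)
    then show ?thesis by (simp add: field_simps)
  qed
  also have "pochhammer (of_nat (n' + 1)) k = (fact (n' + k) / fact n' :: complex)"
  proof -
    have "fact (n' + k) = fact n' * (pochhammer (of_nat (n' + 1)) k :: complex)"
      unfolding pochhammer_fact pochhammer_product'[of _ n' k] by (simp add: add_ac)
    then show ?thesis by simp
  qed
  also have "- of_nat n' * ((-1) ^ k * (fact (n' + k) / fact n') * (bernoulli_num (n' + n) / fact (n' + n)) / fact k)
     = (-1) ^ k * (of_nat n' * fact (n' + k) / (fact n' * fact k)) * (- bernoulli_num (n' + n) / fact (n' + n))"
    by (simp add: field_simps)
  \<comment> \<open>The factorials are regrouped into the constant b C(a+b-1,b) of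
    \<open>hatE\<close>, with a = n' and b = n.\<close>
  also have "of_nat n' * fact (n' + k) / (fact n' * fact k) = of_nat n * (of_nat ((n' + n - 1) choose n) :: complex)"
  proof -
    obtain l where l: "n' = Suc l" using assms by (cases n') auto
    have "of_nat ((n' + n - 1) choose n) = (fact (n' + k) / (fact n * fact l) :: complex)"
      using k l by (subst binomial_fact) auto
    moreover have "fact n = (of_nat n * fact k :: complex)" "fact n' = (of_nat n' * fact l :: complex)"
      using k l by simp_all
    ultimately show ?thesis using assms by simp
  qed
  finally show ?thesis using k by simp
qed

text \<open>For b(z) = z / (e^z - 1) one has b(-z) - b(z) = z. The result matches the contraction
  constant with the convention that Eisenstein series of odd weight are 0.\<close>

lemma bernoulli_num_odd:
  assumes "odd N" "N \<ge> 2"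
  shows "bernoulli_num N = 0"
proof -
  define b where "b = Abs_fps (\<lambda>n. bernoulli_num n / fact n)"
  let ?E = "fps_exp 1 - 1 :: complex fps"
  let ?F = "fls_X / (fexp - 1)"
  have "fls_subdegree ?F \<ge> 0"
  proof -
    have "fls_subdegree (fexp - 1) = 1"
      by (rule fls_subdegree_eqI) auto
    then show ?thesis by (simp add: fls_divide_subdegree fexp_minus_1_nonzero)
  qed
  then have "?F = fps_to_fls b"
    by (intro fls_eqI) (auto simp: b_def bernoulli_num_def)
  then have "fps_to_fls (b * ?E) = fps_to_fls fps_X"
    using fexp_minus_1_nonzero by (simp add: fls_times_fps_to_fls field_simps)
  then have bE: "b * ?E = fps_X" by (simp only: fps_to_fls_eq_iff)
  let ?m = "fps_const (- 1) * fps_X :: complex fps"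
  let ?b' = "b oo ?m"
  have "?b' * (fps_exp (-1) - 1) = - fps_X"
  proof -
    have "(b * ?E) oo ?m = ?b' * (?E oo ?m)" by (rule fps_compose_mult_distrib) simp
    moreover have "?E oo ?m = fps_exp (-1) - 1" by (simp add: fps_compose_sub_distrib fps_exp_compose_linear)
    ultimately show ?thesis by (simp add: bE)
  qed
  then have "?b' * ((fps_exp (-1) - 1) * fps_exp 1) = - (fps_X * fps_exp 1)"
    by (simp only: mult.assoc[symmetric]) simp
  moreover have "(fps_exp (-1) - 1) * fps_exp 1 = - ?E"
    by (simp add: left_diff_distrib fps_exp_add_mult[symmetric])
  ultimately have b'E: "?b' * ?E = fps_X * fps_exp 1" by (simp only: mult_minus_right neg_equal_iff_equal)
  then have "(?b' - b) * ?E = fps_X * ?E"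
    unfolding left_diff_distrib b'E bE by (simp add: right_diff_distrib)
  moreover have "?E \<noteq> 0" using bE by auto
  ultimately have "?b' - b = fps_X" by simp
  then have "(?b' - b) $ N = 0" using assms by simp
  then have "- 2 * (b $ N) = 0" using assms by (simp add: fps_nth_compose_linear)
  then show ?thesis by (simp add: b_def)
qed

section \<open>Contraction of square-bracket modes\<close>

definition supp :: "vec \<Rightarrow> mono set" where "supp v = {\<mu>. v \<mu> \<noteq> 0}"

definition good :: "(nat \<times> nat) set \<Rightarrow> vec \<Rightarrow> bool" where
  "good G v \<longleftrightarrow> finite (supp v) \<and> (\<forall>\<mu>\<in>supp v. set_mset \<mu> \<subseteq> G)"

definition mult_gen :: "nat \<times> nat \<Rightarrow> vec \<Rightarrow> vec" where
  "mult_gen x v = (\<lambda>\<mu>. if x \<in># \<mu> then v (\<mu> - {#x#}) else 0)"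

text \<open>With states read as polynomials in the generators, this is the partial derivative by
  \<open>x\<close>, and \<open>mult_gen\<close> is multiplication by \<open>x\<close>; both are
  written on coefficients.\<close>

definition diff_gen :: "nat \<times> nat \<Rightarrow> vec \<Rightarrow> vec" where
  "diff_gen x v = (\<lambda>\<mu>. of_nat (Suc (count \<mu> x)) * v (add_mset x \<mu>))"

definition sq_op :: "nat \<Rightarrow> nat \<Rightarrow> nat \<Rightarrow> vec \<Rightarrow> vec" where
  "sq_op B j n v = (\<lambda>\<mu>. (\<Sum>m=1..B. crt_coeff n m * mult_gen (j, m) v \<mu>)
      + (\<Sum>m=1..B. of_nat m * ann_coeff n m * diff_gen (j, m) v \<mu>))"

lemma hmode_neg: "m \<ge> 1 \<Longrightarrow> hmode j (- int m) v = mult_gen (j, m) v"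
  by (auto simp: hmode_def mult_gen_def)

lemma hmode_pos: "m \<ge> 1 \<Longrightarrow> hmode j (int m) v \<mu> = of_nat m * diff_gen (j, m) v \<mu>"
  by (simp add: hmode_def diff_gen_def)

lemma sum_symmetric_int:
  fixes F :: "int \<Rightarrow> 'b::comm_monoid_add"
  assumes "F 0 = 0"
  shows "(\<Sum>m\<in>{- int B..int B}. F m) = (\<Sum>m=1..B. F (- int m)) + (\<Sum>m=1..B. F (int m))"
proof -
  have eq: "{- int B..int B} = insert 0 ((\<lambda>m. - int m) ` {1..B} \<union> int ` {1..B})"
  proof (intro equalityI subsetI)
    fix m assume m: "m \<in> {- int B..int B}"
    show "m \<in> insert 0 ((\<lambda>m. - int m) ` {1..B} \<union> int ` {1..B})"
    proof (cases m "0::int" rule: linorder_cases)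
      case less
      then have "m = - int (nat (- m))" "nat (- m) \<in> {1..B}" using m by auto
      then show ?thesis by blast
    next
      case greater
      then have "m = int (nat m)" "nat m \<in> {1..B}" using m by auto
      then show ?thesis by blast
    qed simp
  qed auto
  show ?thesis
    unfolding eq
    by (subst sum.insert, simp, force, subst sum.union_disjoint) (auto simp: assms sum.reindex inj_on_def)
qed

text \<open>Creation modes beyond \<open>n\<close> have coefficient 0, and annihilation modes beyond
  \<open>B\<close> kill \<open>v\<close> because no generator of \<open>v\<close> has a larger mode
  number.\<close>

lemma sq_hmode_eq:
  assumes v: "good ({1..k} \<times> {1..B}) v" and n: "1 \<le> n" "n \<le> B"
  shows "sq_hmode j (- int n) v = sq_op B j n v"
proof
  fix \<nu>
  let ?F = "\<lambda>m. sq_coeff (- int n) m * hmode j m v \<nu>"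
  have "?F m = 0" if "m \<notin> {- int B..int B}" for m
  proof (cases "m < 0")
    case True
    then have "m = - int (nat (- m))" by simp
    then have "sq_coeff (- int n) m = crt_coeff n (nat (- m))" unfolding crt_coeff_def by simp
    also have "\<dots> = 0" using crt_coeff_zero that n True by auto
    finally show ?thesis by simp
  next
    case False
    then have m: "m = int (nat m)" "nat m \<ge> 1" "nat m > B" using that n by auto
    then have "v (add_mset (j, nat m) \<nu>) = 0"
      using v by (auto simp: good_def supp_def)
    then have "hmode j m v \<nu> = 0"
      using hmode_pos[OF m(2), of j v \<nu>] m(1) by (simp add: diff_gen_def)
    then show ?thesis by simp
  qed
  then have "sq_hmode j (- int n) v \<nu> = (\<Sum>\<^sub>\<infinity>m\<in>{- int B..int B}. ?F m)"
    unfolding sq_hmode_def by (intro infsum_cong_neutral) auto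
  also have "\<dots> = (\<Sum>m\<in>{- int B..int B}. ?F m)" by simp
  also have "\<dots> = (\<Sum>m=1..B. ?F (- int m)) + (\<Sum>m=1..B. ?F (int m))"
    by (rule sum_symmetric_int) simp
  also have "\<dots> = sq_op B j n v \<nu>"
    unfolding sq_op_def
    by (intro arg_cong2[where f = "(+)"] sum.cong refl)
       (simp_all add: hmode_neg hmode_pos crt_coeff_def ann_coeff_def)
  finally show "sq_hmode j (- int n) v \<nu> = sq_op B j n v \<nu>" .
qed

lemma diff_gen_mult_gen:
  "diff_gen y (mult_gen x v) \<mu> = (if x = y then v \<mu> else 0) + mult_gen x (diff_gen y v) \<mu>"
proof (cases "x = y")
  case True
  show ?thesis
  proof (cases "x \<in># \<mu>")
    case True
    then have "add_mset x (\<mu> - {#x#}) = \<mu>" "Suc (count \<mu> x - 1) = count \<mu> x"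
      by (auto simp: Suc_diff_le)
    then show ?thesis using \<open>x = y\<close> True
      by (simp add: diff_gen_def mult_gen_def algebra_simps)
  next
    case False
    then show ?thesis using \<open>x = y\<close> by (simp add: diff_gen_def mult_gen_def, simp add: not_in_iff)
  qed
next
  case False
  then show ?thesis
    by (auto simp: diff_gen_def mult_gen_def diff_add_mset_swap)
qed

lemma diff_gen_commute: "diff_gen x (diff_gen y v) = diff_gen y (diff_gen x v)"
  by (auto simp: diff_gen_def fun_eq_iff add_mset_commute)

text \<open>Derivatives commute with each other, so only the multiplication by \<open>y\<close>
  inside \<open>sq_op\<close> fails to commute, which leaves the scalar
  \<open>crt_coeff\<close>.\<close>

lemma diff_gen_sq_op:
  assumes "snd y \<in> {1..B}"
  shows "diff_gen y (sq_op B j n v) \<mu>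
     = (if fst y = j then crt_coeff n (snd y) else 0) * v \<mu> + sq_op B j n (diff_gen y v) \<mu>"
proof -
  have "diff_gen y (sq_op B j n v) \<mu>
      = (\<Sum>m=1..B. crt_coeff n m * diff_gen y (mult_gen (j, m) v) \<mu>)
      + (\<Sum>m=1..B. of_nat m * ann_coeff n m * diff_gen y (diff_gen (j, m) v) \<mu>)"
    by (simp add: diff_gen_def[of y] sq_op_def sum_distrib_left distrib_left mult_ac del: of_nat_Suc)
  also have "\<dots> = (\<Sum>m=1..B. crt_coeff n m * (if (j, m) = y then v \<mu> else 0)) + sq_op B j n (diff_gen y v) \<mu>"
    by (simp add: diff_gen_mult_gen diff_gen_commute[of y] sq_op_def distrib_left sum.distrib)
  also have "(\<Sum>m=1..B. crt_coeff n m * (if (j, m) = y then v \<mu> else 0))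
      = (\<Sum>m=1..B. if m = snd y then (if fst y = j then crt_coeff n (snd y) else 0) * v \<mu> else 0)"
    by (rule sum.cong) (auto simp: prod_eq_iff)
  finally show ?thesis using assms by (simp add: sum.delta)
qed

lemma sq_op_sum:
  assumes "finite S"
  shows "sq_op B j n (\<lambda>\<mu>. \<Sum>s\<in>S. c s * f s \<mu>) = (\<lambda>\<mu>. \<Sum>s\<in>S. c s * sq_op B j n (f s) \<mu>)"
  using assms
proof (induction S)
  case (insert s S)
  have "sq_op B j n (\<lambda>\<mu>. a * g \<mu> + h \<mu>) \<mu> = a * sq_op B j n g \<mu> + sq_op B j n h \<mu>" for a g h \<mu>
  proof -
    have "mult_gen x (\<lambda>\<mu>. a * g \<mu> + h \<mu>) \<mu> = a * mult_gen x g \<mu> + mult_gen x h \<mu>"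
         "diff_gen x (\<lambda>\<mu>. a * g \<mu> + h \<mu>) \<mu> = a * diff_gen x g \<mu> + diff_gen x h \<mu>" for x
      by (simp_all add: mult_gen_def diff_gen_def algebra_simps)
    then show ?thesis
      by (simp add: sq_op_def distrib_left sum.distrib sum_distrib_left mult_ac)
  qed
  with insert show ?case by (simp add: fun_eq_iff)
qed (simp add: sq_op_def mult_gen_def diff_gen_def fun_eq_iff)

lemma supp_mult_gen: "supp (mult_gen x v) = add_mset x ` supp v"
  by (auto simp: supp_def mult_gen_def image_iff) (metis insert_DiffM)

lemma supp_diff_gen: "supp (diff_gen x v) = {\<mu>. add_mset x \<mu> \<in> supp v}"
  by (auto simp: supp_def diff_gen_def simp del: of_nat_Suc)

lemma finite_supp_diff_gen: "finite (supp v) \<Longrightarrow> finite (supp (diff_gen x v))"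
  unfolding supp_diff_gen by (rule finite_subset[of _ "(\<lambda>\<mu>. \<mu> - {#x#}) ` supp v"]) force+

lemma good_vac: "good G vac"
  by (auto simp: good_def supp_def vac_def)

lemma good_diff_gen: "good G v \<Longrightarrow> good G (diff_gen x v)"
  using finite_supp_diff_gen[of v x] by (fastforce simp: good_def supp_diff_gen)

lemma good_mult_gen: "good G v \<Longrightarrow> x \<in> G \<Longrightarrow> good G (mult_gen x v)"
  by (auto simp: good_def supp_mult_gen)

lemma good_sum:
  assumes "finite S" "\<And>s. s \<in> S \<Longrightarrow> good G (f s)"
  shows "good G (\<lambda>\<mu>. \<Sum>s\<in>S. c s * f s \<mu>)"
proof -
  have "supp (\<lambda>\<mu>. \<Sum>s\<in>S. c s * f s \<mu>) \<subseteq> (\<Union>s\<in>S. supp (f s))"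
    by (auto simp: supp_def intro!: sum.neutral)
  with assms show ?thesis unfolding good_def
    by (meson UN_E finite_UN finite_subset subset_iff)
qed

lemma good_sq_op:
  assumes "good ({1..k} \<times> {1..B}) v" "j \<in> {1..k}"
  shows "good ({1..k} \<times> {1..B}) (sq_op B j n v)"
proof -
  let ?G = "{1..k} \<times> {1..B}"
  have 1: "good ?G (\<lambda>\<mu>. \<Sum>m=1..B. crt_coeff n m * mult_gen (j, m) v \<mu>)"
    by (rule good_sum) (use assms good_mult_gen in auto)
  have 2: "good ?G (\<lambda>\<mu>. \<Sum>m=1..B. of_nat m * ann_coeff n m * diff_gen (j, m) v \<mu>)"
    by (rule good_sum) (use assms good_diff_gen in auto)
  have "supp (\<lambda>\<mu>. f \<mu> + g \<mu>) \<subseteq> supp f \<union> supp g" for f g by (auto simp: supp_def)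
  with 1 2 show ?thesis unfolding good_def sq_op_def
    by (meson Un_iff finite_UnI finite_subset subset_iff)
qed

text \<open>The Gaussian moment functional with covariance \<open>\<kappa>\<close>: the linear
  extension of the hafnian from monomials to states.\<close>

definition wick :: "(nat \<times> nat \<Rightarrow> nat \<times> nat \<Rightarrow> complex fps) \<Rightarrow> vec \<Rightarrow> complex fps" where
  "wick \<kappa> v = (\<Sum>\<mu>\<in>supp v. fps_const (v \<mu>) * haf_mset \<kappa> \<mu>)"

lemma wick_superset:
  assumes "finite S" "supp v \<subseteq> S"
  shows "wick \<kappa> v = (\<Sum>\<mu>\<in>S. fps_const (v \<mu>) * haf_mset \<kappa> \<mu>)"
  unfolding wick_def by (rule sum.mono_neutral_left) (use assms in \<open>auto simp: supp_def\<close>)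

lemma wick_sum:
  assumes "finite T" "\<And>t. t \<in> T \<Longrightarrow> finite (supp (f t))"
  shows "wick \<kappa> (\<lambda>\<mu>. \<Sum>t\<in>T. c t * f t \<mu>) = (\<Sum>t\<in>T. fps_const (c t) * wick \<kappa> (f t))"
proof -
  define S where "S = (\<Union>t\<in>T. supp (f t))"
  have S: "finite S" using assms by (simp add: S_def)
  have "supp (\<lambda>\<mu>. \<Sum>t\<in>T. c t * f t \<mu>) \<subseteq> S"
    by (auto simp: supp_def S_def intro!: sum.neutral)
  then have "wick \<kappa> (\<lambda>\<mu>. \<Sum>t\<in>T. c t * f t \<mu>) = (\<Sum>\<mu>\<in>S. fps_const (\<Sum>t\<in>T. c t * f t \<mu>) * haf_mset \<kappa> \<mu>)"
    by (rule wick_superset[OF S])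
  also have "\<dots> = (\<Sum>\<mu>\<in>S. \<Sum>t\<in>T. fps_const (c t) * (fps_const (f t \<mu>) * haf_mset \<kappa> \<mu>))"
  proof (rule sum.cong[OF refl])
    fix \<mu>
    have "fps_const (\<Sum>t\<in>T. c t * f t \<mu>) = (\<Sum>t\<in>T. fps_const (c t) * fps_const (f t \<mu>))"
      using assms(1) by (induction T) (auto simp: fps_const_add[symmetric] simp del: fps_const_add)
    then show "fps_const (\<Sum>t\<in>T. c t * f t \<mu>) * haf_mset \<kappa> \<mu> = (\<Sum>t\<in>T. fps_const (c t) * (fps_const (f t \<mu>) * haf_mset \<kappa> \<mu>))"
      by (simp only: sum_distrib_right mult.assoc)
  qed
  also have "\<dots> = (\<Sum>t\<in>T. fps_const (c t) * (\<Sum>\<mu>\<in>S. fps_const (f t \<mu>) * haf_mset \<kappa> \<mu>))"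
    by (subst sum.swap) (simp only: sum_distrib_left)
  also have "\<dots> = (\<Sum>t\<in>T. fps_const (c t) * wick \<kappa> (f t))"
  proof (intro sum.cong refl arg_cong2[where f = "(*)"])
    fix t assume "t \<in> T"
    then show "(\<Sum>\<mu>\<in>S. fps_const (f t \<mu>) * haf_mset \<kappa> \<mu>) = wick \<kappa> (f t)"
      by (intro wick_superset[OF S, symmetric]) (auto simp: S_def)
  qed
  finally show ?thesis .
qed

lemma wick_add:
  assumes "finite (supp f)" "finite (supp g)"
  shows "wick \<kappa> (\<lambda>\<mu>. f \<mu> + g \<mu>) = wick \<kappa> f + wick \<kappa> g"
  using wick_sum[of "{True, False}" "\<lambda>b. if b then f else g" \<kappa> "\<lambda>_. 1"] assms by simp

lemma sum_mset_eq_sum_count: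
  fixes f :: "'a \<Rightarrow> 'b::comm_semiring_1"
  assumes "finite G" "set_mset \<mu> \<subseteq> G"
  shows "(\<Sum>y\<in>#\<mu>. f y) = (\<Sum>y\<in>G. of_nat (count \<mu> y) * f y)"
  using assms(2)
proof (induction \<mu>)
  case (add x \<mu>)
  have "(\<Sum>y\<in>G. of_nat (count (add_mset x \<mu>) y) * f y)
     = (\<Sum>y\<in>G. of_nat (count \<mu> y) * f y + (if y = x then f y else 0))"
    by (rule sum.cong) (auto simp: algebra_simps)
  then show ?case using add assms(1) by (simp add: sum.distrib sum.delta add.commute)
qed simp

lemma wick_diff_gen:
  assumes "finite (supp v)"
  shows "wick \<kappa> (diff_gen x v) = (\<Sum>\<mu>\<in>supp v. fps_const (v \<mu>) * (of_nat (count \<mu> x) * haf_mset \<kappa> (\<mu> - {#x#})))"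
proof -
  have "wick \<kappa> (diff_gen x v) = (\<Sum>\<mu>\<in>{\<mu>\<in>supp v. x \<in># \<mu>}. fps_const (v \<mu>) * (of_nat (count \<mu> x) * haf_mset \<kappa> (\<mu> - {#x#})))"
    unfolding wick_def
  proof (rule sum.reindex_bij_witness[of _ "\<lambda>\<mu>. \<mu> - {#x#}" "add_mset x"])
    fix \<mu> assume "\<mu> \<in> supp (diff_gen x v)"
    show "fps_const (v (add_mset x \<mu>)) * (of_nat (count (add_mset x \<mu>) x) * haf_mset \<kappa> (add_mset x \<mu> - {#x#})) =
         fps_const (diff_gen x v \<mu>) * haf_mset \<kappa> \<mu>"
    proof -
      have "fps_const (diff_gen x v \<mu>) = fps_const (v (add_mset x \<mu>)) * of_nat (Suc (count \<mu> x))"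
        unfolding diff_gen_def fps_of_nat[symmetric] fps_const_mult by (simp only: mult.commute)
      then show ?thesis by (simp add: mult.assoc del: of_nat_Suc)
    qed
  qed (auto simp: supp_diff_gen)
  also have "\<dots> = (\<Sum>\<mu>\<in>supp v. fps_const (v \<mu>) * (of_nat (count \<mu> x) * haf_mset \<kappa> (\<mu> - {#x#})))"
    by (rule sum.mono_neutral_left) (use assms in \<open>auto simp: not_in_iff\<close>)
  finally show ?thesis .
qed

text \<open>Gaussian integration by parts. The row expansion of the factor \<open>x\<close> over the
  entries \<open>y\<close> of a monomial is differentiation by \<open>y\<close>, since
  \<open>diff_gen\<close> supplies the multiplicity.\<close>

lemma wick_mult_gen:
  assumes sym: "\<And>x y. \<kappa> x y = \<kappa> y x" and v: "good G v" and G: "finite G"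
  shows "wick \<kappa> (mult_gen x v) = (\<Sum>y\<in>G. \<kappa> x y * wick \<kappa> (diff_gen y v))"
proof -
  have fin: "finite (supp v)" using v by (simp add: good_def)
  have "wick \<kappa> (mult_gen x v) = (\<Sum>\<mu>\<in>supp v. fps_const (v \<mu>) * haf_mset \<kappa> (add_mset x \<mu>))"
    unfolding wick_def supp_mult_gen by (subst sum.reindex) (auto simp: inj_on_def mult_gen_def)
  also have "\<dots> = (\<Sum>\<mu>\<in>supp v. fps_const (v \<mu>) * (\<Sum>y\<in>G. of_nat (count \<mu> y) * (\<kappa> x y * haf_mset \<kappa> (\<mu> - {#y#}))))"
    by (intro sum.cong refl arg_cong2[where f = "(*)"], subst haf_mset_add[OF sym])
       (rule sum_mset_eq_sum_count, use G v in \<open>auto simp: good_def\<close>)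
  also have "\<dots> = (\<Sum>\<mu>\<in>supp v. \<Sum>y\<in>G. \<kappa> x y * (fps_const (v \<mu>) * (of_nat (count \<mu> y) * haf_mset \<kappa> (\<mu> - {#y#}))))"
    by (simp only: sum_distrib_left mult_ac)
  also have "\<dots> = (\<Sum>y\<in>G. \<kappa> x y * wick \<kappa> (diff_gen y v))"
    by (subst sum.swap) (simp only: sum_distrib_left[symmetric] wick_diff_gen[OF fin])
  finally show ?thesis .
qed

lemma wick_sq_op:
  assumes sym: "\<And>x y. \<kappa> x y = \<kappa> y x" and v: "good ({1..k} \<times> {1..B}) v"
  shows "wick \<kappa> (sq_op B j n v)
     = (\<Sum>m=1..B. fps_const (crt_coeff n m) * (\<Sum>y\<in>{1..k} \<times> {1..B}. \<kappa> (j, m) y * wick \<kappa> (diff_gen y v)))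
     + (\<Sum>m=1..B. fps_const (of_nat m * ann_coeff n m) * wick \<kappa> (diff_gen (j, m) v))"
proof -
  have fin: "finite (supp v)" using v by (simp add: good_def)
  have fin1: "finite (supp (mult_gen x v))" "finite (supp (diff_gen x v))" for x
    using fin finite_supp_diff_gen by (auto simp: supp_mult_gen)
  have fin2: "finite (supp (\<lambda>\<mu>. \<Sum>m=1..B. c m * f m \<mu>))" if "\<And>m. finite (supp (f m))" for c :: "nat \<Rightarrow> complex" and f
    by (rule finite_subset[of _ "\<Union>m\<in>{1..B}. supp (f m)"]) (use that in \<open>auto simp: supp_def intro!: sum.neutral\<close>)
  have "wick \<kappa> (sq_op B j n v) = wick \<kappa> (\<lambda>\<mu>. \<Sum>m=1..B. crt_coeff n m * mult_gen (j, m) v \<mu>)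
      + wick \<kappa> (\<lambda>\<mu>. \<Sum>m=1..B. of_nat m * ann_coeff n m * diff_gen (j, m) v \<mu>)"
    unfolding sq_op_def by (rule wick_add) (intro fin2 fin1)+
  also have "wick \<kappa> (\<lambda>\<mu>. \<Sum>m=1..B. crt_coeff n m * mult_gen (j, m) v \<mu>)
      = (\<Sum>m=1..B. fps_const (crt_coeff n m) * wick \<kappa> (mult_gen (j, m) v))"
    by (rule wick_sum) (use fin1 in auto)
  also have "wick \<kappa> (\<lambda>\<mu>. \<Sum>m=1..B. of_nat m * ann_coeff n m * diff_gen (j, m) v \<mu>)
      = (\<Sum>m=1..B. fps_const (of_nat m * ann_coeff n m) * wick \<kappa> (diff_gen (j, m) v))"
    by (rule wick_sum) (use fin1 in auto)
  finally show ?thesis using wick_mult_gen[OF sym v] by simp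
qed

text \<open>The coefficient of z^(n-1) in e^(-uz), that is, the weight of h(u) in the vertex
  operator of the state h[-n]1.\<close>

definition mode_weight :: "nat \<Rightarrow> int \<Rightarrow> complex" where
  "mode_weight n u = of_int (- u) ^ (n - 1) / fact (n - 1)"

lemma sum_crt_coeff_field_coeff:
  assumes "1 \<le> n" "n \<le> B"
  shows "(\<Sum>m=1..B. crt_coeff n m * field_coeff m u) = mode_weight n u"
  using sum_crt_coeff_gchoose[OF assms, of "of_int (- u - 1)"]
  by (simp add: field_coeff_def mode_weight_def)

lemma fps_const_sum: "fps_const (\<Sum>x\<in>A. f x) = (\<Sum>x\<in>A. fps_const (f x))"
  by (induction A rule: infinite_finite_induct) (auto simp: fps_const_add[symmetric] simp del: fps_const_add)

text \<open>Summing over the generators \<open>m\<close> and \<open>b\<close> before the modes turns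
  the binomial weights into \<open>mode_weight\<close>; \<open>two_pt\<close> then keeps only
  opposite modes, and u = a and u = -a are merged.\<close>

lemma sum_crt_field_two_pt:
  assumes n: "1 \<le> n" "n \<le> B" and n': "1 \<le> n'" "n' \<le> B"
  shows "(\<Sum>m=1..B. fps_const (crt_coeff n m) * (\<Sum>b=1..B. field_two_pt L \<epsilon> (j, m) (j, b) * fps_const (crt_coeff n' b)))
     = (\<Sum>a=1..L. fps_const ((mode_weight n (int a) * mode_weight n' (- int a)
           + mode_weight n (- int a) * mode_weight n' (int a)) * of_nat a) * lam \<epsilon> a)"
    (is "?lhs = _")
proof -
  let ?I = "{- int L..int L}"
  let ?c = "\<lambda>n m u. fps_const (crt_coeff n m * field_coeff m u)"
  have "?lhs = (\<Sum>m=1..B. \<Sum>b=1..B. \<Sum>u\<in>?I. \<Sum>v\<in>?I. ?c n m u * ?c n' b v * two_pt \<epsilon> (j, u) (j, v))"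
    unfolding field_two_pt_def fps_const_mult[symmetric]
    by (simp only: fst_conv snd_conv sum_distrib_left sum_distrib_right mult_ac)
  also have "\<dots> = (\<Sum>m=1..B. \<Sum>u\<in>?I. \<Sum>v\<in>?I. \<Sum>b=1..B. ?c n m u * ?c n' b v * two_pt \<epsilon> (j, u) (j, v))"
    by (intro sum.cong refl trans[OF sum.swap] sum.swap)
  also have "\<dots> = (\<Sum>m=1..B. \<Sum>u\<in>?I. \<Sum>v\<in>?I. ?c n m u * (fps_const (mode_weight n' v) * two_pt \<epsilon> (j, u) (j, v)))"
    by (simp only: sum_crt_coeff_field_coeff[OF n', symmetric] fps_const_sum sum_distrib_left sum_distrib_right mult.assoc)
  also have "\<dots> = (\<Sum>u\<in>?I. \<Sum>v\<in>?I. \<Sum>m=1..B. ?c n m u * (fps_const (mode_weight n' v) * two_pt \<epsilon> (j, u) (j, v)))"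
    by (rule trans[OF sum.swap]) (intro sum.cong refl sum.swap)
  also have "\<dots> = (\<Sum>u\<in>?I. \<Sum>v\<in>?I. fps_const (mode_weight n u) * (fps_const (mode_weight n' v) * two_pt \<epsilon> (j, u) (j, v)))"
    by (simp only: sum_crt_coeff_field_coeff[OF n, symmetric] fps_const_sum sum_distrib_right)
  also have "\<dots> = (\<Sum>u\<in>?I. fps_const (mode_weight n u) * (fps_const (mode_weight n' (- u)) * two_pt \<epsilon> (j, u) (j, - u)))"
  proof (rule sum.cong[OF refl])
    fix u assume u: "u \<in> ?I"
    have "(\<Sum>v\<in>?I. fps_const (mode_weight n u) * (fps_const (mode_weight n' v) * two_pt \<epsilon> (j, u) (j, v)))
      = (\<Sum>v\<in>{- u}. fps_const (mode_weight n u) * (fps_const (mode_weight n' v) * two_pt \<epsilon> (j, u) (j, v)))"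
      by (rule sum.mono_neutral_right) (use u in \<open>auto simp: two_pt_def\<close>)
    then show "(\<Sum>v\<in>?I. fps_const (mode_weight n u) * (fps_const (mode_weight n' v) * two_pt \<epsilon> (j, u) (j, v)))
      = fps_const (mode_weight n u) * (fps_const (mode_weight n' (- u)) * two_pt \<epsilon> (j, u) (j, - u))" by simp
  qed
  also have "\<dots> = (\<Sum>a=1..L. fps_const (mode_weight n (- int a)) * (fps_const (mode_weight n' (int a)) * two_pt \<epsilon> (j, - int a) (j, int a)))
      + (\<Sum>a=1..L. fps_const (mode_weight n (int a)) * (fps_const (mode_weight n' (- int a)) * two_pt \<epsilon> (j, int a) (j, - int a)))"
    by (subst sum_symmetric_int) (auto simp: two_pt_def)
  also have "\<dots> = (\<Sum>a=1..L. fps_const ((mode_weight n (int a) * mode_weight n' (- int a)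
           + mode_weight n (- int a) * mode_weight n' (int a)) * of_nat a) * lam \<epsilon> a)"
    unfolding sum.distrib[symmetric]
  proof (rule sum.cong[OF refl])
    fix a assume a: "a \<in> {1..L}"
    then have tp: "two_pt \<epsilon> (j, - int a) (j, int a) = fps_const (of_nat a) * lam \<epsilon> a"
      "two_pt \<epsilon> (j, int a) (j, - int a) = fps_const (of_nat a) * lam \<epsilon> a"
      by (auto simp: two_pt_def fps_of_nat)
    show "fps_const (mode_weight n (- int a)) * (fps_const (mode_weight n' (int a)) * two_pt \<epsilon> (j, - int a) (j, int a))
       + fps_const (mode_weight n (int a)) * (fps_const (mode_weight n' (- int a)) * two_pt \<epsilon> (j, int a) (j, - int a))
       = fps_const ((mode_weight n (int a) * mode_weight n' (- int a)
           + mode_weight n (- int a) * mode_weight n' (int a)) * of_nat a) * lam \<epsilon> a"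
      unfolding tp fps_const_mult[symmetric] fps_const_add[symmetric] by (simp only: algebra_simps)
  qed
  finally show ?thesis .
qed

text \<open>The \<open>q\<close>-expansions of \<open>E\<^sub>K\<close> for \<open>\<epsilon> = 1\<close> and of \<open>F\<^sub>K\<close> for \<open>\<epsilon> = -1\<close>.\<close>
definition eis_series :: "complex \<Rightarrow> nat \<Rightarrow> complex fps" where
  "eis_series \<epsilon> K = (if even K then Abs_fps (\<lambda>t. if t = 0 then - bernoulli_num K / fact K
      else 2 / fact (K - 1) * (\<Sum>a | a dvd t. of_nat a ^ (K - 1) * \<epsilon> ^ (t div a))) else 0)"

definition hat_coeff :: "nat \<Rightarrow> nat \<Rightarrow> complex" where
  "hat_coeff a b = (-1) ^ (b + 1) * of_nat b * of_nat ((a + b - 1) choose b)"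

definition hat_series :: "complex \<Rightarrow> nat \<Rightarrow> nat \<Rightarrow> complex fps" where
  "hat_series \<epsilon> a b = fps_const (hat_coeff a b) * eis_series \<epsilon> (a + b)"

lemma hat_coeff_eq:
  assumes "a \<ge> 1" "b \<ge> 1"
  shows "hat_coeff a b = (-1) ^ (b + 1) * fact (a + b - 1) / (fact (a - 1) * fact (b - 1))"
proof -
  have "of_nat ((a + b - 1) choose b) = (fact (a + b - 1) / (fact b * fact (a - 1)) :: complex)"
    using assms by (subst binomial_fact) auto
  moreover have "fact b = (of_nat b * fact (b - 1) :: complex)"
    using assms by (cases b) auto
  ultimately show ?thesis using assms by (simp add: hat_coeff_def)
qed

text \<open>For even \<open>a + b\<close> the two signs agree and the factorial form is symmetric;
  for odd \<open>a + b\<close> the Eisenstein series is 0. Row expansions of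
  \<open>wick_kernel\<close> rest on this symmetry.\<close>

lemma hat_series_commute:
  assumes "a \<ge> 1" "b \<ge> 1"
  shows "hat_series \<epsilon> a b = hat_series \<epsilon> b a"
proof (cases "even (a + b)")
  case True
  then have "(-1 :: complex) ^ (b + 1) = (-1) ^ (a + 1)" by (auto simp: uminus_power_if)
  then have "hat_coeff a b = hat_coeff b a"
    using assms by (simp only: hat_coeff_eq add.commute[of b a] mult.commute[of "fact (b - 1)"])
  then show ?thesis by (simp add: hat_series_def add.commute)
next
  case False
  then show ?thesis by (simp add: hat_series_def eis_series_def)
qed

text \<open>The modes a and -a carry the signs (-1)^(n-1) and (-1)^(n'-1), so they cancel for odd n
  + n' and reinforce each other otherwise, which is the 2 in the Eisenstein coefficients.\<close>

lemma mode_weight_sum: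
  assumes n: "1 \<le> n" and n': "1 \<le> n'"
  shows "(mode_weight n (int a) * mode_weight n' (- int a) + mode_weight n (- int a) * mode_weight n' (int a)) * of_nat a
     = (if even (n + n') then hat_coeff n n' * (2 / fact (n + n' - 1)) * of_nat a ^ (n + n' - 1) else 0)"
proof -
  obtain k l where kl: "n = Suc k" "n' = Suc l" using n n' by (cases n; cases n') auto
  have m: "mode_weight n (int a) = (-1) ^ k * of_nat a ^ k / fact k" "mode_weight n (- int a) = of_nat a ^ k / fact k"
    "mode_weight n' (int a) = (-1) ^ l * of_nat a ^ l / fact l" "mode_weight n' (- int a) = of_nat a ^ l / fact l"
    by (auto simp: mode_weight_def kl power_minus[of "of_nat a"])
  have "(mode_weight n (int a) * mode_weight n' (- int a) + mode_weight n (- int a) * mode_weight n' (int a)) * of_nat a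
     = ((-1) ^ k + (-1) ^ l) * (of_nat a ^ (n + n' - 1) / (fact k * fact l))"
    unfolding m by (simp add: kl power_add field_simps)
  also have "\<dots> = (if even (n + n') then hat_coeff n n' * (2 / fact (n + n' - 1)) * of_nat a ^ (n + n' - 1) else 0)"
  proof (cases "even (n + n')")
    case True
    then have "(-1 :: complex) ^ k = (-1) ^ l" by (auto simp: uminus_power_if kl)
    moreover have "hat_coeff n n' * (2 / fact (n + n' - 1)) = 2 * (-1) ^ l / (fact k * fact l)"
      by (subst hat_coeff_eq[OF n n']) (simp add: kl del: fact_Suc)
    ultimately show ?thesis using True by simp
  next
    case False
    then show ?thesis by (auto simp: uminus_power_if kl)
  qed
  finally show ?thesis .
qed

lemma contraction_nth:
  assumes n: "1 \<le> n" "n \<le> B" and n': "1 \<le> n'" "n' \<le> B" and t: "t \<le> L"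
  shows "((\<Sum>m=1..B. fps_const (crt_coeff n m) * (\<Sum>b=1..B. field_two_pt L \<epsilon> (j, m) (j, b) * fps_const (crt_coeff n' b)))
      + (\<Sum>m=1..B. fps_const (of_nat m * ann_coeff n m) * fps_const (crt_coeff n' m))) $ t = hat_series \<epsilon> n n' $ t"
proof -
  have K: "n + n' \<ge> 2" using n n' by simp
  have const: "(\<Sum>m=1..B. fps_const (of_nat m * ann_coeff n m) * fps_const (crt_coeff n' m))
     = fps_const (hat_coeff n n' * (- bernoulli_num (n + n') / fact (n + n')))"
    using sum_ann_crt_coeff[OF n'(1) n(1) n'(2)]
    by (simp add: fps_const_sum[symmetric] hat_coeff_def)
  show ?thesis
  proof (cases "t = 0")
    \<comment> \<open>\<open>lam\<close> has no constant term, so only the Bernoulli constant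
      remains, and it vanishes for odd weight.\<close>
    case True
    then show ?thesis
      unfolding sum_crt_field_two_pt[OF n n'] const using bernoulli_num_odd[OF _ K]
      by (simp add: fps_sum_nth lam_def hat_series_def eis_series_def)
  next
    case False
    \<comment> \<open>Only modes dividing \<open>t\<close> contribute to the coefficient of
      \<open>q^t\<close>, and \<open>t \<le> L\<close> keeps all of them inside the
      truncation.\<close>
    have "(\<Sum>a=1..L. (if even (n + n') then hat_coeff n n' * (2 / fact (n + n' - 1)) * of_nat a ^ (n + n' - 1) else 0) * lam \<epsilon> a $ t)
       = (\<Sum>a | a dvd t. (if even (n + n') then hat_coeff n n' * (2 / fact (n + n' - 1)) * of_nat a ^ (n + n' - 1) else 0) * \<epsilon> ^ (t div a))"
    proof (rule sum.mono_neutral_cong_right)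
      show "{a. a dvd t} \<subseteq> {1..L}"
      proof
        fix a assume "a \<in> {a. a dvd t}"
        then have "a \<le> t" "a \<noteq> 0" using False by (auto intro: dvd_imp_le)
        then show "a \<in> {1..L}" using t by simp
      qed
    qed (use False in \<open>auto simp: lam_def\<close>)
    then show ?thesis
      unfolding sum_crt_field_two_pt[OF n n'] const mode_weight_sum[OF n(1) n'(1)] using False
      by (simp add: fps_sum_nth hat_series_def eis_series_def sum_distrib_left mult_ac)
  qed
qed

section \<open>Induction over the square-bracket factors\<close>

definition sq_list :: "nat \<Rightarrow> (nat \<Rightarrow> nat) \<Rightarrow> (nat \<Rightarrow> nat) \<Rightarrow> nat list \<Rightarrow> vec" where
  "sq_list B i n L = foldr (\<lambda>r. sq_op B (i r) (n r)) L vac"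

lemma sq_list_simps [simp]:
  "sq_list B i n [] = vac" "sq_list B i n (r # L) = sq_op B (i r) (n r) (sq_list B i n L)"
  by (simp_all add: sq_list_def)

lemma good_sq_list:
  "\<forall>r\<in>set L. i r \<in> {1..k} \<Longrightarrow> good ({1..k} \<times> {1..B}) (sq_list B i n L)"
  by (induction L) (simp_all add: good_vac good_sq_op del: One_nat_def)

lemma sq_list_eq_foldr:
  assumes "\<forall>r\<in>set L. i r \<in> {1..k} \<and> 1 \<le> n r \<and> n r \<le> B"
  shows "foldr (\<lambda>r w. sq_hmode (i r) (- int (n r)) w) L vac = sq_list B i n L"
  using assms
proof (induction L)
  case (Cons r L)
  have "good ({1..k} \<times> {1..B}) (sq_list B i n L)" by (rule good_sq_list) (use Cons in auto)
  with Cons sq_hmode_eq show ?case by simp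
qed simp

lemma diff_gen_vac: "diff_gen y vac = (\<lambda>_. 0)"
  by (auto simp: diff_gen_def vac_def)

text \<open>The derivative moves to the right, leaves one scalar for each factor it passes, and
  finally kills the vacuum. Distinct labels make \<open>remove1\<close> identify the factor that was
  used.\<close>

lemma diff_gen_sq_list:
  assumes "distinct L" "snd y \<in> {1..B}"
  shows "diff_gen y (sq_list B i n L) = (\<lambda>\<mu>. \<Sum>s\<in>set L.
     (if fst y = i s then crt_coeff (n s) (snd y) else 0) * sq_list B i n (remove1 s L) \<mu>)"
  using assms(1)
proof (induction L)
  case (Cons r L)
  let ?c = "\<lambda>s. if fst y = i s then crt_coeff (n s) (snd y) else 0"
  have IH: "diff_gen y (sq_list B i n L) = (\<lambda>\<mu>. \<Sum>s\<in>set L. ?c s * sq_list B i n (remove1 s L) \<mu>)"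
    using Cons by simp
  show ?case
  proof
    fix \<mu>
    have "diff_gen y (sq_list B i n (r # L)) \<mu> = ?c r * sq_list B i n L \<mu>
        + (\<Sum>s\<in>set L. ?c s * sq_op B (i r) (n r) (sq_list B i n (remove1 s L)) \<mu>)"
      using diff_gen_sq_op[OF assms(2)] by (simp add: IH sq_op_sum)
    also have "(\<Sum>s\<in>set L. ?c s * sq_op B (i r) (n r) (sq_list B i n (remove1 s L)) \<mu>)
       = (\<Sum>s\<in>set L. ?c s * sq_list B i n (remove1 s (r # L)) \<mu>)"
      by (rule sum.cong) (use Cons.prems in auto)
    finally show "diff_gen y (sq_list B i n (r # L)) \<mu>
      = (\<Sum>s\<in>set (r # L). ?c s * sq_list B i n (remove1 s (r # L)) \<mu>)"
      using Cons.prems by simp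
  qed
qed (simp add: diff_gen_vac)

lemma field_two_pt_neq: "j \<noteq> j' \<Longrightarrow> field_two_pt L \<epsilon> (j, m) (j', b) = 0"
  by (simp add: field_two_pt_def two_pt_def)

lemma fps_mult_nth_cong:
  fixes f g f' g' :: "complex fps"
  assumes "\<forall>t\<le>N. f $ t = f' $ t" "\<forall>t\<le>N. g $ t = g' $ t" "t \<le> N"
  shows "(f * g) $ t = (f' * g') $ t"
  unfolding fps_mult_nth by (rule sum.cong) (use assms in auto)

definition wick_kernel :: "complex \<Rightarrow> (nat \<Rightarrow> nat) \<Rightarrow> (nat \<Rightarrow> nat) \<Rightarrow> nat \<Rightarrow> nat \<Rightarrow> complex fps" where
  "wick_kernel \<epsilon> i n r s = (if i r = i s then 1 else 0) * hat_series \<epsilon> (n r) (n s)"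

text \<open>\<open>Q s\<close> is the total contraction of factor \<open>r\<close> with factor
  \<open>s\<close>. It depends on the truncation \<open>N\<close> and is known to agree with the
  kernel only through \<open>q^N\<close>, hence the existential form.\<close>

lemma wick_sq_op_sq_list:
  assumes L: "distinct (r # L)" and ok: "\<forall>r\<in>set (r # L). i r \<in> {1..k} \<and> 1 \<le> n r \<and> n r \<le> B"
  shows "\<exists>Q. (\<forall>s\<in>set L. \<forall>t\<le>N. Q s $ t = wick_kernel \<epsilon> i n r s $ t) \<and>
     wick (field_two_pt N \<epsilon>) (sq_list B i n (r # L)) = (\<Sum>s\<in>set L. Q s * wick (field_two_pt N \<epsilon>) (sq_list B i n (remove1 s L)))"
proof -
  let ?\<kappa> = "field_two_pt N \<epsilon>" and ?W = "\<lambda>s. wick (field_two_pt N \<epsilon>) (sq_list B i n (remove1 s L))"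
  let ?j = "i r" and ?n = "n r"
  let ?d = "\<lambda>s y. if fst y = i s then crt_coeff (n s) (snd y) else 0 :: complex"
  \<comment> \<open>The first sum comes from the creation part of the factor \<open>r\<close>,
    contracted through the two-point function; the second from its annihilation part, which
    differentiates the factor \<open>s\<close> directly.\<close>
  define Q where "Q s = (\<Sum>m=1..B. fps_const (crt_coeff ?n m) * (\<Sum>y\<in>{1..k} \<times> {1..B}. ?\<kappa> (?j, m) y * fps_const (?d s y)))
      + (\<Sum>m=1..B. fps_const (of_nat m * ann_coeff ?n m) * fps_const (?d s (?j, m)))" for s
  have good: "good ({1..k} \<times> {1..B}) (sq_list B i n (remove1 s L))" for s
    by (rule good_sq_list) (use ok set_remove1_subset in fastforce)
  have good': "good ({1..k} \<times> {1..B}) (sq_list B i n L)"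
    by (rule good_sq_list) (use ok in auto)
  have Wd: "wick ?\<kappa> (diff_gen y (sq_list B i n L)) = (\<Sum>s\<in>set L. fps_const (?d s y) * ?W s)"
    if "snd y \<in> {1..B}" for y
    unfolding diff_gen_sq_list[OF distinct.simps(2)[THEN iffD1, OF L, THEN conjunct2] that]
    by (rule wick_sum) (use good in \<open>auto simp: good_def\<close>)
  have "wick ?\<kappa> (sq_list B i n (r # L))
     = (\<Sum>m=1..B. fps_const (crt_coeff ?n m) * (\<Sum>y\<in>{1..k} \<times> {1..B}. ?\<kappa> (?j, m) y * (\<Sum>s\<in>set L. fps_const (?d s y) * ?W s)))
     + (\<Sum>m=1..B. fps_const (of_nat m * ann_coeff ?n m) * (\<Sum>s\<in>set L. fps_const (?d s (?j, m)) * ?W s))"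
    unfolding sq_list_simps wick_sq_op[OF field_two_pt_sym good']
    by (intro arg_cong2[where f = "(+)"] sum.cong refl arg_cong2[where f = "(*)"] Wd) auto
  also have "\<dots> = (\<Sum>m=1..B. \<Sum>s\<in>set L. fps_const (crt_coeff ?n m) * (\<Sum>y\<in>{1..k} \<times> {1..B}. ?\<kappa> (?j, m) y * fps_const (?d s y)) * ?W s)
     + (\<Sum>m=1..B. \<Sum>s\<in>set L. fps_const (of_nat m * ann_coeff ?n m) * fps_const (?d s (?j, m)) * ?W s)"
  proof -
    have *: "(\<Sum>y\<in>Y. K y * (\<Sum>s\<in>set L. D s y * ?W s)) = (\<Sum>s\<in>set L. (\<Sum>y\<in>Y. K y * D s y) * ?W s)"
      for Y :: "(nat \<times> nat) set" and K and D :: "nat \<Rightarrow> nat \<times> nat \<Rightarrow> complex fps"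
      unfolding sum_distrib_left sum_distrib_right by (subst sum.swap) (simp only: mult.assoc)
    have **: "c * (\<Sum>s\<in>set L. D s * ?W s) = (\<Sum>s\<in>set L. c * D s * ?W s)" for c and D :: "nat \<Rightarrow> complex fps"
      by (simp add: sum_distrib_left mult.assoc)
    show ?thesis unfolding * by (simp only: **)
  qed
  also have "\<dots> = (\<Sum>s\<in>set L. Q s * ?W s)"
    unfolding Q_def distrib_right sum.distrib sum_distrib_right
    by (intro arg_cong2[where f = "(+)"] sum.swap)
  finally have W: "wick ?\<kappa> (sq_list B i n (r # L)) = (\<Sum>s\<in>set L. Q s * ?W s)" .
  have "Q s $ t = wick_kernel \<epsilon> i n r s $ t" if s: "s \<in> set L" and t: "t \<le> N" for s t
  proof (cases "i r = i s")
    case True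
    have isk: "i s \<in> {1..k}" using ok s by auto
    have "(\<Sum>y\<in>{1..k} \<times> {1..B}. ?\<kappa> (?j, m) y * fps_const (?d s y))
       = (\<Sum>b=1..B. ?\<kappa> (?j, m) (?j, b) * fps_const (crt_coeff (n s) b))" for m
    proof -
      have "(\<Sum>y\<in>{1..k} \<times> {1..B}. ?\<kappa> (?j, m) y * fps_const (?d s y))
        = (\<Sum>y\<in>Pair (i s) ` {1..B}. ?\<kappa> (?j, m) y * fps_const (?d s y))"
        by (rule sum.mono_neutral_right) (use isk in auto)
      then show ?thesis by (simp add: sum.reindex inj_on_def True)
    qed
    then have "Q s $ t = hat_series \<epsilon> (n r) (n s) $ t"
      unfolding Q_def using contraction_nth[of "n r" B "n s" t N \<epsilon> "i r"] ok s t True by simp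
    then show ?thesis using True by (simp add: wick_kernel_def)
  next
    case False
    have zero: "?\<kappa> (?j, m) y * fps_const (?d s y) = 0" for m y
      using False field_two_pt_neq[of ?j "fst y" N \<epsilon> m "snd y"] by auto
    have "Q s = 0" unfolding Q_def zero using False by simp
    then show ?thesis using False by (simp add: wick_kernel_def)
  qed
  with W show ?thesis by blast
qed

text \<open>The head of the list serves as the row of the expansion. Agreement through
  \<open>q^N\<close> survives multiplication, since coefficients of a product up to N involve only
  coefficients up to N.\<close>

lemma wick_sq_list_nth:
  assumes "distinct L" "\<forall>r\<in>set L. i r \<in> {1..k} \<and> 1 \<le> n r \<and> n r \<le> B" "t \<le> N"
  shows "wick (field_two_pt N \<epsilon>) (sq_list B i n L) $ t = Haf (wick_kernel \<epsilon> i n) (set L) $ t"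
  using assms
proof (induction "length L" arbitrary: L t rule: less_induct)
  case less
  show ?case
  proof (cases L)
    case Nil
    have "supp vac = {{#}}" by (auto simp: supp_def vac_def)
    then show ?thesis by (simp add: Nil wick_def vac_def)
  next
    case (Cons r L')
    obtain Q where Q: "\<And>s t. s \<in> set L' \<Longrightarrow> t \<le> N \<Longrightarrow> Q s $ t = wick_kernel \<epsilon> i n r s $ t"
      "wick (field_two_pt N \<epsilon>) (sq_list B i n L) = (\<Sum>s\<in>set L'. Q s * wick (field_two_pt N \<epsilon>) (sq_list B i n (remove1 s L')))"
      using wick_sq_op_sq_list[of r L' i k n B N \<epsilon>] less.prems(1,2) unfolding Cons by blast
    have dis: "r \<notin> set L'" "distinct L'" using less.prems Cons by auto
    have "wick (field_two_pt N \<epsilon>) (sq_list B i n L) $ t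
        = (\<Sum>s\<in>set L'. (Q s * wick (field_two_pt N \<epsilon>) (sq_list B i n (remove1 s L'))) $ t)"
      by (simp add: Q(2) fps_sum_nth)
    also have "\<dots> = (\<Sum>s\<in>set L'. (wick_kernel \<epsilon> i n r s * Haf (wick_kernel \<epsilon> i n) (set L - {r, s})) $ t)"
    proof (intro sum.cong refl fps_mult_nth_cong[where N = N] allI impI)
      fix s t assume s: "s \<in> set L'" and t: "t \<le> N"
      have "set (remove1 s L') = set L - {r, s}" using dis Cons by auto
      moreover have "wick (field_two_pt N \<epsilon>) (sq_list B i n (remove1 s L')) $ t
         = Haf (wick_kernel \<epsilon> i n) (set (remove1 s L')) $ t"
        by (rule less.hyps) (use less.prems s t dis Cons set_remove1_subset[of s L'] in \<open>auto simp: length_remove1\<close>)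
      ultimately show "wick (field_two_pt N \<epsilon>) (sq_list B i n (remove1 s L')) $ t
         = Haf (wick_kernel \<epsilon> i n) (set L - {r, s}) $ t" by simp
    qed (use Q less.prems in auto)
    also have "\<dots> = (\<Sum>s\<in>set L - {r}. wick_kernel \<epsilon> i n r s * Haf (wick_kernel \<epsilon> i n) (set L - {r, s})) $ t"
      using dis by (simp add: Cons fps_sum_nth)
    also have "(\<Sum>s\<in>set L - {r}. wick_kernel \<epsilon> i n r s * Haf (wick_kernel \<epsilon> i n) (set L - {r, s})) = Haf (wick_kernel \<epsilon> i n) (set L)"
    proof (rule Haf_rec[symmetric])
      fix u v assume "u \<in> set L" "v \<in> set L"
      then show "wick_kernel \<epsilon> i n u v = wick_kernel \<epsilon> i n v u"
        using less.prems(2) by (auto simp: wick_kernel_def intro: hat_series_commute)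
    qed (use Cons in auto)
    finally show ?thesis .
  qed
qed

lemma zero_mode_trace:
  assumes v: "good ({1..k} \<times> {1..B}) v"
  shows "(\<Sum>\<nu>\<in>basis_M k N. \<epsilon> ^ size \<nu> * zero_mode v (basis_vec \<nu>) \<nu>)
     = (char_series k \<epsilon> * wick (field_two_pt N \<epsilon>) v) $ N"
proof -
  have "(\<Sum>\<nu>\<in>basis_M k N. \<epsilon> ^ size \<nu> * zero_mode v (basis_vec \<nu>) \<nu>)
    = (\<Sum>\<nu>\<in>basis_M k N. \<Sum>\<mu>\<in>supp v. v \<mu> * (\<epsilon> ^ size \<nu> * vmode_mono \<mu> (int (wt \<mu>) - 1) (basis_vec \<nu>) \<nu>))"
    unfolding zero_mode_def supp_def[symmetric] by (simp add: sum_distrib_left mult_ac)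
  also have "\<dots> = (\<Sum>\<mu>\<in>supp v. v \<mu> * (\<Sum>\<nu>\<in>basis_M k N. \<epsilon> ^ size \<nu> * vmode_mono \<mu> (int (wt \<mu>) - 1) (basis_vec \<nu>) \<nu>))"
    by (subst sum.swap) (simp only: sum_distrib_left)
  also have "\<dots> = (\<Sum>\<mu>\<in>supp v. (fps_const (v \<mu>) * (char_series k \<epsilon> * haf_mset (field_two_pt N \<epsilon>) \<mu>)) $ N)"
  proof (rule sum.cong[OF refl])
    fix \<mu> assume "\<mu> \<in> supp v"
    then have "\<forall>x\<in>#\<mu>. fst x \<in> {1..k}" using v by (force simp: good_def)
    then show "v \<mu> * (\<Sum>\<nu>\<in>basis_M k N. \<epsilon> ^ size \<nu> * vmode_mono \<mu> (int (wt \<mu>) - 1) (basis_vec \<nu>) \<nu>)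
      = (fps_const (v \<mu>) * (char_series k \<epsilon> * haf_mset (field_two_pt N \<epsilon>) \<mu>)) $ N"
      by (subst vmode_mono_trace) auto
  qed
  also have "\<dots> = (char_series k \<epsilon> * wick (field_two_pt N \<epsilon>) v) $ N"
    by (simp only: wick_def sum_distrib_left fps_sum_nth mult.left_commute)
  finally show ?thesis .
qed

text \<open>The modes are truncated at the very weight \<open>N\<close> whose coefficient is read,
  so the result no longer mentions a truncation.\<close>

lemma sq_state_trace:
  assumes "\<forall>r\<in>{1..p}. n r \<ge> 1" "\<forall>r\<in>{1..p}. i r \<in> {1..k}"
  shows "(\<Sum>\<nu>\<in>basis_M k N. \<epsilon> ^ size \<nu> * zero_mode (sq_state p i n) (basis_vec \<nu>) \<nu>)
     = (char_series k \<epsilon> * Haf (wick_kernel \<epsilon> i n) {1..p}) $ N"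
proof -
  \<comment> \<open>Any common upper bound of the \<open>n r\<close> would serve; the sum also makes
    sense for p = 0.\<close>
  define B where "B = (\<Sum>r=1..p. n r)"
  have B: "n r \<le> B" if "r \<in> {1..p}" for r
    unfolding B_def by (rule member_le_sum) (use that in auto)
  have ok: "\<forall>r\<in>set [1..<Suc p]. i r \<in> {1..k} \<and> 1 \<le> n r \<and> n r \<le> B" using assms B by auto
  have "sq_state p i n = sq_list B i n [1..<Suc p]"
    unfolding sq_state_def by (rule sq_list_eq_foldr[OF ok])
  moreover have "good ({1..k} \<times> {1..B}) (sq_list B i n [1..<Suc p])"
    by (rule good_sq_list) (use ok in auto)
  ultimately have "(\<Sum>\<nu>\<in>basis_M k N. \<epsilon> ^ size \<nu> * zero_mode (sq_state p i n) (basis_vec \<nu>) \<nu>)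
     = (char_series k \<epsilon> * wick (field_two_pt N \<epsilon>) (sq_list B i n [1..<Suc p])) $ N"
    using zero_mode_trace by simp
  also have "\<dots> = (char_series k \<epsilon> * Haf (wick_kernel \<epsilon> i n) {1..p}) $ N"
  proof (rule fps_mult_nth_cong[where N = N])
    show "\<forall>t\<le>N. wick (field_two_pt N \<epsilon>) (sq_list B i n [1..<Suc p]) $ t = Haf (wick_kernel \<epsilon> i n) {1..p} $ t"
      using wick_sq_list_nth[OF distinct_upt ok, of _ N \<epsilon>] by (simp add: atLeastLessThanSuc_atLeastAtMost del: upt_Suc)
  qed auto
  finally show ?thesis .
qed

section \<open>Evaluation in the unit disc\<close>

lemma fps_conv_radius_ge_1I:
  fixes f :: "complex fps"
  assumes le: "\<And>n. norm (f $ n) \<le> g n" and g: "\<And>r. 0 < r \<Longrightarrow> r < 1 \<Longrightarrow> summable (\<lambda>n. g n * r ^ n)"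
  shows "1 \<le> fps_conv_radius f"
  unfolding fps_conv_radius_def
proof (rule conv_radius_geI_ex')
  fix r :: real assume r: "0 < r" "ereal r < 1"
  then have "r < 1" by (simp add: one_ereal_def)
  show "summable (\<lambda>n. f $ n * of_real r ^ n)"
  proof (rule summable_comparison_test'[OF g[OF r(1) \<open>r < 1\<close>], of 0])
    fix n show "norm (f $ n * of_real r ^ n) \<le> g n * r ^ n"
      using le[of n] r by (simp add: norm_mult norm_power mult_right_mono)
  qed
qed

text \<open>Induction on \<open>K\<close>: applying \<open>fps_X * fps_deriv\<close> multiplies the
  n-th coefficient by n and does not shrink the radius of convergence.\<close>

lemma summable_power_times_geometric:
  assumes "0 < r" "r < 1"
  shows "summable (\<lambda>n. real n ^ K * r ^ n)"
proof -
  have "\<exists>g :: real fps. (\<forall>n. g $ n = real n ^ K) \<and> 1 \<le> fps_conv_radius g"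
  proof (induction K)
    case 0
    have "1 \<le> fps_conv_radius (Abs_fps (\<lambda>n. 1 :: real))"
      unfolding fps_conv_radius_def
      by (rule conv_radius_geI_ex') (auto simp: one_ereal_def intro!: summable_geometric)
    then show ?case by (intro exI[of _ "Abs_fps (\<lambda>n. 1)"]) simp
  next
    case (Suc K)
    then obtain g :: "real fps" where g: "\<forall>n. g $ n = real n ^ K" "1 \<le> fps_conv_radius g" by blast
    have "1 \<le> min (fps_conv_radius (fps_X :: real fps)) (fps_conv_radius (fps_deriv g))"
      using order_trans[OF g(2) fps_conv_radius_deriv] by simp
    then have "1 \<le> fps_conv_radius (fps_X * fps_deriv g)"
      using fps_conv_radius_mult order_trans by blast
    moreover have "(fps_X * fps_deriv g) $ n = real n ^ Suc K" for n
      using g(1) by (cases n) auto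
    ultimately show ?case by blast
  qed
  then obtain g :: "real fps" where g: "\<forall>n. g $ n = real n ^ K" "1 \<le> fps_conv_radius g" by blast
  have "ereal (norm r) < fps_conv_radius g"
    using assms by (intro less_le_trans[OF _ g(2)]) (simp add: one_ereal_def)
  from summable_fps[OF this] g(1) show ?thesis by simp
qed

text \<open>A finite piece of the Euler product: splitting off the copies of one generator
  \<open>x\<close> yields a partial geometric series in \<open>r ^ snd x\<close>.\<close>

lemma sum_monomials_le:
  fixes r :: real
  assumes r: "0 < r" "r < 1"
    and S: "finite S" "\<forall>x\<in>S. snd x \<ge> 1" and F: "finite F" "\<forall>\<nu>\<in>F. set_mset \<nu> \<subseteq> S"
  shows "(\<Sum>\<nu>\<in>F. r ^ wt \<nu>) \<le> (\<Prod>x\<in>S. 1 / (1 - r ^ snd x))"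
  using S F
proof (induction S arbitrary: F rule: finite_induct)
  case empty
  then have "F \<subseteq> {{#}}" by auto
  then have "F = {} \<or> F = {{#}}" by blast
  then show ?case by (auto simp: wt_def)
next
  case (insert x S)
  define N where "N = (\<Sum>\<nu>\<in>F. count \<nu> x)"
  define F' where "F' = filter_mset (\<lambda>y. y \<noteq> x) ` F"
  define h where "h = (\<lambda>(c, \<nu>). replicate_mset c x + \<nu>)"
  have wt_h: "wt (h (c, \<nu>)) = c * snd x + wt \<nu>" for c \<nu>
    by (simp add: h_def wt_def)
  have rx: "r ^ snd x < 1" using r insert.prems by (simp add: power_less_one_iff)
  have sub: "F \<subseteq> h ` ({..N} \<times> F')"
  proof
    fix \<nu> assume \<nu>: "\<nu> \<in> F"
    have "\<nu> = h (count \<nu> x, filter_mset (\<lambda>y. y \<noteq> x) \<nu>)"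
      by (rule multiset_eqI) (auto simp: h_def)
    moreover have "count \<nu> x \<le> N" unfolding N_def by (rule member_le_sum) (use \<nu> insert.prems in auto)
    ultimately show "\<nu> \<in> h ` ({..N} \<times> F')" using \<nu> by (auto simp: F'_def)
  qed
  have F'fin: "finite F'" using insert.prems by (simp add: F'_def)
  have "(\<Sum>\<nu>\<in>F. r ^ wt \<nu>) \<le> (\<Sum>\<nu>\<in>h ` ({..N} \<times> F'). r ^ wt \<nu>)"
    by (rule sum_mono2) (use sub F'fin r in auto)
  also have "\<dots> \<le> (\<Sum>z\<in>{..N} \<times> F'. r ^ wt (h z))"
    using sum_image_le[of "{..N} \<times> F'" "\<lambda>\<nu>. r ^ wt \<nu>" h] F'fin r by (simp add: comp_def)
  also have "\<dots> = (\<Sum>c\<le>N. (r ^ snd x) ^ c) * (\<Sum>\<nu>\<in>F'. r ^ wt \<nu>)"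
    unfolding sum_product sum.cartesian_product
    by (rule sum.cong) (auto simp: wt_h power_add power_mult[symmetric] mult.commute)
  also have "\<dots> \<le> 1 / (1 - r ^ snd x) * (\<Prod>x\<in>S. 1 / (1 - r ^ snd x))"
  proof (rule mult_mono)
    have "(\<Sum>c\<le>N. (r ^ snd x) ^ c) \<le> (\<Sum>c. (r ^ snd x) ^ c)"
      by (rule sum_le_suminf) (use r rx in \<open>auto intro!: summable_geometric\<close>)
    also have "\<dots> = 1 / (1 - r ^ snd x)" by (rule suminf_geometric) (use r rx in auto)
    finally show "(\<Sum>c\<le>N. (r ^ snd x) ^ c) \<le> 1 / (1 - r ^ snd x)" .
    show "(\<Sum>\<nu>\<in>F'. r ^ wt \<nu>) \<le> (\<Prod>x\<in>S. 1 / (1 - r ^ snd x))"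
      by (rule insert.IH) (use insert.prems F'fin in \<open>auto simp: F'_def\<close>)
    show "0 \<le> 1 / (1 - r ^ snd x)" using rx by simp
    show "0 \<le> (\<Sum>\<nu>\<in>F'. r ^ wt \<nu>)" using r by (intro sum_nonneg) auto
  qed
  finally show ?case using insert.hyps by simp
qed

text \<open>With t = r^m \<le> r one has 1/(1-t) \<le> 1 + t/(1-r) \<le> exp(t/(1-r)), and the
  exponents sum to a bound uniform in \<open>N\<close>.\<close>

lemma prod_generators_le:
  fixes r :: real
  assumes r: "0 < r" "r < 1"
  shows "(\<Prod>x\<in>{1..k} \<times> {1..N}. 1 / (1 - r ^ snd x)) \<le> exp (real k * (1 / (1 - r) * (1 / (1 - r))))"
proof -
  have rm: "r ^ m \<le> r" "0 < r ^ m" if "m \<ge> 1" for m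
    using r that power_decreasing[of 1 m r] by auto
  have "(\<Prod>x\<in>{1..k} \<times> {1..N}. 1 / (1 - r ^ snd x)) \<le> (\<Prod>x\<in>{1..k} \<times> {1..N}. exp (r ^ snd x * (1 / (1 - r))))"
  proof (rule prod_mono, intro conjI)
    fix x :: "nat \<times> nat" assume "x \<in> {1..k} \<times> {1..N}"
    then have m: "r ^ snd x \<le> r" "0 < r ^ snd x" using rm by auto
    show "0 \<le> 1 / (1 - r ^ snd x)" using m r by simp
    have "1 / (1 - r ^ snd x) = 1 + r ^ snd x / (1 - r ^ snd x)" using m r by (simp add: field_simps)
    also have "\<dots> \<le> 1 + r ^ snd x / (1 - r)" using m r by (intro add_left_mono divide_left_mono) auto
    also have "\<dots> \<le> exp (r ^ snd x * (1 / (1 - r)))" using exp_ge_add_one_self by simp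
    finally show "1 / (1 - r ^ snd x) \<le> exp (r ^ snd x * (1 / (1 - r)))" .
  qed
  also have "\<dots> = exp (\<Sum>x\<in>{1..k} \<times> {1..N}. r ^ snd x * (1 / (1 - r)))"
    by (simp add: exp_sum)
  also have "(\<Sum>x\<in>{1..k} \<times> {1..N}. r ^ snd x * (1 / (1 - r))) = real k * ((\<Sum>m=1..N. r ^ m) * (1 / (1 - r)))"
  proof -
    have "(\<Sum>x\<in>{1..k} \<times> {1..N}. r ^ snd x * (1 / (1 - r))) = (\<Sum>j=1..k. \<Sum>m=1..N. r ^ m * (1 / (1 - r)))"
      by (simp only: sum.cartesian_product case_prod_unfold)
    then show ?thesis by (simp add: sum_distrib_right sum_divide_distrib)
  qed
  also have "\<dots> \<le> real k * (1 / (1 - r) * (1 / (1 - r)))"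
  proof (intro mult_left_mono mult_right_mono)
    have "(\<Sum>m=1..N. r ^ m) \<le> (\<Sum>m. r ^ m)"
      by (rule sum_le_suminf) (use r in \<open>auto intro!: summable_geometric\<close>)
    also have "\<dots> = 1 / (1 - r)" by (rule suminf_geometric) (use r in auto)
    finally show "(\<Sum>m=1..N. r ^ m) \<le> 1 / (1 - r)" .
  qed (use r in auto)
  finally show ?thesis by simp
qed

lemma summable_card_basis_M:
  assumes r: "0 < r" "r < 1"
  shows "summable (\<lambda>N. real (card (basis_M k N)) * r ^ N)"
proof (rule summableI_nonneg_bounded)
  fix N
  have "(\<Sum>M<N. real (card (basis_M k M)) * r ^ M) = (\<Sum>M<N. \<Sum>\<nu>\<in>basis_M k M. r ^ wt \<nu>)"
    by (rule sum.cong) (auto simp: basis_M_def)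
  also have "\<dots> = (\<Sum>\<nu>\<in>(\<Union>M<N. basis_M k M). r ^ wt \<nu>)"
    by (rule sum.UNION_disjoint[symmetric]) (use finite_basis_M in \<open>auto simp: basis_M_def\<close>)
  also have "\<dots> \<le> (\<Prod>x\<in>{1..k} \<times> {1..N}. 1 / (1 - r ^ snd x))"
  proof (rule sum_monomials_le[OF r])
    show "\<forall>\<nu>\<in>(\<Union>M<N. basis_M k M). set_mset \<nu> \<subseteq> {1..k} \<times> {1..N}"
    proof
      fix \<nu> assume "\<nu> \<in> (\<Union>M<N. basis_M k M)"
      then have "wt \<nu> < N" "\<forall>x\<in>#\<nu>. fst x \<in> {1..k} \<and> snd x \<ge> 1" by (auto simp: basis_M_def)
      moreover have "snd x \<le> wt \<nu>" if "x \<in># \<nu>" for x using wt_ge[OF that] .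
      ultimately show "set_mset \<nu> \<subseteq> {1..k} \<times> {1..N}" by (fastforce simp: mem_Times_iff)
    qed
  qed (use finite_basis_M in auto)
  also have "\<dots> \<le> exp (real k * (1 / (1 - r) * (1 / (1 - r))))" by (rule prod_generators_le[OF r])
  finally show "(\<Sum>M<N. real (card (basis_M k M)) * r ^ M) \<le> exp (real k * (1 / (1 - r) * (1 / (1 - r))))" .
qed (use r in auto)

lemma conv_radius_char_series:
  assumes "norm \<epsilon> = 1"
  shows "1 \<le> fps_conv_radius (char_series k \<epsilon>)"
proof (rule fps_conv_radius_ge_1I[OF _ summable_card_basis_M])
  fix N
  have "norm (char_series k \<epsilon> $ N) \<le> (\<Sum>\<nu>\<in>basis_M k N. norm (\<epsilon> ^ size \<nu>))"
    unfolding char_series_def fps_nth_Abs_fps by (rule norm_sum)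
  then show "norm (char_series k \<epsilon> $ N) \<le> real (card (basis_M k N))"
    using assms by (simp add: norm_power)
qed auto

lemma conv_radius_eis_series:
  assumes "norm \<epsilon> = 1"
  shows "1 \<le> fps_conv_radius (eis_series \<epsilon> K)"
proof (cases "even K")
  case True
  let ?b = "\<lambda>t. (if t = 0 then norm (bernoulli_num K / fact K) else 0) + 2 * real t ^ Suc K"
  show ?thesis
  proof (rule fps_conv_radius_ge_1I)
    fix t
    show "norm (eis_series \<epsilon> K $ t) \<le> ?b t"
    proof (cases "t = 0")
      case True
      then show ?thesis using \<open>even K\<close> by (simp add: eis_series_def norm_divide)
    next
      case False
      have fin: "{a. a dvd t} \<subseteq> {1..t}"
      proof
        fix a assume "a \<in> {a. a dvd t}"
        then have "a \<le> t" "a \<noteq> 0" using False by (auto intro: dvd_imp_le)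
        then show "a \<in> {1..t}" by simp
      qed
      have "norm (\<Sum>a | a dvd t. of_nat a ^ (K - 1) * \<epsilon> ^ (t div a)) \<le> (\<Sum>a | a dvd t. norm (of_nat a ^ (K - 1) * \<epsilon> ^ (t div a)))"
        by (rule norm_sum)
      also have "\<dots> = (\<Sum>a | a dvd t. real a ^ (K - 1))"
        using assms by (simp add: norm_mult norm_power)
      also have "\<dots> \<le> (\<Sum>a\<in>{1..t}. real t ^ (K - 1))"
        by (rule sum_mono2[THEN order_trans[rotated]], simp, rule fin, simp, rule sum_mono)
           (use fin in \<open>auto intro!: power_mono\<close>)
      \<comment> \<open>The exponent \<open>Suc K\<close> also covers K = 0, where
        \<open>K - 1\<close> is truncated to 0 and the sum equals t.\<close>
      also have "\<dots> \<le> real t ^ Suc K"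
      proof -
        have "real t ^ (K - 1) \<le> real t ^ K" using False by (intro power_increasing) auto
        then show ?thesis by (simp add: mult_left_mono)
      qed
      finally have S: "norm (\<Sum>a | a dvd t. of_nat a ^ (K - 1) * \<epsilon> ^ (t div a)) \<le> real t ^ Suc K" .
      have "norm (2 / fact (K - 1) :: complex) \<le> 2"
        by (simp add: norm_divide divide_le_eq fact_ge_1)
      then have "norm (2 / fact (K - 1) * (\<Sum>a | a dvd t. of_nat a ^ (K - 1) * \<epsilon> ^ (t div a))) \<le> 2 * real t ^ Suc K"
        unfolding norm_mult using S by (intro mult_mono) auto
      then show ?thesis using False \<open>even K\<close> by (simp add: eis_series_def)
    qed
  next
    fix r :: real assume r: "0 < r" "r < 1"
    have "summable (\<lambda>t. (if t = 0 then norm (bernoulli_num K / fact K) else 0) * r ^ t + 2 * (real t ^ Suc K * r ^ t))"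
      by (intro summable_add summable_mult summable_power_times_geometric[OF r] summable_finite[of "{0}"]) auto
    then show "summable (\<lambda>t. ?b t * r ^ t)" by (simp add: algebra_simps)
  qed
qed (simp add: eis_series_def)

section \<open>Eisenstein series as values of formal series\<close>

lemma norm_nome_less_1: "Im \<tau> > 0 \<Longrightarrow> norm (exp (2 * pi * \<i> * \<tau>)) < 1"
  by (simp add: norm_exp_eq_Re)

lemma eval_eis_series:
  assumes "Im \<tau> > 0"
  shows "eval_fps (eis_series 1 K) (exp (2 * pi * \<i> * \<tau>)) = eisenstein K \<tau>"
proof (cases "even K")
  case True
  let ?q = "exp (2 * pi * \<i> * \<tau>)" and ?f = "eis_series 1 K"
  have rad: "1 \<le> fps_conv_radius ?f" by (rule conv_radius_eis_series) simp
  then have "ereal (norm ?q) < fps_conv_radius ?f"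
    using norm_nome_less_1[OF assms] by (intro less_le_trans[OF _ rad]) (simp add: one_ereal_def)
  then have sm: "summable (\<lambda>n. ?f $ n * ?q ^ n)" by (rule summable_fps)
  define g where "g n = of_nat (divisor_sigma (K - 1) (Suc n)) * ?q ^ Suc n" for n
  have eq: "?f $ Suc n * ?q ^ Suc n = 2 / fact (K - 1) * g n" for n
    using True by (simp add: eis_series_def g_def divisor_sigma_def)
  have "summable (\<lambda>n. ?f $ Suc n * ?q ^ Suc n)" using sm by (subst summable_Suc_iff)
  then have "summable (\<lambda>n. fact (K - 1) / 2 * (2 / fact (K - 1) * g n))" unfolding eq by (rule summable_mult)
  then have smg: "summable g" by simp
  have "eval_fps ?f ?q = (\<Sum>n. ?f $ Suc n * ?q ^ Suc n) + ?f $ 0"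
    unfolding eval_fps_def using suminf_split_head[OF sm] by simp
  also have "\<dots> = 2 / fact (K - 1) * (\<Sum>n. g n) + ?f $ 0"
    unfolding eq using smg by (simp only: suminf_mult)
  finally show ?thesis using True by (simp add: eisenstein_def eis_series_def g_def)
qed (simp add: eis_series_def eisenstein_def)

text \<open>The sign (-1)^(t/a) is 2 minus 1 when t/a is even and 0 minus 1 when it is odd, and the
  divisors a of t with t/a even are the divisors of t/2. At t = 0 the constant c reappears as 2c -
  c.\<close>

lemma eis_series_minus_1_nth:
  "eis_series (-1) K $ t = (if even t then 2 * eis_series 1 K $ (t div 2) else 0) - eis_series 1 K $ t"
proof (cases "odd K \<or> t = 0")
  case False
  then have K: "even K" and t: "t > 0" by auto
  have fin: "finite {a. a dvd t}" using t by simp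
  have "(\<Sum>a | a dvd t. of_nat a ^ (K - 1) * (-1) ^ (t div a)) + (\<Sum>a | a dvd t. of_nat a ^ (K - 1))
     = (\<Sum>a | a dvd t. of_nat a ^ (K - 1) * (if even (t div a) then 2 else 0 :: complex))"
    unfolding sum.distrib[symmetric] by (rule sum.cong) auto
  also have "\<dots> = (\<Sum>a | a dvd t \<and> even (t div a). of_nat a ^ (K - 1) * 2)"
    by (rule sum.mono_neutral_cong_right) (use fin in auto)
  also have "{a. a dvd t \<and> even (t div a)} = (if even t then {a. a dvd t div 2} else {})"
  proof (cases "even t")
    case True
    then obtain s where s: "t = 2 * s" by blast
    have "a dvd t \<and> even (t div a) \<longleftrightarrow> a dvd s" for a
    proof
      assume a: "a dvd t \<and> even (t div a)"
      then obtain b where b: "t = a * b" by blast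
      then have "a > 0" using t by auto
      with a b have "even b" by simp
      then obtain c where "b = 2 * c" by blast
      then have "s = a * c" using b s by simp
      then show "a dvd s" by simp
    next
      assume "a dvd s"
      then obtain c where c: "s = a * c" by blast
      then have "t = a * (2 * c)" "a > 0" using s t by auto
      then show "a dvd t \<and> even (t div a)" by simp
    qed
    then show ?thesis using True s by simp
  next
    case False
    then have "\<not> (a dvd t \<and> even (t div a))" for a by (metis dvd_div_mult_self dvd_mult2)
    then show ?thesis using False by auto
  qed
  finally have main: "(\<Sum>a | a dvd t. of_nat a ^ (K - 1) * (-1) ^ (t div a)) =
     (if even t then 2 * (\<Sum>a | a dvd t div 2. of_nat a ^ (K - 1)) else 0)
      - (\<Sum>a | a dvd t. of_nat a ^ (K - 1) :: complex)"
    by (auto simp: sum_distrib_left algebra_simps)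
  have "even t \<Longrightarrow> t div 2 \<noteq> 0" using t by auto
  moreover have "eis_series (-1) K $ t = 2 / fact (K - 1) *
     ((if even t then 2 * (\<Sum>a | a dvd t div 2. of_nat a ^ (K - 1)) else 0) - (\<Sum>a | a dvd t. of_nat a ^ (K - 1)))"
    using K t unfolding main[symmetric] by (simp add: eis_series_def)
  ultimately show ?thesis
    using K t by (cases "even t") (simp_all add: eis_series_def algebra_simps)
qed (auto simp: eis_series_def)

lemma eval_eis_series_minus_1:
  assumes "Im \<tau> > 0"
  shows "eval_fps (eis_series (-1) K) (exp (2 * pi * \<i> * \<tau>)) = eisF K \<tau>"
proof -
  let ?q = "exp (2 * pi * \<i> * \<tau>)" and ?f = "eis_series 1 K"
  have rad: "1 \<le> fps_conv_radius ?f" by (rule conv_radius_eis_series) simp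
  have less: "ereal (norm (exp (2 * pi * \<i> * \<tau>'))) < fps_conv_radius ?f" if "Im \<tau>' > 0" for \<tau>'
    using norm_nome_less_1[OF that] by (intro less_le_trans[OF _ rad]) (simp add: one_ereal_def)
  have q2: "exp (2 * pi * \<i> * (2 * \<tau>)) = ?q ^ 2"
    by (simp add: exp_double[symmetric] mult_ac)
  have "Im (2 * \<tau>) > 0" using assms by simp
  note e2 = sums_eval_fps[OF less[OF this]] eval_eis_series[OF this, of K]
  have "(\<lambda>n. ?f $ n * (?q ^ 2) ^ n) sums eisenstein K (2 * \<tau>)"
    using e2 unfolding q2 by simp
  \<comment> \<open>Doubling \<tau> squares q, so the series is spread over the even exponents to
    become a series in q.\<close>
  then have "(\<lambda>n. (\<lambda>t. (if even t then ?f $ (t div 2) else 0) * ?q ^ t) (2 * n)) sums eisenstein K (2 * \<tau>)"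
    by (simp add: power_mult)
  then have s2: "(\<lambda>t. (if even t then ?f $ (t div 2) else 0) * ?q ^ t) sums eisenstein K (2 * \<tau>)"
    by (subst (asm) sums_mono_reindex) (auto simp: strict_mono_def elim!: evenE)
  have s1: "(\<lambda>t. ?f $ t * ?q ^ t) sums eisenstein K \<tau>"
    using sums_eval_fps[OF less[OF assms]] eval_eis_series[OF assms, of K] by simp
  have "(\<lambda>t. 2 * ((if even t then ?f $ (t div 2) else 0) * ?q ^ t) - ?f $ t * ?q ^ t) sums (2 * eisenstein K (2 * \<tau>) - eisenstein K \<tau>)"
    by (intro sums_diff sums_mult s1 s2)
  also have "(\<lambda>t. 2 * ((if even t then ?f $ (t div 2) else 0) * ?q ^ t) - ?f $ t * ?q ^ t) = (\<lambda>t. eis_series (-1) K $ t * ?q ^ t)"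
    by (auto simp: eis_series_minus_1_nth algebra_simps)
  finally show ?thesis unfolding eval_fps_def eisF_def by (rule sums_unique[symmetric])
qed

section \<open>Evaluation of sums, products and hafnians of series\<close>

lemma conv_radius_mult_ge_1:
  fixes f g :: "complex fps"
  shows "1 \<le> fps_conv_radius f \<Longrightarrow> 1 \<le> fps_conv_radius g \<Longrightarrow> 1 \<le> fps_conv_radius (f * g)"
  by (meson fps_conv_radius_mult min.boundedI order_trans)

lemma conv_radius_add_ge_1:
  fixes f g :: "complex fps"
  shows "1 \<le> fps_conv_radius f \<Longrightarrow> 1 \<le> fps_conv_radius g \<Longrightarrow> 1 \<le> fps_conv_radius (f + g)"
  by (meson fps_conv_radius_add min.boundedI order_trans)

lemma eval_fps_mult_unit_disc:
  fixes f g :: "complex fps"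
  assumes "1 \<le> fps_conv_radius f" "1 \<le> fps_conv_radius g" "norm q < 1"
  shows "eval_fps (f * g) q = eval_fps f q * eval_fps g q"
  using assms by (intro eval_fps_mult) (auto simp: one_ereal_def intro: less_le_trans[of _ 1])

lemma eval_fps_add_unit_disc:
  fixes f g :: "complex fps"
  assumes "1 \<le> fps_conv_radius f" "1 \<le> fps_conv_radius g" "norm q < 1"
  shows "eval_fps (f + g) q = eval_fps f q + eval_fps g q"
  using assms by (intro eval_fps_add) (auto simp: one_ereal_def intro: less_le_trans[of _ 1])

lemma eval_fps_prod_unit_disc:
  fixes f :: "'a \<Rightarrow> complex fps"
  assumes "\<And>x. x \<in> A \<Longrightarrow> 1 \<le> fps_conv_radius (f x)" "norm q < 1"
  shows "1 \<le> fps_conv_radius (\<Prod>x\<in>A. f x) \<and> eval_fps (\<Prod>x\<in>A. f x) q = (\<Prod>x\<in>A. eval_fps (f x) q)"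
  using assms
  by (induction A rule: infinite_finite_induct) (auto simp: conv_radius_mult_ge_1 eval_fps_mult_unit_disc)

lemma eval_fps_sum_unit_disc:
  fixes f :: "'a \<Rightarrow> complex fps"
  assumes "\<And>x. x \<in> A \<Longrightarrow> 1 \<le> fps_conv_radius (f x)" "norm q < 1"
  shows "1 \<le> fps_conv_radius (\<Sum>x\<in>A. f x) \<and> eval_fps (\<Sum>x\<in>A. f x) q = (\<Sum>x\<in>A. eval_fps (f x) q)"
  using assms
  by (induction A rule: infinite_finite_induct) (auto simp: conv_radius_add_ge_1 eval_fps_add_unit_disc)

lemma eval_fps_Haf:
  fixes f :: "'a::linorder \<Rightarrow> 'a \<Rightarrow> complex fps"
  assumes "\<And>r s. 1 \<le> fps_conv_radius (f r s)" "norm q < 1"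
  shows "1 \<le> fps_conv_radius (Haf f S)" "eval_fps (Haf f S) q = Haf (\<lambda>r s. eval_fps (f r s) q) S"
proof -
  have 1: "1 \<le> fps_conv_radius (\<Prod>r\<in>{r \<in> S. r < \<sigma> r}. f r (\<sigma> r)) \<and>
     eval_fps (\<Prod>r\<in>{r \<in> S. r < \<sigma> r}. f r (\<sigma> r)) q = (\<Prod>r\<in>{r \<in> S. r < \<sigma> r}. eval_fps (f r (\<sigma> r)) q)" for \<sigma>
    by (rule eval_fps_prod_unit_disc) (use assms in auto)
  then have "1 \<le> fps_conv_radius (Haf f S) \<and> eval_fps (Haf f S) q
     = (\<Sum>\<sigma>\<in>fpf S. eval_fps (\<Prod>r\<in>{r \<in> S. r < \<sigma> r}. f r (\<sigma> r)) q)"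
    unfolding Haf_def by (intro eval_fps_sum_unit_disc) (use assms in auto)
  with 1 show "1 \<le> fps_conv_radius (Haf f S)" "eval_fps (Haf f S) q = Haf (\<lambda>r s. eval_fps (f r s) q) S"
    by (auto simp: Haf_def)
qed

lemma conv_radius_hat_series: "norm \<epsilon> = 1 \<Longrightarrow> 1 \<le> fps_conv_radius (hat_series \<epsilon> a b)"
  unfolding hat_series_def by (intro conv_radius_mult_ge_1 conv_radius_eis_series) auto

lemma eval_hat_series:
  assumes "Im \<tau> > 0"
  shows "eval_fps (hat_series 1 a b) (exp (2 * pi * \<i> * \<tau>)) = hatE a b \<tau>"
    and "eval_fps (hat_series (-1) a b) (exp (2 * pi * \<i> * \<tau>)) = hatF a b \<tau>"
proof -
  let ?q = "exp (2 * pi * \<i> * \<tau>)"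
  have "eval_fps (hat_series \<epsilon> a b) ?q = hat_coeff a b * eval_fps (eis_series \<epsilon> (a + b)) ?q"
    if "norm \<epsilon> = 1" for \<epsilon>
    unfolding hat_series_def
    by (subst eval_fps_mult_unit_disc[OF _ _ norm_nome_less_1[OF assms]])
       (use that conv_radius_eis_series in simp_all)
  from this[of 1] this[of "-1"]
  show "eval_fps (hat_series 1 a b) ?q = hatE a b \<tau>" "eval_fps (hat_series (-1) a b) ?q = hatF a b \<tau>"
    unfolding eval_eis_series[OF assms] eval_eis_series_minus_1[OF assms] hatE_def hatF_def hat_coeff_def
    by (simp_all del: of_real_mult)
qed

lemma eval_wick_kernel:
  assumes "Im \<tau> > 0"
  shows "eval_fps (wick_kernel 1 i n r s) (exp (2 * pi * \<i> * \<tau>)) = (if i r = i s then 1 else 0) * hatE (n r) (n s) \<tau>"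
    and "eval_fps (wick_kernel (-1) i n r s) (exp (2 * pi * \<i> * \<tau>)) = (if i r = i s then 1 else 0) * hatF (n r) (n s) \<tau>"
  using eval_hat_series[OF assms] by (auto simp: wick_kernel_def simp del: of_real_mult)

lemma conv_radius_wick_kernel: "norm \<epsilon> = 1 \<Longrightarrow> 1 \<le> fps_conv_radius (wick_kernel \<epsilon> i n r s)"
  by (simp add: wick_kernel_def conv_radius_hat_series)

section \<open>Trace functions of M and its fixed-point subalgebra\<close>

lemma Haf_eq_sum_pair_prod:
  "Haf f {1..p} = (\<Sum>\<sigma>\<in>fpf_involutions p. pair_prod p \<sigma> f)"
  by (simp add: Haf_def fpf_def fpf_involutions_def pair_prod_def)

definition trace_series :: "nat \<Rightarrow> complex \<Rightarrow> vec \<Rightarrow> complex fps" where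
  "trace_series k \<epsilon> u = Abs_fps (\<lambda>N. \<Sum>\<nu>\<in>basis_M k N. \<epsilon> ^ size \<nu> * zero_mode u (basis_vec \<nu>) \<nu>)"

lemma trace_series_sq_state:
  assumes "\<forall>r\<in>{1..p}. n r \<ge> 1" "\<forall>r\<in>{1..p}. i r \<in> {1..k}"
  shows "trace_series k \<epsilon> (sq_state p i n) = char_series k \<epsilon> * Haf (wick_kernel \<epsilon> i n) {1..p}"
  by (rule fps_ext) (simp add: trace_series_def sq_state_trace[OF assms])

lemma trace_series_vac: "trace_series k \<epsilon> vac = char_series k \<epsilon>"
  using trace_series_sq_state[of 0 undefined undefined k \<epsilon>] by (simp add: sq_state_def)

lemma Zfun_eq_eval_fps:
  assumes "\<And>N. (\<Sum>\<nu>\<in>B N. zero_mode u (basis_vec \<nu>) \<nu>) = f $ N" "1 \<le> fps_conv_radius f" "Im \<tau> > 0"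
  shows "Zfun B k u \<tau> = exp (- (2 * pi * \<i> * \<tau> * (of_nat k / 24))) * eval_fps f (exp (2 * pi * \<i> * \<tau>))"
proof -
  let ?q = "exp (2 * pi * \<i> * \<tau>)"
  have "ereal (norm ?q) < fps_conv_radius f"
    using norm_nome_less_1[OF assms(3)] by (intro less_le_trans[OF _ assms(2)]) (simp add: one_ereal_def)
  then have sm: "summable (\<lambda>n. f $ n * ?q ^ n)" by (rule summable_fps)
  \<comment> \<open>The factor q^(-k/24) is a function of \<tau> and not a power series in q, so it
    is kept as a separate exponential.\<close>
  have "exp (2 * pi * \<i> * \<tau> * (of_nat N - of_nat k / 24)) = exp (- (2 * pi * \<i> * \<tau> * (of_nat k / 24))) * ?q ^ N" for N
    by (simp add: exp_of_nat_mult[symmetric] exp_add[symmetric] algebra_simps)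
  then have "Zfun B k u \<tau> = (\<Sum>N. exp (- (2 * pi * \<i> * \<tau> * (of_nat k / 24))) * (f $ N * ?q ^ N))"
    unfolding Zfun_def assms(1) by (simp add: mult_ac)
  then show ?thesis using suminf_mult[OF sm] by (simp add: eval_fps_def)
qed

lemma Z_M_eq_eval_fps:
  assumes "1 \<le> fps_conv_radius (trace_series k 1 u)" "Im \<tau> > 0"
  shows "Z_M k u \<tau> = exp (- (2 * pi * \<i> * \<tau> * (of_nat k / 24))) * eval_fps (trace_series k 1 u) (exp (2 * pi * \<i> * \<tau>))"
  unfolding Z_M_def by (rule Zfun_eq_eval_fps) (use assms in \<open>auto simp: trace_series_def\<close>)

lemma Z_Mplus_eq_eval_fps:
  assumes "1 \<le> fps_conv_radius (trace_series k 1 u)" "1 \<le> fps_conv_radius (trace_series k (-1) u)" "Im \<tau> > 0"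
  shows "Z_Mplus k u \<tau> = exp (- (2 * pi * \<i> * \<tau> * (of_nat k / 24))) *
     ((eval_fps (trace_series k 1 u) (exp (2 * pi * \<i> * \<tau>)) + eval_fps (trace_series k (-1) u) (exp (2 * pi * \<i> * \<tau>))) / 2)"
proof -
  let ?f = "fps_const (1/2) * (trace_series k 1 u + trace_series k (-1) u)"
  have rad: "1 \<le> fps_conv_radius (trace_series k 1 u + trace_series k (-1) u)"
    by (rule conv_radius_add_ge_1[OF assms(1,2)])
  have "(\<Sum>\<nu>\<in>basis_Mplus k N. zero_mode u (basis_vec \<nu>) \<nu>) = ?f $ N" for N
  proof -
    have "(\<Sum>\<nu>\<in>basis_Mplus k N. zero_mode u (basis_vec \<nu>) \<nu>)
       = (\<Sum>\<nu>\<in>basis_M k N. 1/2 * (1 ^ size \<nu> * zero_mode u (basis_vec \<nu>) \<nu> + (-1) ^ size \<nu> * zero_mode u (basis_vec \<nu>) \<nu>))"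
      by (rule sum.mono_neutral_cong_left) (auto simp: basis_Mplus_def finite_basis_M)
    then show ?thesis by (simp add: trace_series_def sum.distrib sum_distrib_left sum_divide_distrib add_divide_distrib)
  qed
  then have "Z_Mplus k u \<tau> = exp (- (2 * pi * \<i> * \<tau> * (of_nat k / 24))) * eval_fps ?f (exp (2 * pi * \<i> * \<tau>))"
    unfolding Z_Mplus_def
    by (rule Zfun_eq_eval_fps) (use assms(3) rad in \<open>auto intro: conv_radius_mult_ge_1\<close>)
  also have "eval_fps ?f (exp (2 * pi * \<i> * \<tau>)) = (eval_fps (trace_series k 1 u) (exp (2 * pi * \<i> * \<tau>)) + eval_fps (trace_series k (-1) u) (exp (2 * pi * \<i> * \<tau>))) / 2"
    using rad assms norm_nome_less_1[OF assms(3)]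
    by (simp add: eval_fps_mult_unit_disc eval_fps_add_unit_disc)
  finally show ?thesis .
qed

theorem theorem7p1:
  fixes k p :: nat and i n :: "nat \<Rightarrow> nat" and \<tau> :: complex
  assumes "even p"
    and "\<forall>r\<in>{1..p}. n r \<ge> 1"
    and "\<forall>r\<in>{1..p}. i r \<in> {1..k}"
    and "Im \<tau> > 0"
  shows "Z_Mplus k (sq_state p i n) \<tau> =
     (\<Sum>\<sigma>\<in>fpf_involutions p.
        pair_prod p \<sigma> (\<lambda>r s. (if i r = i s then 1 else 0) * hatF (n r) (n s) \<tau>))
       * Z_Mplus k vac \<tau>
   + 1/2 * (\<Sum>\<sigma>\<in>fpf_involutions p.
        pair_prod p \<sigma> (\<lambda>r s. (if i r = i s then 1 else 0) * hatE (n r) (n s) \<tau>)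
      - pair_prod p \<sigma> (\<lambda>r s. (if i r = i s then 1 else 0) * hatF (n r) (n s) \<tau>))
       * Z_M k vac \<tau>"
proof -
  let ?q = "exp (2 * pi * \<i> * \<tau>)"
  define HE where "HE = (\<Sum>\<sigma>\<in>fpf_involutions p.
        pair_prod p \<sigma> (\<lambda>r s. (if i r = i s then 1 else 0) * hatE (n r) (n s) \<tau>))"
  define HF where "HF = (\<Sum>\<sigma>\<in>fpf_involutions p.
        pair_prod p \<sigma> (\<lambda>r s. (if i r = i s then 1 else 0) * hatF (n r) (n s) \<tau>))"
  have q: "norm ?q < 1" using norm_nome_less_1 assms(4) by blast
  have Hrad: "1 \<le> fps_conv_radius (Haf (wick_kernel \<epsilon> i n) {1..p})" if "norm \<epsilon> = 1" for \<epsilon>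
    by (rule eval_fps_Haf(1)[OF _ q]) (use conv_radius_wick_kernel that in auto)
  have H: "eval_fps (Haf (wick_kernel 1 i n) {1..p}) ?q = HE" "eval_fps (Haf (wick_kernel (-1) i n) {1..p}) ?q = HF"
    unfolding HE_def HF_def Haf_eq_sum_pair_prod[symmetric]
    by (subst eval_fps_Haf(2); use q conv_radius_wick_kernel eval_wick_kernel[OF assms(4)] in simp)+
  note ts = trace_series_sq_state[OF assms(2,3)] trace_series_vac
  have rad: "1 \<le> fps_conv_radius (trace_series k \<epsilon> (sq_state p i n))" "1 \<le> fps_conv_radius (trace_series k \<epsilon> vac)"
    if "norm \<epsilon> = 1" for \<epsilon>
    unfolding ts using conv_radius_char_series Hrad that by (auto intro: conv_radius_mult_ge_1)
  have ev: "eval_fps (trace_series k 1 (sq_state p i n)) ?q = eval_fps (char_series k 1) ?q * HE"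
    "eval_fps (trace_series k (-1) (sq_state p i n)) ?q = eval_fps (char_series k (-1)) ?q * HF"
    unfolding ts H[symmetric] using conv_radius_char_series Hrad q by (simp_all add: eval_fps_mult_unit_disc)
  have n1: "norm (1 :: complex) = 1" "norm (- 1 :: complex) = 1" by simp_all
  define c C1 C2 where "c = exp (- (2 * pi * \<i> * \<tau> * (of_nat k / 24)))"
    and "C1 = eval_fps (char_series k 1) ?q" and "C2 = eval_fps (char_series k (-1)) ?q"
  have "Z_Mplus k (sq_state p i n) \<tau> = c * ((C1 * HE + C2 * HF) / 2)"
    unfolding Z_Mplus_eq_eval_fps[OF rad(1)[OF n1(1)] rad(1)[OF n1(2)] assms(4)] ev c_def C1_def C2_def ..
  moreover have "Z_Mplus k vac \<tau> = c * ((C1 + C2) / 2)"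
    unfolding Z_Mplus_eq_eval_fps[OF rad(2)[OF n1(1)] rad(2)[OF n1(2)] assms(4)] trace_series_vac c_def C1_def C2_def ..
  moreover have "Z_M k vac \<tau> = c * C1"
    unfolding Z_M_eq_eval_fps[OF rad(2)[OF n1(1)] assms(4)] trace_series_vac c_def C1_def ..
  \<comment> \<open>Writing \<open>HE\<close> as \<open>HF + (HE - HF)\<close> in the \<epsilon> = 1
    trace, the common \<open>HF\<close> multiplies the average of both characters, and the excess
    multiplies only half of the full character of M.\<close>
  ultimately have "Z_Mplus k (sq_state p i n) \<tau> = HF * Z_Mplus k vac \<tau> + 1/2 * (HE - HF) * Z_M k vac \<tau>"
    by (simp add: field_simps)
  then show ?thesis by (simp only: HE_def HF_def sum_subtractf)
qed

end
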